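(* Let $\mathcal{L}$ be a Helmholtz type operator of order $2$ on $\mathbb{S}^2$ having the form $\mathcal{L}=\alpha-\Delta$, with $\alpha>0$, and let $\varPhi_m(x,y)=\phi(x\cdot y)$ be a conditionally positive definite SBF of order $\tilde m$ whose expansion coefficients satisfy $\widehat\phi(\ell)\sim \ell^{-2m}$ for all $\ell>\tilde m$. Then $\mathbf{M}_{X_N}$ is invertible and has the stability bound $$\|\mathbf{M}_{X_N}^{-1}\|_{2\to 2}\le C q^{2-2m},$$ with $C$ a constant which depends on $\varPhi_m$ and the mesh ratio $\rho=h/q$ of $X_N$.
   Context: $\mathbb{S}^2$ is the unit sphere in $\mathbb{R}^3$ with geodesic distance $\operatorname{dist}(x,y)=\arccos(x\cdot y)$, and $\Delta$ is its Laplace-Beltrami operator, with eigenvalues $\nu_\ell=-\ell(\ell+1)$. $\{Y_\ell^\mu: |\mu|\le \ell\}$ is the standard real $L_2(\mathbb{S}^2)$-orthonormal basis of spherical harmonics of degree $\ell$. $\Pi_{\tilde m}=\operatorname{span}\{Y_\ell^\mu:\ell\le\tilde m,|\mu|\le\ell\}$ has dimension $N_{\tilde m}=(\tilde m+1)^2$. For a finite set $X_N=\{x_1,\dots,x_N\}\subset\mathbb{S}^2$: the fill distance is $h=\max_{x\in\mathbb{S}^2}\min_{j}\operatorname{dist}(x,x_j)$, the separation radius is $q=\frac12\min_{j\ne k}\operatorname{dist}(x_j,x_k)$, and the mesh ratio is $\rho=h/q$. Point sets are quasi-uniformly distributed: there is a fixed constant $\rho_0$ with $\rho\le\rho_0$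 for all point sets considered. An SBF (spherical basis function) is a kernel $\varPhi(x,y)=\phi(x\cdot y)$ with $\phi:[-1,1]\to\mathbb{R}$ continuous and with expansion $\varPhi(x,y)=\sum_{\ell\ge0}\sum_{|\mu|\le\ell}\widehat\phi(\ell)Y_\ell^\mu(x)Y_\ell^\mu(y)$. It is conditionally positive definite of order $\tilde m$ if $\sum_{j,k}a_ja_k\varPhi(x_j,x_k)>0$ for every nonzero coefficient vector $a$ with $\sum_j a_jP(x_j)=0$ for all $P\in\Pi_{\tilde m}$. By convention, order $\tilde m=-1$ means strictly positive definite, with $\Pi_{-1}=\{0\}$. The relation $\widehat\phi(\ell)\sim\ell^{-2m}$ means that the ratio of the two sides lies between two positive constants (for $\ell=0$, which matters only if $\tilde m=-1$, it just means $\widehat\phi(0)>0$). Set $S(X_N)=\{\sum_jA_j\varPhi_m(\cdot,x_j):\sum_jA_jP(x_j)=0\ \forall P\in\Pi_{\tilde m}\}+\Pi_{\tilde m}$. With $\mathbf{\Phi}_{X_N}=(\varPhi_m(x_j,x_k))_{j,k}$ and $\mathbf{P}=(P_k(x_j))_{j\le N,\,k\le N_{\tilde m}}$ for a basis $\{P_k\}$ of $\Pi_{\tilde m}$, the augmented interpolation matrix $\begin{pmatrix}\mathbf{\Phi}_{X_N}&\mathbf{P}\\ \mathbf{P}^T&\mathbf{0}\end{pmatrix}$ is taken to be nonsingular, so that each data vector on $X_N$ has a unique interpolant in $S(X_N)$. The Lagrange functions $\chi_{x_j}\in S(X_N)$ are defined by $\chi_{x_j}(x_k)=\delta_{j,k}$.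 The (full) FD matrix is $\mathbf{M}_{X_N}\in\mathbb{R}^{N\times N}$ with entry $(\mathcal{L}\chi_{x_j})(x_i)$ in row $i$, column $j$. $\|\cdot\|_{2\to2}$ is the operator norm on $\ell_2$.
   Formalization: For order m̃ ≥ 1 the norm bound (not invertibility) is claimed only for fill distance h ≤ h0, with h0 > 0 fixed independently of the point set: near-degenerate coarse sets refute the uniform bound. Also m > 2 is assumed, so that the entries of M are defined. *)

theory Defs
  imports "HOL-Analysis.Analysis" "HOL-Computational_Algebra.Polynomial" "Jordan_Normal_Form.Matrix"
begin

abbreviation S2 :: "(real ^ 3) set"
  where "S2 \<equiv> sphere 0 1"

definition geodesic_dist :: "real ^ 3 \<Rightarrow> real ^ 3 \<Rightarrow> real"
  where "geodesic_dist x y = arccos (inner x y)"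

definition fill_distance :: "(real ^ 3) set \<Rightarrow> real"
  where "fill_distance X = (SUP x\<in>S2. Min (geodesic_dist x ` X))"

definition separation_radius :: "(real ^ 3) set \<Rightarrow> real"
  where "separation_radius X = Min {geodesic_dist x y | x y. x \<in> X \<and> y \<in> X \<and> x \<noteq> y} / 2"

definition mesh_ratio :: "(real ^ 3) set \<Rightarrow> real"
  where "mesh_ratio X = fill_distance X / separation_radius X"

(* Rodrigues' formula. *)
definition legendre_poly :: "nat \<Rightarrow> real poly"
  where "legendre_poly l = Polynomial.smult (1 / (2 ^ l * fact l)) ((pderiv ^^ l) ([:- 1, 0, 1:] ^ l))"

(* Real orthonormal spherical harmonics in Cartesian coordinates, meaningful for |mu| <= l. With
   colatitude theta and longitude psi, sin(theta)^k * cos(k * psi) and sin(theta)^k * sin(k * psi)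
   are the real and imaginary parts of (x1 + i x2)^k, and sin(theta)^k times the k-th derivative of
   the Legendre polynomial at cos(theta) = x3 is the associated Legendre function, without the
   Condon-Shortley sign. Off the sphere the formula gives a polynomial extension. *)
definition sph_harm :: "nat \<Rightarrow> int \<Rightarrow> real ^ 3 \<Rightarrow> real"
  where "sph_harm l \<mu> x =
    (let k = nat \<bar>\<mu>\<bar>; w = Complex (vec_nth x 1) (vec_nth x 2) in
      sqrt ((2 * real l + 1) / (4 * pi) * fact (l - k) / fact (l + k))
      * poly ((pderiv ^^ k) (legendre_poly l)) (vec_nth x 3)
      * (if \<mu> = 0 then 1 else if \<mu> > 0 then sqrt 2 * Re (w ^ k) else sqrt 2 * Im (w ^ k)))"

(* The basis of the spherical polynomials of degree at most mt, ordered by degree. The degree is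
   an integer so that mt = -1 gives the zero space. *)
definition sph_basis :: "int \<Rightarrow> (real ^ 3 \<Rightarrow> real) list"
  where "sph_basis mt = concat (map (\<lambda>l. map (sph_harm l) [- int l..int l]) [0..<nat (mt + 1)])"

definition sph_polys :: "int \<Rightarrow> (real ^ 3 \<Rightarrow> real) set"
  where "sph_polys mt =
    {\<lambda>x. \<Sum>k<length (sph_basis mt). b k * (sph_basis mt ! k) x | b. True}"

definition is_SBF :: "(real \<Rightarrow> real) \<Rightarrow> (nat \<Rightarrow> real) \<Rightarrow> bool"
  where "is_SBF \<phi> \<phi>hat \<longleftrightarrow> continuous_on {-1..1} \<phi> \<and>
    (\<forall>x\<in>S2. \<forall>y\<in>S2.
      (\<lambda>l. \<Sum>\<mu>\<in>{- int l..int l}. \<phi>hat l * sph_harm l \<mu> x * sph_harm l \<mu> y) sums \<phi> (inner x y))"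

definition cond_pos_def :: "(real \<Rightarrow> real) \<Rightarrow> int \<Rightarrow> bool"
  where "cond_pos_def \<phi> mt \<longleftrightarrow>
    (\<forall>X a. finite X \<longrightarrow> X \<subseteq> S2 \<longrightarrow> (\<exists>x\<in>X. a x \<noteq> 0) \<longrightarrow>
      (\<forall>P\<in>sph_polys mt. (\<Sum>x\<in>X. a x * P x) = 0) \<longrightarrow>
      (\<Sum>x\<in>X. \<Sum>y\<in>X. a x * a y * \<phi> (inner x y)) > 0)"

definition coeffs_decay :: "(nat \<Rightarrow> real) \<Rightarrow> int \<Rightarrow> real \<Rightarrow> bool"
  where "coeffs_decay \<phi>hat mt m \<longleftrightarrow>
    (\<exists>c1>0. \<exists>c2>0. \<forall>l. int l > mt \<longrightarrow>
      (if l = 0 then \<phi>hat 0 > 0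
       else c1 \<le> \<phi>hat l / real l powr (- 2 * m) \<and> \<phi>hat l / real l powr (- 2 * m) \<le> c2))"

definition kernel_space :: "(real \<Rightarrow> real) \<Rightarrow> int \<Rightarrow> (real ^ 3) set \<Rightarrow> (real ^ 3 \<Rightarrow> real) set"
  where "kernel_space \<phi> mt X =
    {\<lambda>x. (\<Sum>y\<in>X. A y * \<phi> (inner x y)) + p x | A p.
      p \<in> sph_polys mt \<and> (\<forall>P\<in>sph_polys mt. (\<Sum>y\<in>X. A y * P y) = 0)}"

definition augmented_matrix :: "(real \<Rightarrow> real) \<Rightarrow> int \<Rightarrow> (real ^ 3) list \<Rightarrow> real mat"
  where "augmented_matrix \<phi> mt xs =
    (let N = length xs; K = length (sph_basis mt);
         Phi = mat N N (\<lambda>(i, j). \<phi> (inner (xs ! i) (xs ! j)));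
         P = mat N K (\<lambda>(i, k). (sph_basis mt ! k) (xs ! i))
     in four_block_mat Phi P (transpose_mat P) (0\<^sub>m K K))"

(* Unique whenever the augmented matrix is nonsingular. *)
definition lagrange_fun :: "(real \<Rightarrow> real) \<Rightarrow> int \<Rightarrow> (real ^ 3) set \<Rightarrow> real ^ 3 \<Rightarrow> real ^ 3 \<Rightarrow> real"
  where "lagrange_fun \<phi> mt X x =
    (THE f. f \<in> kernel_space \<phi> mt X \<and> (\<forall>y\<in>X. f y = (if y = x then 1 else 0)))"

definition laplacian :: "(real ^ 3 \<Rightarrow> real) \<Rightarrow> real ^ 3 \<Rightarrow> real"
  where "laplacian F x = (\<Sum>b\<in>Basis. (deriv ^^ 2) (\<lambda>t. F (x + t *\<^sub>R b)) 0)"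

(* Laplace-Beltrami operator on the sphere: the Euclidean Laplacian of the extension that is
   constant along rays. Only the values of f on the sphere enter. *)
definition laplace_beltrami :: "(real ^ 3 \<Rightarrow> real) \<Rightarrow> real ^ 3 \<Rightarrow> real"
  where "laplace_beltrami f x = laplacian (\<lambda>y. f (y /\<^sub>R norm y)) x"

definition helmholtz :: "real \<Rightarrow> (real ^ 3 \<Rightarrow> real) \<Rightarrow> real ^ 3 \<Rightarrow> real"
  where "helmholtz \<alpha> f x = \<alpha> * f x - laplace_beltrami f x"

definition FD_matrix :: "real \<Rightarrow> (real \<Rightarrow> real) \<Rightarrow> int \<Rightarrow> (real ^ 3) list \<Rightarrow> real mat"
  where "FD_matrix \<alpha> \<phi> mt xs = mat (length xs) (length xs)
    (\<lambda>(i, j). helmholtz \<alpha> (lagrange_fun \<phi> mt (set xs) (xs ! j)) (xs ! i))"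

definition l2_norm_vec :: "real Matrix.vec \<Rightarrow> real"
  where "l2_norm_vec v = sqrt (scalar_prod v v)"

definition l2_op_norm :: "real mat \<Rightarrow> real"
  where "l2_op_norm A =
    (SUP v\<in>carrier_vec (dim_col A) - {0\<^sub>v (dim_col A)}. l2_norm_vec (A *\<^sub>v v) / l2_norm_vec v)"

end

(*
  A function of the interpolation space is s = sum_j A_j Phi(., x_j) + p with A annihilating the
  spherical polynomials, and w = (L s)|X equals Psi A + (L p)|X, where Psi is the zonal kernel with
  coefficients (alpha + l(l+1)) phihat(l), of order l^(2-2m). Pairing w with A removes the
  polynomial part, so |A| is controlled by |w| once the quadratic form of Psi is bounded below on
  such A.

  For that bound, compare Psi with the kernel ((1 + x.y)/2)^M, M ~ 1/q^2. Its Legendre coefficients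
  are explicit positive numbers that decay like exp(-l^2/M)/M, hence are at most a multiple of
  M^(m-2) l^(2-2m); its off-diagonal entries decay like exp(-M |x-y|^2/4), so that its matrix on X
  is diagonally dominant. This gives |A| <= C M^(m-2) |w|. The same kernel, tested on the constant
  vector, gives N <= 3M. Hence |Phi A| <= C N |A| <= C M^(m-1) |w|, and p is controlled by the
  values of L p = w - Psi A on X, since for small fill distance X is a norming set. The linear
  independence of the spherical harmonics needed there is read off the assumed nonsingularity of
  one augmented matrix.
*)
theory Submission
  imports Defs "Jordan_Normal_Form.Determinant"
begin

text \<open>Three obstacles shape the details. The harmonics and Legendre polynomials are given by
  explicit formulas, so the addition theorem has to be derived: the cosine sum in it is shown to
  obey Bonnet's recurrence, degree by degree. It turns the quadratic form of each zonal kernel into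
  a sum over degrees of nonnegative energies, which is what allows two kernels to be compared
  coefficient by coefficient. L has to be applied termwise to the kernel series. Since
  \<open>legendre''\<close> grows like l^4 at the ends of [-1, 1], a direct estimate would ask for m
  > 3. Along a curve on the sphere, however, the squared derivative of x.y is at most a multiple of
  1 - (x.y)^2, and with this weight the Legendre equation leaves only l^2, so that m > 2 is enough.
  L multiplies different degrees by different factors, so the passage from L p to p goes through the
  coefficients of p, and these are controlled by values on X only when X is fine. For mt <= 0 at
  most constants occur, on which L is multiplication by \<alpha>; hence the fill distance is
  restricted only for mt >= 1.\<close>

section \<open>Legendre polynomials\<close>

text \<open>For k = 0 the truncated difference k - 1 is harmless: its coefficient vanishes.\<close>

lemma higher_pderiv_x_mult:
  fixes p :: "'a :: {comm_semiring_1,semiring_no_zero_divisors} poly"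
  shows "(pderiv ^^ k) ([:0, 1:] * p) = [:0, 1:] * (pderiv ^^ k) p + Polynomial.smult (of_nat k) ((pderiv ^^ (k - 1)) p)"
proof (induction k)
  case (Suc k)
  show ?case
  proof (cases k)
    case (Suc j)
    then show ?thesis using Suc.IH
      by (simp add: pderiv_add pderiv_smult pderiv_pCons smult_add_left algebra_simps)
  qed (simp add: pderiv_pCons add.commute)
qed simp

text \<open>Leibniz' rule for a quadratic factor stops after three terms; it comes from applying the
  rule for \<open>[:0, 1:]\<close> twice. Where k - 1 or k - 2 is truncated, the coefficient is
  zero.\<close>

lemma higher_pderiv_one_minus_sq_mult:
  fixes p :: "real poly"
  shows "(pderiv ^^ k) ([:- 1, 0, 1:] * p) = [:- 1, 0, 1:] * (pderiv ^^ k) p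
    + Polynomial.smult (2 * real k) ([:0, 1:] * (pderiv ^^ (k - 1)) p)
    + Polynomial.smult (real k * (real k - 1)) ((pderiv ^^ (k - 2)) p)"
proof -
  obtain X :: "real poly" where X: "X = [:0, 1:]" by blast
  have u: "[:- 1, 0, 1:] = X * X - 1" by (simp add: X one_pCons)
  have eq: "[:- 1, 0, 1:] * p = X * (X * p) + Polynomial.smult (-1) p" for p :: "real poly"
    by (simp add: u algebra_simps)
  have Xm: "(pderiv ^^ k) (X * p) = X * (pderiv ^^ k) p + Polynomial.smult (real k) ((pderiv ^^ (k - 1)) p)"
    for k and p :: "real poly"
    unfolding X by (rule higher_pderiv_x_mult)
  have k: "real k * real (k - 1) = real k * (real k - 1)" "k - 1 - 1 = k - 2"
    by (cases k; simp)+
  have "(pderiv ^^ k) ([:- 1, 0, 1:] * p) = X * (X * (pderiv ^^ k) p + Polynomial.smult (real k) ((pderiv ^^ (k - 1)) p))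
    + Polynomial.smult (real k) (X * (pderiv ^^ (k - 1)) p + Polynomial.smult (real (k - 1)) ((pderiv ^^ (k - 2)) p))
    + Polynomial.smult (-1) ((pderiv ^^ k) p)"
    unfolding eq by (simp only: higher_pderiv_add higher_pderiv_smult Xm k)
  also have "\<dots> = [:- 1, 0, 1:] * (pderiv ^^ k) p
    + Polynomial.smult (2 * real k) (X * (pderiv ^^ (k - 1)) p)
    + Polynomial.smult (real k * (real k - 1)) ((pderiv ^^ (k - 2)) p)"
    unfolding eq by (simp add: poly_eq_poly_eq_iff[symmetric] fun_eq_iff algebra_simps)
      (cases k; simp add: algebra_simps)
  finally show ?thesis unfolding X .
qed

lemma pderiv_sq_minus_one_power:
  "pderiv ([:- 1, 0, 1:] ^ Suc n :: real poly) = Polynomial.smult (2 * real (Suc n)) ([:0, 1:] * [:- 1, 0, 1:] ^ n)"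
proof -
  have "pderiv [:- 1, 0, 1 :: real:] = Polynomial.smult 2 [:0, 1:]" by (simp add: pderiv_pCons)
  then show ?thesis by (simp only: pderiv_power_Suc mult_smult_left mult_smult_right smult_smult mult.commute)
qed

abbreviation legendre :: "nat \<Rightarrow> real \<Rightarrow> real"
  where "legendre l \<equiv> poly (legendre_poly l)"

abbreviation legendre' :: "nat \<Rightarrow> real \<Rightarrow> real"
  where "legendre' l \<equiv> poly (pderiv (legendre_poly l))"

abbreviation legendre'' :: "nat \<Rightarrow> real \<Rightarrow> real"
  where "legendre'' l \<equiv> poly (pderiv (pderiv (legendre_poly l)))"

abbreviation legendre_deriv :: "nat \<Rightarrow> nat \<Rightarrow> real \<Rightarrow> real"
  where "legendre_deriv l k t \<equiv> poly ((pderiv ^^ k) (legendre_poly l)) t"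

text \<open>Rodrigues' formula is differentiated once more, the innermost derivative turning u^(n+1)
  into 2 (n+1) x u^n; Leibniz' rule for the factor x then leaves two terms.\<close>

lemma pderiv_legendre_poly_Suc:
  "pderiv (legendre_poly (Suc n)) =
    [:0, 1:] * pderiv (legendre_poly n) + Polynomial.smult (real (Suc n)) (legendre_poly n)"
proof -
  let ?u = "[:- 1, 0, 1:] :: real poly"
  have "(pderiv ^^ Suc (Suc n)) (?u ^ Suc n) =
      Polynomial.smult (2 * real (Suc n)) ((pderiv ^^ Suc n) ([:0, 1:] * ?u ^ n))"
    by (simp only: funpow_Suc_right o_apply pderiv_sq_minus_one_power pderiv_smult higher_pderiv_smult)
  then have *: "(pderiv ^^ Suc (Suc n)) (?u ^ Suc n) =
      Polynomial.smult (2 * real (Suc n)) ([:0, 1:] * (pderiv ^^ Suc n) (?u ^ n)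
        + Polynomial.smult (real (Suc n)) ((pderiv ^^ n) (?u ^ n)))"
    by (simp only: higher_pderiv_x_mult diff_Suc_1 of_nat_Suc)
  have c: "(1 / (2 ^ Suc n * fact (Suc n))) * (2 * real (Suc n)) = 1 / (2 ^ n * fact n)"
  proof -
    have "(2::real) ^ Suc n * fact (Suc n) = (2 * real (Suc n)) * (2 ^ n * fact n)" by simp
    moreover have "2 * real (Suc n) \<noteq> 0" by simp
    ultimately show ?thesis by (simp del: of_nat_Suc fact_Suc power_Suc)
  qed
  have "pderiv (legendre_poly (Suc n)) = Polynomial.smult (1 / (2 ^ Suc n * fact (Suc n))) ((pderiv ^^ Suc (Suc n)) (?u ^ Suc n))"
    by (simp only: legendre_poly_def pderiv_smult funpow.simps(2) o_apply)
  also have "\<dots> = Polynomial.smult (1 / (2 ^ n * fact n)) ([:0, 1:] * (pderiv ^^ Suc n) (?u ^ n)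
        + Polynomial.smult (real (Suc n)) ((pderiv ^^ n) (?u ^ n)))"
    by (simp only: * smult_smult c)
  also have "\<dots> = [:0, 1:] * pderiv (legendre_poly n) + Polynomial.smult (real (Suc n)) (legendre_poly n)"
    by (simp only: legendre_poly_def pderiv_smult funpow.simps(2) o_apply smult_add_right
        mult_smult_right smult_smult mult.commute)
  finally show ?thesis .
qed

text \<open>With u = x^2 - 1, the power v = u^n satisfies u v' = 2 n x v. Differentiating this n + 1
  times gives Legendre's equation for the n-th derivative of v.\<close>

lemma legendre_poly_ode:
  "[:- 1, 0, 1:] * (pderiv ^^ 2) (legendre_poly n) + Polynomial.smult 2 ([:0, 1:] * pderiv (legendre_poly n)) =
    Polynomial.smult (real n * (real n + 1)) (legendre_poly n)"
proof -
  let ?u = "[:- 1, 0, 1:] :: real poly"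
  let ?v = "?u ^ n"
  let ?D = "\<lambda>k. (pderiv ^^ k) ?v"
  have "?u * pderiv ?v = Polynomial.smult (2 * real n) ([:0, 1:] * ?v)"
  proof (cases n)
    case (Suc k)
    show ?thesis unfolding Suc pderiv_sq_minus_one_power
      by (simp only: power_Suc mult_smult_right mult.left_commute)
  qed simp
  then have "(pderiv ^^ Suc n) (?u * pderiv ?v) = (pderiv ^^ Suc n) (Polynomial.smult (2 * real n) ([:0, 1:] * ?v))"
    by (rule arg_cong)
  moreover have "(pderiv ^^ k) (pderiv ?v) = ?D (Suc k)" for k
    by (simp only: funpow_Suc_right o_apply)
  \<comment> \<open>For n = 0 the index \<open>Suc n - 2\<close> is truncated, so the two
    derivatives differ, but both carry the factor n.\<close>
  moreover have "Polynomial.smult (real (Suc n) * (real (Suc n) - 1)) (?D (Suc (Suc n - 2))) =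
      Polynomial.smult (real (Suc n) * real n) (?D n)"
    by (cases n) (simp_all del: funpow.simps power_Suc)
  ultimately have "?u * ?D (Suc (Suc n)) + Polynomial.smult (2 * real (Suc n)) ([:0, 1:] * ?D (Suc n))
      + Polynomial.smult (real (Suc n) * real n) (?D n)
     = Polynomial.smult (2 * real n) ([:0, 1:] * ?D (Suc n) + Polynomial.smult (real (Suc n)) (?D n))"
    by (simp only: higher_pderiv_one_minus_sq_mult higher_pderiv_smult higher_pderiv_x_mult diff_Suc_1)
  then have *: "?u * ?D (Suc (Suc n)) + Polynomial.smult 2 ([:0, 1:] * ?D (Suc n)) =
      Polynomial.smult (real n * (real n + 1)) (?D n)"
    by (simp add: poly_eq_poly_eq_iff[symmetric] fun_eq_iff algebra_simps del: funpow.simps)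
  show ?thesis
    using arg_cong[OF *, of "Polynomial.smult (1 / (2 ^ n * fact n))"]
    by (simp add: legendre_poly_def pderiv_smult numeral_2_eq_2 smult_add_right mult.commute)
qed

text \<open>A zero of order n survives fewer than n derivatives. The cofactor q carries the
  induction: the derivative of q p^n is again a multiple of p^(n-1).\<close>

lemma poly_higher_pderiv_power_eq_0:
  fixes p :: "'a :: {idom, semiring_char_0} poly"
  assumes "poly p a = 0" "j < n"
  shows "poly ((pderiv ^^ j) (q * p ^ n)) a = 0"
  using assms(2)
proof (induction j arbitrary: n q)
  case 0
  then show ?case using assms(1) by (simp add: power_0_left)
next
  case (Suc j)
  then obtain m where n: "n = Suc m" "j < m" by (cases n) auto
  have "pderiv (q * p ^ n) = (pderiv q * p + Polynomial.smult (of_nat n) (q * pderiv p)) * p ^ m"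
    by (simp only: n(1) pderiv_mult pderiv_power_Suc) (simp add: algebra_simps)
  then show ?case using Suc.IH[OF n(2)]
    by (simp only: funpow_Suc_right o_apply)
qed

text \<open>At 1 the second Leibniz term vanishes, because n - 1 derivatives do not exhaust the zero
  of u^n; the remaining term passes the normalisation from n to n + 1.\<close>

lemma poly_legendre_poly_1: "legendre n 1 = 1"
proof (induction n)
  case (Suc n)
  let ?u = "[:- 1, 0, 1:] :: real poly"
  have "(pderiv ^^ Suc n) (?u ^ Suc n) =
      Polynomial.smult (2 * real (Suc n)) ((pderiv ^^ n) ([:0, 1:] * ?u ^ n))"
    by (simp only: funpow_Suc_right o_apply pderiv_sq_minus_one_power pderiv_smult higher_pderiv_smult)
  then have *: "(pderiv ^^ Suc n) (?u ^ Suc n) =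
      Polynomial.smult (2 * real (Suc n)) ([:0, 1:] * (pderiv ^^ n) (?u ^ n)
        + Polynomial.smult (real n) ((pderiv ^^ (n - 1)) (?u ^ n)))"
    by (simp only: higher_pderiv_x_mult)
  have "real n * poly ((pderiv ^^ (n - 1)) (?u ^ n)) 1 = 0"
    using poly_higher_pderiv_power_eq_0[of ?u 1 "n - 1" n 1] by (cases n) auto
  then have "poly ((pderiv ^^ Suc n) (?u ^ Suc n)) 1 = 2 * real (Suc n) * poly ((pderiv ^^ n) (?u ^ n)) 1"
    unfolding * by simp
  moreover have "poly ((pderiv ^^ n) (?u ^ n)) 1 = 2 ^ n * fact n"
    using Suc by (simp add: legendre_poly_def field_simps)
  ultimately show ?case
    unfolding legendre_poly_def poly_smult by (simp del: funpow.simps)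
qed (simp add: legendre_poly_def)

text \<open>The difference W of the two sides has derivative zero by Legendre's equation and
  vanishes at 1.\<close>

lemma legendre_poly_Suc:
  "Polynomial.smult (real (Suc n)) (legendre_poly (Suc n)) =
    Polynomial.smult (real (Suc n)) ([:0, 1:] * legendre_poly n) + [:- 1, 0, 1:] * pderiv (legendre_poly n)"
proof -
  let ?P = "legendre_poly n"
  define W where "W = Polynomial.smult (real (Suc n)) (legendre_poly (Suc n)) -
    (Polynomial.smult (real (Suc n)) ([:0, 1:] * ?P) + [:- 1, 0, 1:] * pderiv ?P)"
  have "poly (pderiv W) t = 0" for t
  proof -
    have "poly (pderiv W) t = real (Suc n) * real n * poly ?P t
        - poly ([:- 1, 0, 1:] * (pderiv ^^ 2) ?P + Polynomial.smult 2 ([:0, 1:] * pderiv ?P)) t"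
      by (simp add: W_def pderiv_diff pderiv_smult pderiv_add pderiv_mult pderiv_pCons numeral_2_eq_2
          pderiv_legendre_poly_Suc) (simp add: algebra_simps)
    then show ?thesis unfolding legendre_poly_ode by simp
  qed
  then have "pderiv W = 0" using poly_eq_poly_eq_iff[of "pderiv W" 0] by (auto simp: fun_eq_iff)
  then obtain c where c: "W = [:c:]" using pderiv_iszero by blast
  have "poly W 1 = 0" by (simp add: W_def poly_legendre_poly_1)
  then have "W = 0" using c by simp
  then show ?thesis by (simp only: W_def right_minus_eq)
qed

text \<open>Legendre's equation differentiated k times; (l - k)(l + k + 1) is l(l+1) -
  k(k+1).\<close>

lemma legendre_deriv_ode:
  "(1 - t\<^sup>2) * legendre_deriv l (k + 2) t - 2 * (real k + 1) * t * legendre_deriv l (k + 1) t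
    + (real l - real k) * (real l + real k + 1) * legendre_deriv l k t = 0"
proof -
  have "(pderiv ^^ k) ([:- 1, 0, 1:] * (pderiv ^^ 2) (legendre_poly l) + Polynomial.smult 2 ([:0, 1:] * pderiv (legendre_poly l)))
    = (pderiv ^^ k) (Polynomial.smult (real l * (real l + 1)) (legendre_poly l))"
    by (simp only: legendre_poly_ode)
  moreover have "(pderiv ^^ j) (pderiv p) = (pderiv ^^ (j + 1)) p" "(pderiv ^^ j) ((pderiv ^^ 2) p) = (pderiv ^^ (j + 2)) p"
    for j and p :: "real poly"
    by (simp_all add: funpow_swap1 numeral_2_eq_2)
  ultimately have *: "poly ([:- 1, 0, 1:] * (pderiv ^^ (k + 2)) (legendre_poly l)
      + Polynomial.smult (2 * real k) ([:0, 1:] * (pderiv ^^ (k - 1 + 2)) (legendre_poly l))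
      + Polynomial.smult (real k * (real k - 1)) ((pderiv ^^ (k - 2 + 2)) (legendre_poly l))
      + Polynomial.smult 2 ([:0, 1:] * (pderiv ^^ (k + 1)) (legendre_poly l) + Polynomial.smult (real k) ((pderiv ^^ (k - 1 + 1)) (legendre_poly l)))) t
      = poly (Polynomial.smult (real l * (real l + 1)) ((pderiv ^^ k) (legendre_poly l))) t"
    by (simp only: higher_pderiv_add higher_pderiv_smult higher_pderiv_one_minus_sq_mult higher_pderiv_x_mult)
  \<comment> \<open>Undoes the truncated subtractions: where k - 1 + 1 or k - 2 + 2 differs from k,
    the coefficient in front is zero.\<close>
  have **: "real k * poly ((pderiv ^^ (k - 1 + 2)) (legendre_poly l)) t = real k * legendre_deriv l (k + 1) t"
    "real k * poly ((pderiv ^^ (k - 1 + 1)) (legendre_poly l)) t = real k * legendre_deriv l k t"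
    "real k * (real k - 1) * poly ((pderiv ^^ (k - 2 + 2)) (legendre_poly l)) t = real k * (real k - 1) * legendre_deriv l k t"
  proof -
    consider "k = 0" | "k = 1" | j where "k = Suc (Suc j)" by (metis One_nat_def not0_implies_Suc)
    note c = this
    show "real k * poly ((pderiv ^^ (k - 1 + 2)) (legendre_poly l)) t = real k * legendre_deriv l (k + 1) t"
      by (cases rule: c) (simp_all add: numeral_2_eq_2)
    show "real k * poly ((pderiv ^^ (k - 1 + 1)) (legendre_poly l)) t = real k * legendre_deriv l k t"
      by (cases rule: c) simp_all
    show "real k * (real k - 1) * poly ((pderiv ^^ (k - 2 + 2)) (legendre_poly l)) t = real k * (real k - 1) * legendre_deriv l k t"
      by (cases rule: c) (simp_all add: numeral_2_eq_2)
  qed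
  define q where "q j = poly ((pderiv ^^ j) (legendre_poly l)) t" for j
  have "(t\<^sup>2 - 1) * q (k + 2) + 2 * t * (real k * q (k - 1 + 2)) + real k * (real k - 1) * q (k - 2 + 2)
     + 2 * (t * q (k + 1) + real k * q (k - 1 + 1)) = real l * (real l + 1) * q k"
    using * by (simp add: q_def[symmetric] power2_eq_square del: funpow.simps) (simp add: algebra_simps)
  then have "(t\<^sup>2 - 1) * q (k + 2) + 2 * t * (real k * q (k + 1)) + real k * (real k - 1) * q k
     + 2 * (t * q (k + 1) + real k * q k) = real l * (real l + 1) * q k"
    unfolding q_def ** .
  then have "(1 - t\<^sup>2) * q (k + 2) - 2 * (real k + 1) * t * q (k + 1) + (real l - real k) * (real l + real k + 1) * q k = 0"
    by (simp add: algebra_simps)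
  then show ?thesis unfolding q_def .
qed

lemma legendre_deriv_Suc_Suc:
  "legendre_deriv (Suc l) (Suc k) t = t * legendre_deriv l (Suc k) t + (real l + 1 + real k) * legendre_deriv l k t"
proof -
  have "(pderiv ^^ Suc k) (legendre_poly (Suc l)) = (pderiv ^^ k) ([:0, 1:] * pderiv (legendre_poly l)) + Polynomial.smult (real (Suc l)) ((pderiv ^^ k) (legendre_poly l))"
    by (simp only: funpow_Suc_right o_apply pderiv_legendre_poly_Suc higher_pderiv_add higher_pderiv_smult)
  moreover have "real k * poly ((pderiv ^^ (k - 1)) (pderiv (legendre_poly l))) t = real k * legendre_deriv l k t"
    by (cases k) (simp_all add: funpow_swap1)
  ultimately show ?thesis
    by (simp only: higher_pderiv_x_mult) (simp add: funpow_swap1 algebra_simps)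
qed

text \<open>Raises the degree at fixed order. For k >= 1 the left side is expanded by
  \<open>legendre_deriv_Suc_Suc\<close>, and what remains is the differentiated Legendre equation of
  order k - 1; k = 0 is \<open>legendre_poly_Suc\<close>.\<close>

lemma legendre_deriv_Suc_eq:
  "(real l + 1 - real k) * legendre_deriv (Suc l) k t =
    (real l + 1 + real k) * t * legendre_deriv l k t - (1 - t\<^sup>2) * legendre_deriv l (k + 1) t"
proof (cases k)
  case 0
  have "poly (Polynomial.smult (real (Suc l)) (legendre_poly (Suc l))) t = poly (Polynomial.smult (real (Suc l)) ([:0, 1:] * legendre_poly l) + [:- 1, 0, 1:] * pderiv (legendre_poly l)) t"
    by (simp only: legendre_poly_Suc)
  then show ?thesis using 0 by (simp add: algebra_simps power2_eq_square)
next
  case (Suc j)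
  show ?thesis
    using legendre_deriv_ode[where l=l and k=j and t=t] unfolding Suc legendre_deriv_Suc_Suc
    by (simp add: algebra_simps numeral_2_eq_2)
qed

text \<open>Lowers the degree at fixed order, by eliminating the derivative of order k + 1 in degree
  l from the two preceding relations.\<close>

lemma legendre_deriv_pred_eq:
  "(real l + 1 + real k) * legendre_deriv l k t =
    (1 - t\<^sup>2) * legendre_deriv (Suc l) (k + 1) t + (real l + 1 - real k) * t * legendre_deriv (Suc l) k t"
proof -
  have "(real l + 1 - real k) * t * legendre_deriv (Suc l) k t = t * ((real l + 1 + real k) * t * legendre_deriv l k t - (1 - t\<^sup>2) * legendre_deriv l (k + 1) t)"
    by (subst legendre_deriv_Suc_eq[symmetric]) (simp only: mult_ac)
  then show ?thesis using legendre_deriv_Suc_Suc[where l=l and k=k and t=t]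
    by (simp add: algebra_simps power2_eq_square)
qed

lemma degree_legendre_poly: "degree (legendre_poly l) \<le> l"
proof -
  have "degree ([:- 1, 0, 1:] ^ l :: real poly) \<le> 2 * l"
    by (rule order_trans[OF degree_power_le]) simp
  then show ?thesis unfolding legendre_poly_def
    by (intro order_trans[OF degree_smult_le]) (simp add: degree_higher_pderiv)
qed

lemma higher_pderiv_eq_0:
  fixes p :: "'a :: {comm_semiring_1,semiring_no_zero_divisors,semiring_char_0} poly"
  assumes "degree p < n"
  shows "(pderiv ^^ n) p = 0"
  using assms
proof (induction n arbitrary: p)
  case (Suc n)
  show ?case
  proof (cases "degree p = 0")
    case True
    then have "pderiv p = 0" by (simp add: pderiv_eq_0_iff)
    then show ?thesis by (simp only: funpow_Suc_right o_apply higher_pderiv_0)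
  next
    case False
    then show ?thesis using Suc by (simp add: funpow_swap1 degree_pderiv del: funpow.simps(2) add: funpow_Suc_right)
  qed
qed simp

lemma legendre_deriv_eq_0: "k > l \<Longrightarrow> legendre_deriv l k t = 0"
  using higher_pderiv_eq_0[of "legendre_poly l" k] degree_legendre_poly[of l] by simp

text \<open>Bonnet's recurrence: the raising and lowering relations at k = 0 both contain the
  derivative of \<open>legendre_poly (Suc l)\<close>, which cancels.\<close>

lemma legendre_poly_three_term:
  "(real l + 2) * legendre (Suc (Suc l)) t =
    (2 * real l + 3) * t * legendre (Suc l) t - (real l + 1) * legendre l t"
  using legendre_deriv_Suc_eq[where l="Suc l" and k=0 and t=t] legendre_deriv_pred_eq[where l=l and k=0 and t=t] by (simp add: algebra_simps)

lemma legendre_deriv_1_Suc_Suc: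
  "legendre' (Suc (Suc l)) t = legendre' l t + (2 * real l + 3) * legendre (Suc l) t"
  using legendre_deriv_Suc_Suc[where l="Suc l" and k=0 and t=t] legendre_deriv_Suc_Suc[where l=l and k=0 and t=t] legendre_deriv_pred_eq[where l=l and k=0 and t=t]
    legendre_deriv_Suc_eq[where l=l and k=0 and t=t]
  by (simp add: algebra_simps power2_eq_square)

section \<open>The addition theorem\<close>

definition assoc_coeff :: "nat \<Rightarrow> nat \<Rightarrow> real"
  where "assoc_coeff l k = fact (l - k) / fact (l + k)"

text \<open>Coefficient of \<open>Re (z ^ k)\<close> in the addition theorem. The k-th powers of
  sines in the associated Legendre functions are left out: they are carried by z, whose modulus is
  the product of the two sines.\<close>

definition zonal_coeff :: "nat \<Rightarrow> nat \<Rightarrow> real \<Rightarrow> real \<Rightarrow> real"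
  where "zonal_coeff l k a b = assoc_coeff l k * legendre_deriv l k a * legendre_deriv l k b"

lemma zonal_coeff_eq_0: "k > l \<Longrightarrow> zonal_coeff l k a b = 0"
  by (simp add: zonal_coeff_def legendre_deriv_eq_0)

lemma assoc_coeff_Suc: "k \<le> l \<Longrightarrow> assoc_coeff (Suc l) k = assoc_coeff l k * (real l + 1 - real k) / (real l + 1 + real k)"
  by (simp add: assoc_coeff_def Suc_diff_le of_nat_diff) (simp add: divide_simps, simp add: algebra_simps)

lemma assoc_coeff_Suc_right: "k < l \<Longrightarrow> assoc_coeff l k = assoc_coeff l (Suc k) * ((real l - real k) * (real l + 1 + real k))"
proof -
  assume "k < l"
  then have "l - k = Suc (l - Suc k)" by simp
  then have "fact (l - k) = (real l - real k) * fact (l - Suc k)"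
    using \<open>k < l\<close> by (simp add: of_nat_diff)
  moreover have "1 + (real l + real k) \<noteq> 0" by linarith
  ultimately show ?thesis by (simp add: assoc_coeff_def divide_simps)
qed

text \<open>X, U stand for a times the k-th and 1 - a^2 times the (k+1)-st derivative at a, and Y, V
  for the same at b. Both sides are bilinear in (X, U) and (Y, V); \<open>uv\<close>,
  \<open>xv\<close> and \<open>xy\<close> match the coefficients of U V, of X V + U Y and of X
  Y.\<close>

lemma zonal_coeff_three_term_aux:
  fixes l k :: real
  assumes "l - k \<noteq> 0" "l + k \<noteq> 0" "l + 1 - k \<noteq> 0" "l + 1 + k \<noteq> 0"
  shows "(l + 1) * (((l + 1 + k) * X - U) * ((l + 1 + k) * Y - V) / ((l + 1 + k) * (l + 1 - k)))
     + l * ((U + (l - k) * X) * (V + (l - k) * Y) / ((l - k) * (l + k)))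
    = (2 * l + 1) * (X * Y + (2 * k * X - U) * (2 * k * Y - V) / (2 * ((l + k) * (l + 1 - k)))
       + U * V / (2 * ((l - k) * (l + 1 + k))))"
proof -
  define A B D E where "A = (l + 1) / ((l + 1 + k) * (l + 1 - k))" and "B = l / ((l - k) * (l + k))"
    and "D = (2 * l + 1) / (2 * ((l + k) * (l + 1 - k)))" and "E = (2 * l + 1) / (2 * ((l - k) * (l + 1 + k)))"
  have uv: "A + B = D + E"
    using assms unfolding A_def B_def D_def E_def by (simp add: divide_simps) (simp add: algebra_simps power2_eq_square)
  have xv: "(l + 1 + k) * A - (l - k) * B = 2 * k * D"
  proof -
    have *: "(l + 1 + k) * A = (l + 1) / (l + 1 - k)" "(l - k) * B = l / (l + k)"
      using assms by (simp_all add: A_def B_def)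
    show ?thesis using assms unfolding * D_def by (simp add: divide_simps) (simp add: algebra_simps power2_eq_square)
  qed
  have xy: "(l + 1 + k)\<^sup>2 * A + (l - k)\<^sup>2 * B = 2 * l + 1 + 4 * k\<^sup>2 * D"
  proof -
    have *: "(l + 1 + k)\<^sup>2 * A = (l + 1 + k) * (l + 1) / (l + 1 - k)" "(l - k)\<^sup>2 * B = (l - k) * l / (l + k)"
      using assms by (simp_all add: A_def B_def power2_eq_square)
    show ?thesis using assms unfolding * D_def by (simp add: divide_simps) (simp add: algebra_simps power2_eq_square)
  qed
  have "A * (((l + 1 + k) * X - U) * ((l + 1 + k) * Y - V)) + B * ((U + (l - k) * X) * (V + (l - k) * Y))
    = (2 * l + 1) * (X * Y) + D * ((2 * k * X - U) * (2 * k * Y - V)) + E * (U * V)"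
  proof -
    have "A * (((l + 1 + k) * X - U) * ((l + 1 + k) * Y - V)) + B * ((U + (l - k) * X) * (V + (l - k) * Y))
      = ((l + 1 + k)\<^sup>2 * A + (l - k)\<^sup>2 * B) * (X * Y)
        - ((l + 1 + k) * A - (l - k) * B) * (X * V + U * Y) + (A + B) * (U * V)"
      by (simp add: algebra_simps power2_eq_square)
    then show ?thesis unfolding uv xv xy by (simp add: algebra_simps power2_eq_square)
  qed
  then show ?thesis
    by (simp add: A_def B_def D_def E_def distrib_left[of "2 * l + 1"])
qed

text \<open>This lemma and the next three express the four neighbours of an index pair (degree or
  order changed by one) through the derivatives at that pair itself, so that the three-term identity
  becomes one in X, Y, U, V.\<close>

lemma zonal_coeff_Suc:
  assumes "k \<le> l"
  shows "zonal_coeff (Suc l) k a b = assoc_coeff l k *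
    (((real l + 1 + real k) * (a * legendre_deriv l k a) - (1 - a\<^sup>2) * legendre_deriv l (Suc k) a)
   * ((real l + 1 + real k) * (b * legendre_deriv l k b) - (1 - b\<^sup>2) * legendre_deriv l (Suc k) b)
   / ((real l + 1 + real k) * (real l + 1 - real k)))"
proof -
  have "real l + 1 - real k > 0" using assms by linarith
  then have "legendre_deriv (Suc l) k t = ((real l + 1 + real k) * (t * legendre_deriv l k t) - (1 - t\<^sup>2) * legendre_deriv l (Suc k) t) / (real l + 1 - real k)" for t
    using legendre_deriv_Suc_eq[where l=l and k=k and t=t] by (simp add: field_simps del: funpow.simps)
  note * = this[of a] this[of b]
  show ?thesis using \<open>real l + 1 - real k > 0\<close>
    unfolding zonal_coeff_def assoc_coeff_Suc[OF assms] * by (simp del: funpow.simps)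
qed

lemma zonal_coeff_pred:
  assumes "k \<le> l"
  shows "zonal_coeff l k a b = assoc_coeff (Suc l) k *
    (((1 - a\<^sup>2) * legendre_deriv (Suc l) (Suc k) a + (real (Suc l) - real k) * (a * legendre_deriv (Suc l) k a))
   * ((1 - b\<^sup>2) * legendre_deriv (Suc l) (Suc k) b + (real (Suc l) - real k) * (b * legendre_deriv (Suc l) k b))
   / ((real (Suc l) - real k) * (real (Suc l) + real k)))"
proof -
  have "real (Suc l) - real k > 0" using assms by linarith
  have "legendre_deriv l k t = ((1 - t\<^sup>2) * legendre_deriv (Suc l) (Suc k) t + (real (Suc l) - real k) * (t * legendre_deriv (Suc l) k t)) / (real (Suc l) + real k)" for t
    using legendre_deriv_pred_eq[where l=l and k=k and t=t] by (simp add: field_simps del: funpow.simps)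
  note * = this[of a] this[of b]
  have c: "assoc_coeff l k = assoc_coeff (Suc l) k * (real (Suc l) + real k) / (real (Suc l) - real k)"
    using assoc_coeff_Suc[OF assms] \<open>real (Suc l) - real k > 0\<close> by (simp add: field_simps)
  have "(assoc_coeff (Suc l) k * P / M) * (A / P) * (B / P) = assoc_coeff (Suc l) k * (A * B / (M * P))"
    if "P > 0" for P M A B :: real using that by simp
  then show ?thesis
    unfolding zonal_coeff_def c * by (simp del: funpow.simps)
qed

lemma zonal_coeff_pred_right:
  assumes "k < l"
  shows "zonal_coeff l k a b = assoc_coeff l (Suc k) *
    ((2 * real (Suc k) * (a * legendre_deriv l (Suc k) a) - (1 - a\<^sup>2) * legendre_deriv l (Suc (Suc k)) a)
   * (2 * real (Suc k) * (b * legendre_deriv l (Suc k) b) - (1 - b\<^sup>2) * legendre_deriv l (Suc (Suc k)) b)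
   / ((real l + real (Suc k)) * (real l + 1 - real (Suc k))))"
proof -
  have pos: "real l - real k > 0" using assms by simp
  have "legendre_deriv l k t = (2 * real (Suc k) * (t * legendre_deriv l (Suc k) t) - (1 - t\<^sup>2) * legendre_deriv l (Suc (Suc k)) t) / ((real l - real k) * (real l + 1 + real k))" for t
  proof -
    have "(real l - real k) * (real l + 1 + real k) \<noteq> 0" using pos by simp
    moreover have "(real l - real k) * (real l + 1 + real k) * legendre_deriv l k t = 2 * real (Suc k) * (t * legendre_deriv l (Suc k) t) - (1 - t\<^sup>2) * legendre_deriv l (Suc (Suc k)) t"
      using legendre_deriv_ode[where l=l and k=k and t=t] by (simp add: numeral_2_eq_2 algebra_simps del: funpow.simps)
    ultimately show ?thesis by (simp add: field_simps del: funpow.simps)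
  qed
  note * = this[of a] this[of b]
  have e: "(real l + real (Suc k)) * (real l + 1 - real (Suc k)) = (real l - real k) * (real l + 1 + real k)"
    by (simp add: algebra_simps)
  have "(c * M) * (A / M) * (B / M) = c * (A * B / M)" if "M \<noteq> 0" for c M A B :: real using that by simp
  then show ?thesis using pos
    unfolding zonal_coeff_def assoc_coeff_Suc_right[OF assms] * e by (simp del: funpow.simps)
qed

lemma zonal_coeff_Suc_right:
  assumes "k < l"
  shows "(1 - a\<^sup>2) * (1 - b\<^sup>2) * zonal_coeff l (Suc k) a b = assoc_coeff l k *
    (((1 - a\<^sup>2) * legendre_deriv l (Suc k) a) * ((1 - b\<^sup>2) * legendre_deriv l (Suc k) b)
     / ((real l - real k) * (real l + 1 + real k)))"
  using assms unfolding zonal_coeff_def assoc_coeff_Suc_right[OF assms] by (simp del: funpow.simps)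

text \<open>At k = 0 the orders k - 1 and k + 1 contribute equally, so the two halves in the
  auxiliary identity add up to one full term.\<close>

lemma zonal_coeff_three_term_0:
  "(real l + 2) * zonal_coeff (Suc (Suc l)) 0 a b + (real l + 1) * zonal_coeff l 0 a b =
    (2 * real l + 3) * (a * b * zonal_coeff (Suc l) 0 a b + (1 - a\<^sup>2) * (1 - b\<^sup>2) * zonal_coeff (Suc l) 1 a b)"
proof -
  define X Y U V where "X = a * legendre_deriv (Suc l) 0 a" and "Y = b * legendre_deriv (Suc l) 0 b"
    and "U = (1 - a\<^sup>2) * legendre_deriv (Suc l) 1 a" and "V = (1 - b\<^sup>2) * legendre_deriv (Suc l) 1 b"
  define c where "c = assoc_coeff (Suc l) 0"
  note aux = zonal_coeff_three_term_aux[of "real (Suc l)" 0 X U Y V]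
  have 1: "zonal_coeff (Suc (Suc l)) 0 a b = c * (((real (Suc l) + 1 + 0) * X - U) * ((real (Suc l) + 1 + 0) * Y - V) / ((real (Suc l) + 1 + 0) * (real (Suc l) + 1 - 0)))"
    using zonal_coeff_Suc[of 0 "Suc l" a b] by (simp only: X_def Y_def U_def V_def c_def One_nat_def) simp
  have 2: "zonal_coeff l 0 a b = c * ((U + (real (Suc l) - 0) * X) * (V + (real (Suc l) - 0) * Y) / ((real (Suc l) - 0) * (real (Suc l) + 0)))"
    using zonal_coeff_pred[of 0 l a b] by (simp only: X_def Y_def U_def V_def c_def One_nat_def) simp
  have 3: "(1 - a\<^sup>2) * (1 - b\<^sup>2) * zonal_coeff (Suc l) 1 a b = c * (U * V / ((real (Suc l) - 0) * (real (Suc l) + 1 + 0)))"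
    using zonal_coeff_Suc_right[of 0 "Suc l" a b] by (simp only: X_def Y_def U_def V_def c_def One_nat_def) simp
  have 4: "a * b * zonal_coeff (Suc l) 0 a b = c * (X * Y)"
    by (simp add: zonal_coeff_def c_def X_def Y_def)
  have "(real l + 2) * zonal_coeff (Suc (Suc l)) 0 a b + (real l + 1) * zonal_coeff l 0 a b =
    c * ((real (Suc l) + 1) * (((real (Suc l) + 1 + 0) * X - U) * ((real (Suc l) + 1 + 0) * Y - V) / ((real (Suc l) + 1 + 0) * (real (Suc l) + 1 - 0)))
      + real (Suc l) * ((U + (real (Suc l) - 0) * X) * (V + (real (Suc l) - 0) * Y) / ((real (Suc l) - 0) * (real (Suc l) + 0))))"
    unfolding 1 2 by (simp add: algebra_simps)
  also have "\<dots> = c * ((2 * real (Suc l) + 1) * (X * Y + U * V / ((real (Suc l) - 0) * (real (Suc l) + 1 + 0))))"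
  proof -
    have half: "x / (2 * p) + x / (2 * p) = x / p" for x p :: real by simp
    show ?thesis using half[of "U * V" "real (Suc l) * (real (Suc l) + 1)"]
      by (subst aux) (simp_all del: of_nat_Suc)
  qed
  also have "\<dots> = (2 * real l + 3) * (a * b * zonal_coeff (Suc l) 0 a b + (1 - a\<^sup>2) * (1 - b\<^sup>2) * zonal_coeff (Suc l) 1 a b)"
    unfolding 3 4 by (simp add: algebra_simps)
  finally show ?thesis .
qed

lemma zonal_coeff_three_term_Suc:
  "(real l + 2) * zonal_coeff (Suc (Suc l)) (Suc k) a b + (real l + 1) * zonal_coeff l (Suc k) a b =
    (2 * real l + 3) * (a * b * zonal_coeff (Suc l) (Suc k) a b
      + (zonal_coeff (Suc l) k a b + (1 - a\<^sup>2) * (1 - b\<^sup>2) * zonal_coeff (Suc l) (Suc (Suc k)) a b) / 2)"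
proof -
  define X Y U V where "X = a * legendre_deriv (Suc l) (Suc k) a" and "Y = b * legendre_deriv (Suc l) (Suc k) b"
    and "U = (1 - a\<^sup>2) * legendre_deriv (Suc l) (Suc (Suc k)) a" and "V = (1 - b\<^sup>2) * legendre_deriv (Suc l) (Suc (Suc k)) b"
  note defs = X_def Y_def U_def V_def
  define c where "c = assoc_coeff (Suc l) (Suc k)"
  have 4: "a * b * zonal_coeff (Suc l) (Suc k) a b = c * (X * Y)"
    by (simp add: zonal_coeff_def c_def X_def Y_def)
  let ?L = "real (Suc l)" and ?k = "real (Suc k)"
  \<comment> \<open>Outside k < l the auxiliary identity would divide by zero:
    \<open>?L - ?k\<close> vanishes for k = l and \<open>?L + 1 - ?k\<close> for k = Suc l. There
    the few terms that survive are compared directly, and beyond that all vanish.\<close>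
  consider "k < l" | "k = l" | "k = Suc l" | "k > Suc l" by linarith
  then show ?thesis
  proof cases
    case 1
    have n: "?L - ?k \<noteq> 0" "?L + ?k \<noteq> 0" "?L + 1 - ?k \<noteq> 0" "?L + 1 + ?k \<noteq> 0" using 1 by auto
    have e1: "zonal_coeff (Suc (Suc l)) (Suc k) a b = c * (((?L + 1 + ?k) * X - U) * ((?L + 1 + ?k) * Y - V) / ((?L + 1 + ?k) * (?L + 1 - ?k)))"
      using zonal_coeff_Suc[of "Suc k" "Suc l" a b] 1 by (simp only: defs c_def; simp)
    have e2: "zonal_coeff l (Suc k) a b = c * ((U + (?L - ?k) * X) * (V + (?L - ?k) * Y) / ((?L - ?k) * (?L + ?k)))"
      using zonal_coeff_pred[of "Suc k" l a b] 1 by (simp only: defs c_def; simp)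
    have e3: "zonal_coeff (Suc l) k a b = c * ((2 * ?k * X - U) * (2 * ?k * Y - V) / ((?L + ?k) * (?L + 1 - ?k)))"
      using zonal_coeff_pred_right[of k "Suc l" a b] 1 by (simp only: defs c_def; simp)
    have e5: "(1 - a\<^sup>2) * (1 - b\<^sup>2) * zonal_coeff (Suc l) (Suc (Suc k)) a b = c * (U * V / ((?L - ?k) * (?L + 1 + ?k)))"
      using zonal_coeff_Suc_right[of "Suc k" "Suc l" a b] 1 by (simp only: defs c_def; simp)
    have "(real l + 2) * zonal_coeff (Suc (Suc l)) (Suc k) a b + (real l + 1) * zonal_coeff l (Suc k) a b
      = c * ((?L + 1) * (((?L + 1 + ?k) * X - U) * ((?L + 1 + ?k) * Y - V) / ((?L + 1 + ?k) * (?L + 1 - ?k)))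
       + ?L * ((U + (?L - ?k) * X) * (V + (?L - ?k) * Y) / ((?L - ?k) * (?L + ?k))))"
      unfolding e1 e2 by (simp add: algebra_simps)
    also have "\<dots> = c * ((2 * ?L + 1) * (X * Y + (2 * ?k * X - U) * (2 * ?k * Y - V) / (2 * ((?L + ?k) * (?L + 1 - ?k)))
       + U * V / (2 * ((?L - ?k) * (?L + 1 + ?k)))))"
      by (subst zonal_coeff_three_term_aux[OF n]) (rule refl)
    also have "\<dots> = (2 * real l + 3) * (c * (X * Y) + (c * ((2 * ?k * X - U) * (2 * ?k * Y - V) / ((?L + ?k) * (?L + 1 - ?k)))
       + c * (U * V / ((?L - ?k) * (?L + 1 + ?k)))) / 2)"
    proof -
      have g: "c * ((2 * ?L + 1) * (p + x / 2 + y / 2)) = (2 * real l + 3) * (c * p + (c * x + c * y) / 2)" for p x y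
        by (simp add: field_simps)
      have h: "r / (2 * s) = (r / s) / 2" for r s :: real by simp
      show ?thesis unfolding h g ..
    qed
    finally show ?thesis unfolding e3 e5 4 .
  next
    case 2
    have z: "U = 0" "V = 0" by (simp_all add: U_def V_def 2 legendre_deriv_eq_0 del: funpow.simps)
    have e1: "zonal_coeff (Suc (Suc l)) (Suc k) a b = c * ((2 * ?L + 1) * (X * Y))"
      using zonal_coeff_Suc[of "Suc k" "Suc l" a b] 2 unfolding defs[symmetric] z c_def[symmetric]
      by (simp; simp add: algebra_simps)
    have e3: "zonal_coeff (Suc l) k a b = c * (2 * ?L * (X * Y))"
      using zonal_coeff_pred_right[of k "Suc l" a b] 2 unfolding defs[symmetric] z c_def[symmetric]
      by simp
    show ?thesis unfolding e1 e3 4 by (simp add: zonal_coeff_eq_0 2) (simp add: algebra_simps)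
  next
    case 3
    have a0: "legendre_deriv (Suc l) (Suc (Suc l)) t = 0" for t by (simp add: legendre_deriv_eq_0 del: funpow.simps)
    have "legendre_deriv (Suc (Suc l)) (Suc (Suc l)) t = (2 * real l + 3) * legendre_deriv (Suc l) (Suc l) t" for t
      using legendre_deriv_Suc_Suc[where l="Suc l" and k="Suc l" and t=t] a0[of t] by (simp del: funpow.simps)
    moreover have "assoc_coeff (Suc l) (Suc l) = assoc_coeff (Suc (Suc l)) (Suc (Suc l)) * ((2 * real l + 3) * (2 * real l + 4))"
      by (simp add: assoc_coeff_def) (simp add: divide_simps, simp add: algebra_simps)
    ultimately show ?thesis unfolding 3 by (simp add: zonal_coeff_eq_0 del: funpow.simps) 
      (simp add: zonal_coeff_def algebra_simps del: funpow.simps)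
  next
    case 4
    then show ?thesis by (simp add: zonal_coeff_eq_0)
  qed
qed

text \<open>z is a root of T^2 - 2 (Re z) T + |z|^2; this is the product formula for cosines with
  the modulus kept in.\<close>

lemma Re_mult_power_recurrence:
  fixes z :: complex
  shows "2 * Re z * Re (z ^ Suc k) = Re (z ^ Suc (Suc k)) + (cmod z)\<^sup>2 * Re (z ^ k)"
  unfolding cmod_power2 by (simp add: algebra_simps power2_eq_square)

text \<open>Multiplication by Re z shifts each order by one in both directions. The last two terms
  are the boundary error at n, which vanishes once n exceeds the degree.\<close>

lemma Re_mult_cosine_sum:
  fixes z :: complex and T :: "nat \<Rightarrow> real"
  shows "Re z * (T 0 + 2 * (\<Sum>k=1..n. T k * Re (z ^ k))) =
    (cmod z)\<^sup>2 * T 1 + (\<Sum>k=1..n. (T (k - 1) + (cmod z)\<^sup>2 * T (k + 1)) * Re (z ^ k))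
      + T n * Re (z ^ Suc n) - (cmod z)\<^sup>2 * T (Suc n) * Re (z ^ n)"
proof (induction n)
  case (Suc n)
  have "Re z * (T 0 + 2 * (\<Sum>k=1..Suc n. T k * Re (z ^ k))) =
      Re z * (T 0 + 2 * (\<Sum>k=1..n. T k * Re (z ^ k))) + T (Suc n) * (2 * Re z * Re (z ^ Suc n))"
    by (simp add: algebra_simps del: power_Suc)
  then show ?case unfolding Suc Re_mult_power_recurrence
    by (simp add: algebra_simps del: power_Suc)
qed simp

text \<open>Both sides satisfy Bonnet's recurrence. The summation range is any n above the degree,
  so that three consecutive degrees share one range; the additional terms are zero.\<close>

lemma legendre_addition_aux:
  fixes z :: complex
  assumes "(cmod z)\<^sup>2 = (1 - a\<^sup>2) * (1 - b\<^sup>2)" "n > l"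
  shows "legendre l (a * b + Re z) = zonal_coeff l 0 a b + 2 * (\<Sum>k=1..n. zonal_coeff l k a b * Re (z ^ k))"
  using assms(2)
proof (induction l rule: induct_nat_012)
  case 0
  have "(\<Sum>k=1..n. zonal_coeff 0 k a b * Re (z ^ k)) = 0"
    by (rule sum.neutral) (auto simp: zonal_coeff_eq_0)
  then show ?case by (simp add: zonal_coeff_def assoc_coeff_def legendre_poly_def)
next
  case 1
  have "(\<Sum>k=1..n. zonal_coeff 1 k a b * Re (z ^ k)) = (\<Sum>k\<in>{1}. zonal_coeff 1 k a b * Re (z ^ k))"
    using 1 by (intro sum.mono_neutral_right) (auto simp: zonal_coeff_eq_0)
  then show ?case by (simp add: zonal_coeff_def assoc_coeff_def legendre_poly_def pderiv_pCons)
next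
  case (ge2 l)
  define F where "F l = zonal_coeff l 0 a b + 2 * (\<Sum>k=1..n. zonal_coeff l k a b * Re (z ^ k))" for l
  have "n > Suc l" "zonal_coeff (Suc l) n a b = 0" "zonal_coeff (Suc l) (Suc n) a b = 0"
    using ge2.prems by (auto simp: zonal_coeff_eq_0)
  then have R: "Re z * F (Suc l) = (1 - a\<^sup>2) * (1 - b\<^sup>2) * zonal_coeff (Suc l) 1 a b
      + (\<Sum>k=1..n. (zonal_coeff (Suc l) (k - 1) a b + (1 - a\<^sup>2) * (1 - b\<^sup>2) * zonal_coeff (Suc l) (k + 1) a b) * Re (z ^ k))"
    unfolding F_def by (subst Re_mult_cosine_sum) (simp add: assms(1))
  have "(2 * real l + 3) * (a * b + Re z) * F (Suc l) =
      (2 * real l + 3) * (a * b * zonal_coeff (Suc l) 0 a b + (1 - a\<^sup>2) * (1 - b\<^sup>2) * zonal_coeff (Suc l) 1 a b)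
      + 2 * (\<Sum>k=1..n. (2 * real l + 3) * (a * b * zonal_coeff (Suc l) k a b
          + (zonal_coeff (Suc l) (k - 1) a b + (1 - a\<^sup>2) * (1 - b\<^sup>2) * zonal_coeff (Suc l) (k + 1) a b) / 2) * Re (z ^ k))"
  proof -
    have "(2 * real l + 3) * (a * b + Re z) * F (Suc l) = (2 * real l + 3) * (a * b * F (Suc l) + Re z * F (Suc l))"
      by (simp add: algebra_simps)
    then show ?thesis unfolding R by (simp add: F_def sum_distrib_left sum.distrib distrib_left distrib_right mult_ac add_divide_distrib)
  qed
  also have "\<dots> = ((real l + 2) * zonal_coeff (Suc (Suc l)) 0 a b + (real l + 1) * zonal_coeff l 0 a b)
      + 2 * (\<Sum>k=1..n. ((real l + 2) * zonal_coeff (Suc (Suc l)) k a b + (real l + 1) * zonal_coeff l k a b) * Re (z ^ k))"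
  proof -
    have "(\<Sum>k=1..n. (2 * real l + 3) * (a * b * zonal_coeff (Suc l) k a b
          + (zonal_coeff (Suc l) (k - 1) a b + (1 - a\<^sup>2) * (1 - b\<^sup>2) * zonal_coeff (Suc l) (k + 1) a b) / 2) * Re (z ^ k))
      = (\<Sum>k=1..n. ((real l + 2) * zonal_coeff (Suc (Suc l)) k a b + (real l + 1) * zonal_coeff l k a b) * Re (z ^ k))"
    proof (rule sum.cong[OF refl])
      fix k assume "k \<in> {1..n}"
      then obtain j where j: "k = Suc j" by (cases k) auto
      show "(2 * real l + 3) * (a * b * zonal_coeff (Suc l) k a b
          + (zonal_coeff (Suc l) (k - 1) a b + (1 - a\<^sup>2) * (1 - b\<^sup>2) * zonal_coeff (Suc l) (k + 1) a b) / 2) * Re (z ^ k)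
         = ((real l + 2) * zonal_coeff (Suc (Suc l)) k a b + (real l + 1) * zonal_coeff l k a b) * Re (z ^ k)"
        unfolding j zonal_coeff_three_term_Suc by simp
    qed
    then show ?thesis unfolding zonal_coeff_three_term_0 by simp
  qed
  also have "\<dots> = (real l + 2) * F (Suc (Suc l)) + (real l + 1) * F l"
    by (simp add: F_def algebra_simps sum.distrib sum_distrib_left)
  finally have "(real l + 2) * F (Suc (Suc l)) = (2 * real l + 3) * (a * b + Re z) * F (Suc l) - (real l + 1) * F l"
    by simp
  moreover have "F l = legendre l (a * b + Re z)" "F (Suc l) = legendre (Suc l) (a * b + Re z)"
    using ge2 by (simp_all add: F_def)
  ultimately have "(real l + 2) * F (Suc (Suc l)) = (real l + 2) * legendre (Suc (Suc l)) (a * b + Re z)"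
    by (simp only: legendre_poly_three_term)
  then show ?case by (simp add: F_def)
qed

lemma sum_symmetric_int_interval:
  fixes f :: "int \<Rightarrow> 'a :: comm_monoid_add"
  shows "(\<Sum>\<mu>\<in>{- int l..int l}. f \<mu>) = f 0 + (\<Sum>k=1..l. f (int k) + f (- int k))"
proof (induction l)
  case (Suc l)
  have "{- int (Suc l)..int (Suc l)} = insert (int (Suc l)) (insert (- int (Suc l)) {- int l..int l})" by auto
  then show ?case using Suc by (simp add: ac_simps)
qed simp

lemma sphere3_iff:
  fixes x :: "real ^ 3"
  shows "x \<in> S2 \<longleftrightarrow> (vec_nth x 1)\<^sup>2 + (vec_nth x 2)\<^sup>2 + (vec_nth x 3)\<^sup>2 = 1"
proof -
  have "(norm x)\<^sup>2 = (vec_nth x 1)\<^sup>2 + (vec_nth x 2)\<^sup>2 + (vec_nth x 3)\<^sup>2"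
    unfolding power2_norm_eq_inner by (simp add: inner_vec_def sum_3 power2_eq_square)
  moreover have "x \<in> S2 \<longleftrightarrow> (norm x)\<^sup>2 = 1"
    using norm_ge_zero[of x] by (auto simp: power2_eq_1_iff simp del: norm_ge_zero)
  ultimately show ?thesis by simp
qed

theorem legendre_addition:
  assumes "x \<in> S2" "y \<in> S2"
  shows "(\<Sum>\<mu>\<in>{- int l..int l}. sph_harm l \<mu> x * sph_harm l \<mu> y) = (2 * real l + 1) / (4 * pi) * legendre l (inner x y)"
proof -
  define w where "w x = Complex (vec_nth x 1) (vec_nth x 2)" for x :: "real ^ 3"
  define z where "z = w x * cnj (w y)"
  define T where "T k = zonal_coeff l k (vec_nth x 3) (vec_nth y 3)" for k
  let ?c = "(2 * real l + 1) / (4 * pi)"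
  have [simp]: "?c \<ge> 0" by simp
  have nw: "(cmod (w x))\<^sup>2 = 1 - (vec_nth x 3)\<^sup>2" if "x \<in> S2" for x
    using that unfolding sphere3_iff w_def cmod_power2 by simp
  have "(cmod z)\<^sup>2 = (1 - (vec_nth x 3)\<^sup>2) * (1 - (vec_nth y 3)\<^sup>2)"
    by (simp only: z_def norm_mult power_mult_distrib complex_mod_cnj nw[OF assms(1)] nw[OF assms(2)])
  note add = legendre_addition_aux[OF this, of l "Suc l"]
  have Rez: "vec_nth x 3 * vec_nth y 3 + Re z = inner x y"
    by (simp add: z_def w_def inner_vec_def sum_3)
  \<comment> \<open>The orders k and - k are paired: cos cos + sin sin is the cosine of the
    difference, which in Cartesian form is the real part of z^k.\<close>
  have pm: "sph_harm l (int k) x * sph_harm l (int k) y + sph_harm l (- int k) x * sph_harm l (- int k) y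
    = ?c * (2 * (T k * Re (z ^ k)))" if "k \<ge> 1" for k
  proof -
    have sq: "sqrt (?c * fact (l - k) / fact (l + k)) * sqrt (?c * fact (l - k) / fact (l + k)) = ?c * assoc_coeff l k"
      by (simp add: assoc_coeff_def)
    have re: "Re (w x ^ k) * Re (w y ^ k) + Im (w x ^ k) * Im (w y ^ k) = Re (z ^ k)"
      by (simp add: z_def power_mult_distrib flip: complex_cnj_power)
    define r where "r = sqrt (?c * fact (l - k) / fact (l + k))"
    have a: "sph_harm l (int k) u = r * legendre_deriv l k (vec_nth u 3) * (sqrt 2 * Re (w u ^ k))"
        "sph_harm l (- int k) u = r * legendre_deriv l k (vec_nth u 3) * (sqrt 2 * Im (w u ^ k))" for u
      using that by (simp_all add: sph_harm_def Let_def r_def w_def)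
    have "sph_harm l (int k) x * sph_harm l (int k) y + sph_harm l (- int k) x * sph_harm l (- int k) y
      = (r * r) * (legendre_deriv l k (vec_nth x 3) * legendre_deriv l k (vec_nth y 3)) * ((sqrt 2 * sqrt 2) *
        (Re (w x ^ k) * Re (w y ^ k) + Im (w x ^ k) * Im (w y ^ k)))"
      unfolding a by (simp only: algebra_simps)
    then show ?thesis unfolding re sq[folded r_def] by (simp add: T_def zonal_coeff_def)
  qed
  obtain s where s: "s = sqrt ?c" by blast
  then have ss: "s * s = ?c" by simp
  have "sph_harm l 0 u = s * legendre_deriv l 0 (vec_nth u 3)" for u
    by (simp add: sph_harm_def s)
  then have "sph_harm l 0 x * sph_harm l 0 y = (s * s) * T 0"
    by (simp add: T_def zonal_coeff_def assoc_coeff_def)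
  then have zero: "sph_harm l 0 x * sph_harm l 0 y = ?c * T 0"
    unfolding ss .
  have "(\<Sum>\<mu>\<in>{- int l..int l}. sph_harm l \<mu> x * sph_harm l \<mu> y) =
      ?c * (T 0 + 2 * (\<Sum>k=1..l. T k * Re (z ^ k)))"
    unfolding sum_symmetric_int_interval zero by (simp add: pm distrib_left sum_distrib_left)
  also have "(\<Sum>k=1..l. T k * Re (z ^ k)) = (\<Sum>k=1..Suc l. T k * Re (z ^ k))"
    by (simp add: T_def zonal_coeff_eq_0)
  finally show ?thesis using add by (simp add: Rez T_def)
qed

text \<open>Cauchy-Schwarz for the sum in the addition theorem, at two points of the sphere with
  inner product t; the diagonal values are those at 1.\<close>

lemma abs_legendre_poly_le_1:
  assumes "\<bar>t\<bar> \<le> 1"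
  shows "\<bar>legendre l t\<bar> \<le> 1"
proof -
  define x y :: "real ^ 3" where "x = vector [1, 0, 0]" and "y = vector [t, sqrt (1 - t\<^sup>2), 0]"
  have t: "t\<^sup>2 \<le> 1" using assms by (simp add: abs_square_le_1)
  have S: "x \<in> S2" "y \<in> S2" unfolding sphere3_iff x_def y_def using t by simp_all
  have i: "inner x y = t" "inner x x = 1" "inner y y = 1"
    using S by (simp_all add: x_def y_def inner_vec_def sum_3 dist_norm norm_eq_1)
  let ?c = "(2 * real l + 1) / (4 * pi)"
  have c: "?c > 0" by simp
  have "(?c * legendre l t)\<^sup>2 \<le> ?c * ?c"
    using Cauchy_Schwarz_ineq_sum[of "\<lambda>\<mu>. sph_harm l \<mu> x" "\<lambda>\<mu>. sph_harm l \<mu> y" "{- int l..int l}"]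
    unfolding legendre_addition[OF S] power2_eq_square[of "sph_harm _ _ _"] legendre_addition[OF S(1) S(1)] legendre_addition[OF S(2) S(2)] i
    by (simp only: poly_legendre_poly_1 mult_1_right)
  then have "(?c * ?c) * (legendre l t)\<^sup>2 \<le> (?c * ?c) * 1"
    by (simp only: power_mult_distrib power2_eq_square[of ?c] mult_1_right)
  then have "(legendre l t)\<^sup>2 \<le> 1"
    using c by (simp only: mult_le_cancel_left_pos mult_pos_pos)
  then show ?thesis by (simp add: abs_square_le_1)
qed

text \<open>The eigenvalue of minus the Laplace-Beltrami operator on harmonics of degree l.\<close>

abbreviation eigval :: "nat \<Rightarrow> real" where "eigval l \<equiv> real l * (real l + 1)"

text \<open>A step of two degrees adds at most 2 l + 3, which is exactly the increment of the right
  side. The bound is attained at t = 1.\<close>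

lemma abs_legendre_deriv_le:
  assumes "\<bar>t\<bar> \<le> 1"
  shows "\<bar>legendre' l t\<bar> \<le> eigval l / 2"
proof (induction l rule: induct_nat_012)
  case (ge2 l)
  have "\<bar>(2 * real l + 3) * legendre (Suc l) t\<bar> \<le> 2 * real l + 3"
    using abs_legendre_poly_le_1[OF assms] by (simp add: abs_mult)
  then have "\<bar>legendre' l t + (2 * real l + 3) * legendre (Suc l) t\<bar> \<le>
      eigval l / 2 + (2 * real l + 3)"
    using ge2(1) by linarith
  then show ?case unfolding legendre_deriv_1_Suc_Suc
    by (simp add: field_simps)
qed (simp_all add: legendre_poly_def pderiv_pCons)

text \<open>The weight 1 - t^2 lets Legendre's equation replace a quantity of order l^4 by one of
  order l^2. In the application \<open>z'_sq_le\<close> supplies this weight.\<close>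

lemma abs_legendre_deriv_2_le:
  assumes "\<bar>t\<bar> \<le> 1"
  shows "(1 - t\<^sup>2) * \<bar>legendre'' l t\<bar> \<le> 2 * eigval l"
proof -
  have "(1 - t\<^sup>2) * legendre'' l t = 2 * (t * legendre' l t) - eigval l * legendre l t"
    using legendre_deriv_ode[where k=0 and l=l and t=t] by (simp add: numeral_2_eq_2 algebra_simps)
  moreover have "\<bar>t * legendre' l t\<bar> \<le> 1 * (eigval l / 2)"
    unfolding abs_mult using assms by (intro mult_mono abs_legendre_deriv_le) auto
  moreover have "\<bar>eigval l * legendre l t\<bar> \<le> eigval l * 1"
    unfolding abs_mult using assms by (intro mult_mono abs_legendre_poly_le_1) auto
  ultimately have "\<bar>(1 - t\<^sup>2) * legendre'' l t\<bar> \<le> 2 * eigval l"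
    by linarith
  moreover have "1 - t\<^sup>2 \<ge> 0" using assms by (simp add: abs_square_le_1)
  ultimately show ?thesis by (simp add: abs_mult)
qed

section \<open>The kernel ((1 + t) / 2)^M\<close>

text \<open>Half the integral of ((1 + t)/2)^M times the Legendre polynomial of degree l over
  [-1, 1].\<close>

definition power_coeff :: "nat \<Rightarrow> nat \<Rightarrow> real"
  where "power_coeff M l = (if l \<le> M then (fact M)\<^sup>2 / (fact (M - l) * fact (M + l + 1)) else 0)"

lemma power_coeff_nonneg: "power_coeff M l \<ge> 0"
  by (simp add: power_coeff_def)

lemma power_coeff_0: "power_coeff M 0 = 1 / (real M + 1)"
proof -
  have "fact (M + 0 + 1) = (real M + 1) * fact M" by (simp add: algebra_simps)
  then show ?thesis by (simp only: power_coeff_def) (simp add: power2_eq_square)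
qed

lemma power_coeff_Suc_right:
  "l \<le> M \<Longrightarrow> power_coeff M (Suc l) = power_coeff M l * (real M - real l) / (real M + real l + 2)"
proof (cases "l = M")
  case False
  assume "l \<le> M"
  with False have "M - l = Suc (M - Suc l)" "Suc l \<le> M" by auto
  then have f: "fact (M - l) = (real M - real l) * fact (M - Suc l)" and ne: "real M - real l \<noteq> 0"
    by (simp_all add: of_nat_diff)
  have g: "fact (M + Suc l + 1) = (real M + real l + 2) * fact (M + l + 1)" by (simp add: algebra_simps)
  have "p / (f1 * (c * g1)) = p / (a * f1 * g1) * a / c" if "a \<noteq> 0" for p f1 g1 a c :: real
    using that by simp
  then show ?thesis using \<open>l \<le> M\<close> \<open>Suc l \<le> M\<close> ne unfolding power_coeff_def g f by (simp del: fact_Suc)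
qed (simp add: power_coeff_def)

lemma power_coeff_Suc:
  "l \<le> M \<Longrightarrow> power_coeff (Suc M) l = power_coeff M l * (real M + 1)\<^sup>2 / ((real M + 1 - real l) * (real M + real l + 2))"
proof -
  assume "l \<le> M"
  then have f: "fact (Suc M - l) = (real M + 1 - real l) * fact (M - l)" by (simp add: Suc_diff_le of_nat_diff)
  have g: "fact (Suc M + l + 1) = (real M + real l + 2) * fact (M + l + 1)" by (simp add: algebra_simps)
  have h: "fact (Suc M) = (real M + 1) * fact M" by (simp add: algebra_simps)
  show ?thesis using \<open>l \<le> M\<close> unfolding power_coeff_def f g h by (simp add: power_mult_distrib mult_ac del: fact_Suc)
qed

text \<open>Multiplication by (1 + t)/2 written in coefficients, with Bonnet's recurrence for the
  factor t. For l <= M everything is a multiple of \<open>power_coeff M l\<close>; at l = Suc M only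
  the term from l - 1 survives.\<close>

lemma power_coeff_recurrence:
  assumes "l \<le> Suc M"
  shows "(2 * real l + 1) * power_coeff (Suc M) l =
    ((2 * real l + 1) * power_coeff M l + real l * power_coeff M (l - 1) + (real l + 1) * power_coeff M (Suc l)) / 2"
proof (cases "l = Suc M")
  case True
  have f: "fact (Suc M + Suc M + 1) = (2 * real M + 3) * ((2 * real M + 2) * fact (M + M + 1))" by (simp add: algebra_simps)
  have h: "fact (Suc M) = (real M + 1) * fact M" by (simp add: algebra_simps)
  have a: "power_coeff (Suc M) (Suc M) = ((real M + 1) * fact M)\<^sup>2 / ((2 * real M + 3) * ((2 * real M + 2) * fact (M + M + 1)))"
    unfolding power_coeff_def f h by simp
  have b: "power_coeff M M = (fact M)\<^sup>2 / fact (M + M + 1)" by (simp add: power_coeff_def)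
  have c: "power_coeff M (Suc M) = 0" "power_coeff M (Suc (Suc M)) = 0" by (simp_all add: power_coeff_def)
  have "(2 * p + 3) * (((p + 1) * u)\<^sup>2 / ((2 * p + 3) * ((2 * p + 2) * v))) = (p + 1) * (u\<^sup>2 / v) / 2"
    if "p \<ge> 0" "v > 0" for p u v :: real
  proof -
    have "2 * p + 3 \<noteq> 0" "2 * p + 2 \<noteq> 0" "v \<noteq> 0" using that by auto
    then show ?thesis by (simp add: divide_simps) (simp add: algebra_simps power2_eq_square)
  qed
  from this[of "real M" "fact (M + M + 1)" "fact M"]
  show ?thesis unfolding True diff_Suc_1 a b c by (simp add: add.commute)
next
  case False
  then have l: "l \<le> M" using assms by simp
  let ?g = "power_coeff M l" and ?M = "real M" and ?l = "real l"
  have ne: "?M + 1 - ?l > 0" "?M + ?l + 2 > 0" using l by auto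
  have a: "?l * power_coeff M (l - 1) = ?g * (?l * (?M + ?l + 1) / (?M + 1 - ?l))"
  proof (cases l)
    case (Suc j)
    then have p: "power_coeff M (Suc j) = power_coeff M j * (?M - real j) / (?M + real j + 2)"
      using l by (intro power_coeff_Suc_right) simp
    have ne: "?M - real j \<noteq> 0" "?M + real j + 2 \<noteq> 0" using Suc l by auto
    have e: "?M + ?l + 1 = ?M + real j + 2" "?M + 1 - ?l = ?M - real j" using Suc by auto
    have "q * p = p * a / b * (q * b / a)" if "a \<noteq> 0" "b \<noteq> 0" for p q a b :: real
      using that by simp
    from this[OF ne, of ?l "power_coeff M j"] show ?thesis
      unfolding e using p by (simp only: Suc diff_Suc_1)
  qed simp
  have "(2 * ?l + 1) * ((?M + 1)\<^sup>2 / ((?M + 1 - ?l) * (?M + ?l + 2)))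
      = ((2 * ?l + 1) + ?l * (?M + ?l + 1) / (?M + 1 - ?l) + (?l + 1) * ((?M - ?l) / (?M + ?l + 2))) / 2"
  proof -
    \<comment> \<open>The two denominators are taken as variables; M and l are recovered from their
      sum and difference, which leaves an identity of rational functions in p and q.\<close>
    define p q where "p = ?M + 1 - ?l" and "q = ?M + ?l + 2"
    have pq: "p \<noteq> 0" "q \<noteq> 0" using ne by (simp_all add: p_def q_def)
    have r: "?M + 1 = (p + q - 1) / 2" "?l = (q - p - 1) / 2" "?M + ?l + 1 = q - 1" "?M - ?l = p - 1"
      by (simp_all add: p_def q_def)
    have "(q - p) * (((p + q - 1) / 2)\<^sup>2 / (p * q)) =
       ((q - p) + (q - p - 1) / 2 * (q - 1) / p + (q - p + 1) / 2 * ((p - 1) / q)) / 2"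
      using pq by (simp add: divide_simps) (simp add: algebra_simps power2_eq_square)
    moreover have "2 * ?l + 1 = q - p" "?l + 1 = (q - p + 1) / 2" by (simp_all add: p_def q_def)
    ultimately show ?thesis unfolding p_def[symmetric] q_def[symmetric] unfolding r(1,3,4) by (simp only: r(2)[symmetric])
  qed
  then have "?g * ((2 * ?l + 1) * ((?M + 1)\<^sup>2 / ((?M + 1 - ?l) * (?M + ?l + 2))))
      = ?g * (((2 * ?l + 1) + ?l * (?M + ?l + 1) / (?M + 1 - ?l) + (?l + 1) * ((?M - ?l) / (?M + ?l + 2))) / 2)"
    by (rule arg_cong)
  then show ?thesis unfolding a power_coeff_Suc[OF l] power_coeff_Suc_right[OF l]
    by (simp add: distrib_left distrib_right add_divide_distrib mult_ac)
qed

lemma x_mult_legendre_sum: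
  "t * (\<Sum>l\<le>n. (2 * real l + 1) * c l * legendre l t) =
    (\<Sum>l\<le>n. (real l * c (l - 1) + (real l + 1) * c (Suc l)) * legendre l t)
     + (real n + 1) * c n * legendre (Suc n) t - (real n + 1) * c (Suc n) * legendre n t"
proof (induction n)
  case 0
  then show ?case by (simp add: legendre_poly_def pderiv_pCons)
next
  case (Suc n)
  have *: "(2 * real (Suc n) + 1) * c (Suc n) * (t * legendre (Suc n) t) =
      c (Suc n) * ((real n + 2) * legendre (Suc (Suc n)) t + (real n + 1) * legendre n t)"
    unfolding legendre_poly_three_term by (simp add: algebra_simps)
  have "t * (\<Sum>l\<le>Suc n. (2 * real l + 1) * c l * legendre l t) =
    t * (\<Sum>l\<le>n. (2 * real l + 1) * c l * legendre l t)
      + (2 * real (Suc n) + 1) * c (Suc n) * (t * legendre (Suc n) t)"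
    by (simp add: algebra_simps)
  then show ?case unfolding Suc * by (simp add: algebra_simps)
qed

lemma power_legendre_expansion:
  "((1 + t) / 2) ^ M = (\<Sum>l\<le>M. (2 * real l + 1) * power_coeff M l * legendre l t)"
proof (induction M)
  case 0
  then show ?case by (simp add: power_coeff_def legendre_poly_def)
next
  case (Suc M)
  have z: "power_coeff M (Suc M) = 0" "power_coeff M (Suc (Suc M)) = 0" by (simp_all add: power_coeff_def)
  have IH: "((1 + t) / 2) ^ M = (\<Sum>l\<le>Suc M. (2 * real l + 1) * power_coeff M l * legendre l t)"
    using Suc by (simp add: z)
  have "((1 + t) / 2) ^ Suc M = (((1 + t) / 2) ^ M + t * ((1 + t) / 2) ^ M) / 2"
    by (simp add: field_simps)
  also have "\<dots> = (\<Sum>l\<le>Suc M. ((2 * real l + 1) * power_coeff M l + real l * power_coeff M (l - 1)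
      + (real l + 1) * power_coeff M (Suc l)) / 2 * legendre l t)"
    unfolding IH x_mult_legendre_sum z
    by (simp only: mult_zero_right mult_zero_left add_0_right diff_0_right sum.distrib[symmetric] sum_divide_distrib)
      (rule sum.cong[OF refl], simp add: algebra_simps add_divide_distrib)
  also have "\<dots> = (\<Sum>l\<le>Suc M. (2 * real l + 1) * power_coeff (Suc M) l * legendre l t)"
    by (intro sum.cong[OF refl]) (simp only: power_coeff_recurrence atMost_iff)
  finally show ?case .
qed

text \<open>With x = (l + 1)/(M + 1) the ratio of consecutive coefficients is (1 - x)/(1 + x) <= 1 -
  x <= exp (- x). The exponents add up to l (l + 1) / (2 (M + 1)).\<close>

lemma power_coeff_le_exp:
  "power_coeff M l \<le> exp (- eigval l / (2 * (real M + 1))) / (real M + 1)"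
proof (induction l)
  case (Suc l)
  show ?case
  proof (cases "l \<le> M")
    case True
    define x where "x = (real l + 1) / (real M + 1)"
    have x: "0 \<le> x" "x \<le> 1" using True by (simp_all add: x_def)
    have "(real M - real l) / (real M + real l + 2) = (1 - x) / (1 + x)"
      by (simp add: x_def divide_simps)
    also have "\<dots> \<le> 1 - x"
    proof -
      have "(1 - x) * 1 \<le> (1 - x) * (1 + x)" using x by (intro mult_left_mono) auto
      then show ?thesis using x by (simp add: pos_divide_le_eq)
    qed
    also have "\<dots> \<le> exp (- x)" using exp_ge_add_one_self[of "- x"] by simp
    finally have le: "(real M - real l) / (real M + real l + 2) \<le> exp (- x)" .
    have "power_coeff M (Suc l) = power_coeff M l * ((real M - real l) / (real M + real l + 2))"
      by (simp add: power_coeff_Suc_right[OF True])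
    also have "\<dots> \<le> (exp (- eigval l / (2 * (real M + 1))) / (real M + 1)) * exp (- x)"
      using True by (intro mult_mono Suc.IH le) auto
    also have "\<dots> = exp (- eigval l / (2 * (real M + 1)) + (- x)) / (real M + 1)"
      by (simp only: exp_add times_divide_eq_left)
    also have "- eigval l / (2 * (real M + 1)) + (- x) = - (real (Suc l) * (real (Suc l) + 1)) / (2 * (real M + 1))"
      by (simp add: x_def divide_simps) (simp add: algebra_simps)
    finally show ?thesis .
  next
    case False
    then show ?thesis by (simp add: power_coeff_def)
  qed
qed (simp add: power_coeff_0)

text \<open>From ln r <= r - 1 at r = u / s, dropping a factor exp (- s).\<close>

lemma powr_le_exp:
  fixes u s :: real
  assumes "u > 0" "s > 0"
  shows "u powr s \<le> s powr s * exp u"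
proof -
  have "ln (u / s) \<le> u / s - 1" using assms by (intro ln_le_minus_one) simp
  then have "s * ln (u / s) \<le> s * (u / s - 1)" using assms by (intro mult_left_mono) auto
  then have "s * ln u \<le> s * ln s + u" using assms by (simp add: ln_div algebra_simps)
  then have "exp (s * ln u) \<le> exp (s * ln s + u)" by simp
  then show ?thesis using assms by (simp add: powr_def exp_add)
qed

lemma power_coeff_le_powr:
  assumes "s > 0" "l \<ge> 1" "M \<ge> 1"
  shows "power_coeff M l \<le> (4 * s) powr s * real M powr (s - 1) * real l powr (- 2 * s)"
proof -
  \<comment> \<open>For M >= 1 the denominator 4 M is at least 2 (M + 1), so u is a lower bound of
    the exponent that is homogeneous in l^2 / M; this fixes the powers of M and l.\<close>
  define u where "u = (real l)\<^sup>2 / (4 * real M)"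
  have u: "u > 0" using assms by (simp add: u_def)
  have "u \<le> eigval l / (2 * (real M + 1))"
    unfolding u_def power2_eq_square using assms by (intro frac_le mult_left_mono) auto
  then have "exp (- eigval l / (2 * (real M + 1))) \<le> exp (- u)" by simp
  also have "\<dots> \<le> s powr s * u powr (- s)"
    using powr_le_exp[OF u assms(1)] u by (simp add: exp_minus powr_minus field_simps)
  also have "u powr (- s) = (4 * real M) powr s * real l powr (- 2 * s)"
  proof -
    have "u powr (- s) = ((real l)\<^sup>2 powr (- s)) / ((4 * real M) powr (- s))"
      unfolding u_def by (rule powr_divide)
    also have "(real l)\<^sup>2 powr (- s) = real l powr (- 2 * s)"
      using assms by (simp add: powr_powr flip: powr_numeral)
    finally show ?thesis by (simp add: powr_minus divide_inverse mult.commute)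
  qed
  finally have "exp (- eigval l / (2 * (real M + 1))) \<le> (4 * s) powr s * real M powr s * real l powr (- 2 * s)"
    using assms by (simp add: powr_mult mult_ac)
  then have "power_coeff M l \<le> ((4 * s) powr s * real M powr s * real l powr (- 2 * s)) / real M"
    using assms by (intro order_trans[OF power_coeff_le_exp] frac_le) auto
  also have "\<dots> = (4 * s) powr s * real M powr (s - 1) * real l powr (- 2 * s)"
    using assms by (simp add: powr_diff)
  finally show ?thesis .
qed

section \<open>Gaussian sums over separated points\<close>

lemma sum_exp_minus_abs_le: "(\<Sum>n\<in>{- int R..int R}. exp (- \<bar>real_of_int n\<bar>)) \<le> 3"
proof -
  have e: "exp (-1::real) \<le> 1 / 2"
    using exp_ge_add_one_self[of 1] by (simp add: exp_minus field_simps)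
  have "(\<Sum>k=1..R. exp (- real k)) \<le> 1 - (1 / 2) ^ R"
  proof (induction R)
    case (Suc R)
    have "exp (- real (Suc R)) = exp (-1) ^ Suc R" unfolding exp_of_nat_mult[symmetric] by simp
    also have "\<dots> \<le> (1 / 2) ^ Suc R" using e by (intro power_mono) auto
    finally show ?case using Suc by simp
  qed simp
  also have "\<dots> \<le> 1" by simp
  finally show ?thesis
    unfolding sum_symmetric_int_interval by (simp add: sum.distrib flip: sum_distrib_left)
qed

text \<open>Cubes of side half the separation contain at most one point each.\<close>

lemma sum_gaussian_separated_le:
  fixes x :: "real ^ 3"
  assumes "finite X" "\<delta> > 0" "\<And>y z. y \<in> X \<Longrightarrow> z \<in> X \<Longrightarrow> y \<noteq> z \<Longrightarrow> dist y z \<ge> \<delta>"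
  shows "(\<Sum>y\<in>X. exp (- 4 * (dist x y)\<^sup>2 / \<delta>\<^sup>2)) \<le> 27 * exp 6"
proof -
  define s where "s = \<delta> / 2"
  have s: "s > 0" using assms by (simp add: s_def)
  define fl where "fl y i = \<lfloor>(vec_nth y i - vec_nth x i) / s\<rfloor>" for y and i :: 3
  define f where "f y = (fl y 1, fl y 2, fl y 3)" for y
  define w where "w = (\<lambda>(i, j, k). exp (- \<bar>real_of_int i\<bar>) * (exp (- \<bar>real_of_int j\<bar>) * exp (- \<bar>real_of_int k\<bar>)))"
  have nsq: "(dist y z)\<^sup>2 = (vec_nth y 1 - vec_nth z 1)\<^sup>2 + (vec_nth y 2 - vec_nth z 2)\<^sup>2 + (vec_nth y 3 - vec_nth z 3)\<^sup>2" for y z :: "real ^ 3"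
    unfolding dist_norm power2_norm_eq_inner by (simp add: inner_vec_def sum_3 power2_eq_square)
  have "inj_on f X"
  proof (rule inj_onI, rule ccontr)
    fix y z assume yz: "y \<in> X" "z \<in> X" "f y = f z" "y \<noteq> z"
    have c: "(vec_nth y i - vec_nth z i)\<^sup>2 \<le> s\<^sup>2" if "fl y i = fl z i" for i
    proof -
      have "\<bar>(vec_nth y i - vec_nth x i) / s - (vec_nth z i - vec_nth x i) / s\<bar> \<le> 1"
        using that unfolding fl_def by linarith
      moreover have "(vec_nth y i - vec_nth x i) / s - (vec_nth z i - vec_nth x i) / s = (vec_nth y i - vec_nth z i) / s"
        by (simp add: diff_divide_distrib)
      ultimately have "\<bar>vec_nth y i - vec_nth z i\<bar> \<le> \<bar>s\<bar>" using s by (simp add: abs_divide)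
      then show ?thesis by (simp only: abs_le_square_iff)
    qed
    \<comment> \<open>The diagonal of a cube has squared length 3/4 \<delta>^2, which is less than
      \<delta>^2.\<close>
    have "(dist y z)\<^sup>2 \<le> s\<^sup>2 + s\<^sup>2 + s\<^sup>2"
      unfolding nsq using yz(3) by (intro add_mono c) (simp_all add: f_def)
    moreover have "\<delta>\<^sup>2 \<le> (dist y z)\<^sup>2" using assms yz by (intro power_mono) auto
    ultimately have "\<delta>\<^sup>2 \<le> 3 * s\<^sup>2" by simp
    then show False using assms(2) by (simp add: s_def power_divide)
  qed
  have le: "exp (- 4 * (dist x y)\<^sup>2 / \<delta>\<^sup>2) \<le> exp 6 * w (f y)" for y
  proof -
    \<comment> \<open>A linear lower bound for the square turns the Gaussian into a product of
      exponentials in the cube indices. Each coordinate loses 2, hence the factor exp 6.\<close>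
    have c: "\<bar>real_of_int (fl y i)\<bar> - 2 \<le> ((vec_nth y i - vec_nth x i) / s)\<^sup>2" for i
    proof -
      define u where "u = (vec_nth y i - vec_nth x i) / s"
      have "\<bar>real_of_int \<lfloor>u\<rfloor>\<bar> \<le> \<bar>u\<bar> + 1" by linarith
      moreover have "u\<^sup>2 \<ge> \<bar>u\<bar> - 1"
      proof -
        have "0 \<le> (\<bar>u\<bar> - 1/2)\<^sup>2" by simp
        then show ?thesis by (simp add: power2_eq_square algebra_simps)
      qed
      ultimately show ?thesis by (simp add: fl_def u_def)
    qed
    have "4 * (dist x y)\<^sup>2 / \<delta>\<^sup>2 = ((vec_nth y 1 - vec_nth x 1) / s)\<^sup>2 + ((vec_nth y 2 - vec_nth x 2) / s)\<^sup>2 + ((vec_nth y 3 - vec_nth x 3) / s)\<^sup>2"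
    proof -
      have q: "(a / s)\<^sup>2 = 4 * a\<^sup>2 / \<delta>\<^sup>2" for a by (simp add: s_def power_divide power_mult_distrib)
      show ?thesis unfolding dist_commute[of x y] nsq q by (simp add: add_divide_distrib distrib_left)
    qed
    then have "- 4 * (dist x y)\<^sup>2 / \<delta>\<^sup>2 \<le> 6 + (- \<bar>real_of_int (fl y 1)\<bar> + (- \<bar>real_of_int (fl y 2)\<bar> + - \<bar>real_of_int (fl y 3)\<bar>))"
      using c[of 1] c[of 2] c[of 3] by simp
    then have "exp (- 4 * (dist x y)\<^sup>2 / \<delta>\<^sup>2) \<le> exp (6 + (- \<bar>real_of_int (fl y 1)\<bar> + (- \<bar>real_of_int (fl y 2)\<bar> + - \<bar>real_of_int (fl y 3)\<bar>)))"
      by (simp only: exp_le_cancel_iff)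
    then show ?thesis by (simp only: exp_add w_def f_def prod.case)
  qed
  have "finite (f ` X)" using assms(1) by simp
  \<comment> \<open>Enlarging the index set to a box makes the sum factor into three sums over one
    coordinate.\<close>
  have "\<exists>R::nat. f ` X \<subseteq> {- int R..int R} \<times> {- int R..int R} \<times> {- int R..int R}"
  proof -
    define R where "R = (\<Sum>y\<in>X. nat \<bar>fl y 1\<bar> + nat \<bar>fl y 2\<bar> + nat \<bar>fl y 3\<bar>)"
    have "nat \<bar>fl y 1\<bar> + nat \<bar>fl y 2\<bar> + nat \<bar>fl y 3\<bar> \<le> R" if "y \<in> X" for y
      unfolding R_def by (rule member_le_sum) (use that assms in auto)
    then show ?thesis by (intro exI[of _ R]) (force simp: f_def)
  qed
  then obtain R :: nat where R: "f ` X \<subseteq> {- int R..int R} \<times> {- int R..int R} \<times> {- int R..int R}" ..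
  let ?I = "{- int R..int R}"
  let ?E = "\<Sum>n\<in>?I. exp (- \<bar>real_of_int n\<bar>)"
  have "(\<Sum>y\<in>X. exp (- 4 * (dist x y)\<^sup>2 / \<delta>\<^sup>2)) \<le> (\<Sum>y\<in>X. exp 6 * w (f y))"
    by (intro sum_mono le)
  also have "\<dots> = exp 6 * (\<Sum>n\<in>f ` X. w n)"
    by (simp add: sum_distrib_left sum.reindex[OF \<open>inj_on f X\<close>])
  also have "(\<Sum>n\<in>f ` X. w n) \<le> (\<Sum>n\<in>?I \<times> ?I \<times> ?I. w n)"
    using R by (intro sum_mono2) (auto simp: w_def)
  also have "\<dots> = ?E * (?E * ?E)"
  proof -
    have pr: "(\<Sum>(i, p)\<in>A \<times> B. f i * g p) = sum f A * sum g B" for f :: "int \<Rightarrow> real" and g :: "'z \<Rightarrow> real" and A B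
      by (simp only: sum_product sum.cartesian_product)
    have pr2: "(\<Sum>(i, p)\<in>A \<times> B. f i * g p) = sum f A * sum g B" for f g :: "int \<Rightarrow> real" and A B
      by (simp only: sum_product sum.cartesian_product)
    have "w = (\<lambda>(i, p). exp (- \<bar>real_of_int i\<bar>) * (\<lambda>(j, k). exp (- \<bar>real_of_int j\<bar>) * exp (- \<bar>real_of_int k\<bar>)) p)"
      by (auto simp: w_def)
    then show ?thesis by (simp only: pr pr2)
  qed
  also have "\<dots> \<le> 3 * (3 * 3)"
    by (intro mult_mono sum_exp_minus_abs_le sum_nonneg mult_nonneg_nonneg) auto
  finally show ?thesis by simp
qed

section \<open>Quadratic forms of zonal kernels by degree\<close>

definition zonal_energy :: "(real ^ 3) set \<Rightarrow> (real ^ 3 \<Rightarrow> real) \<Rightarrow> nat \<Rightarrow> real"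
  where "zonal_energy X A l = (\<Sum>\<mu>\<in>{- int l..int l}. (\<Sum>x\<in>X. A x * sph_harm l \<mu> x)\<^sup>2)"

lemma zonal_energy_nonneg: "zonal_energy X A l \<ge> 0"
  by (simp add: zonal_energy_def sum_nonneg)

text \<open>The addition theorem, summed against the weights. Hence a zonal kernel with harmonic
  coefficients c l has as quadratic form the sum of c l times these nonnegative energies.\<close>

lemma zonal_energy_eq:
  assumes "X \<subseteq> S2"
  shows "zonal_energy X A l = (\<Sum>x\<in>X. \<Sum>y\<in>X. A x * A y * ((2 * real l + 1) / (4 * pi) * legendre l (inner x y)))"
proof -
  have "zonal_energy X A l = (\<Sum>\<mu>\<in>{- int l..int l}. \<Sum>x\<in>X. \<Sum>y\<in>X. A x * A y * (sph_harm l \<mu> x * sph_harm l \<mu> y))"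
    by (simp add: zonal_energy_def power2_eq_square sum_product mult_ac)
  also have "\<dots> = (\<Sum>x\<in>X. \<Sum>y\<in>X. \<Sum>\<mu>\<in>{- int l..int l}. A x * A y * (sph_harm l \<mu> x * sph_harm l \<mu> y))"
    by (subst sum.swap, intro sum.cong[OF refl], rule sum.swap)
  also have "\<dots> = (\<Sum>x\<in>X. \<Sum>y\<in>X. A x * A y * (\<Sum>\<mu>\<in>{- int l..int l}. sph_harm l \<mu> x * sph_harm l \<mu> y))"
    by (simp add: sum_distrib_left)
  also have "\<dots> = (\<Sum>x\<in>X. \<Sum>y\<in>X. A x * A y * ((2 * real l + 1) / (4 * pi) * legendre l (inner x y)))"
    using assms by (intro sum.cong[OF refl] arg_cong2[where f="(*)"] legendre_addition) auto
  finally show ?thesis .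
qed

definition power_kernel :: "nat \<Rightarrow> real ^ 3 \<Rightarrow> real ^ 3 \<Rightarrow> real"
  where "power_kernel M x y = ((1 + inner x y) / 2) ^ M"

lemma power_kernel_form:
  assumes "X \<subseteq> S2"
  shows "(\<Sum>x\<in>X. \<Sum>y\<in>X. A x * A y * power_kernel M x y) = 4 * pi * (\<Sum>l\<le>M. power_coeff M l * zonal_energy X A l)"
proof -
  have e: "A x * A y * power_kernel M x y = (\<Sum>l\<le>M. 4 * pi * power_coeff M l * (A x * A y * ((2 * real l + 1) / (4 * pi) * legendre l (inner x y))))" for x y
    unfolding power_kernel_def power_legendre_expansion sum_distrib_left by (rule sum.cong[OF refl]) simp
  have "(\<Sum>x\<in>X. \<Sum>y\<in>X. A x * A y * power_kernel M x y) =
    (\<Sum>l\<le>M. \<Sum>x\<in>X. \<Sum>y\<in>X. 4 * pi * power_coeff M l * (A x * A y * ((2 * real l + 1) / (4 * pi) * legendre l (inner x y))))"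
    unfolding e by (simp only: sum.swap[where A=X and B="{..M}"])
  also have "\<dots> = (\<Sum>l\<le>M. 4 * pi * power_coeff M l * zonal_energy X A l)"
    unfolding zonal_energy_eq[OF assms] by (simp only: sum_distrib_left)
  finally show ?thesis by (simp add: sum_distrib_left mult_ac)
qed

lemma power_kernel_commute: "power_kernel M x y = power_kernel M y x"
  by (simp add: power_kernel_def inner_commute)

text \<open>On the sphere (1 + x.y)/2 equals 1 - |x - y|^2/4, and 1 - r <= exp (- r).\<close>

lemma power_kernel_le_exp:
  assumes "x \<in> S2" "y \<in> S2"
  shows "0 \<le> power_kernel M x y" "power_kernel M x y \<le> exp (- real M * (dist x y)\<^sup>2 / 4)"
proof -
  have n: "inner x x = 1" "inner y y = 1" using assms by (simp_all add: norm_eq_1)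
  have d: "(1 + inner x y) / 2 = 1 - (dist x y)\<^sup>2 / 4"
    unfolding dist_norm power2_norm_eq_inner by (simp add: inner_diff inner_commute n field_simps)
  have "\<bar>inner x y\<bar> \<le> norm x * norm y" by (rule Cauchy_Schwarz_ineq2)
  then have pos: "0 \<le> (1 + inner x y) / 2" using assms by simp
  then show "0 \<le> power_kernel M x y" by (simp add: power_kernel_def)
  have "(1 + inner x y) / 2 \<le> exp (- (dist x y)\<^sup>2 / 4)"
    unfolding d using exp_ge_add_one_self[of "- (dist x y)\<^sup>2 / 4"] by simp
  then have "power_kernel M x y \<le> exp (- (dist x y)\<^sup>2 / 4) ^ M"
    unfolding power_kernel_def using pos by (intro power_mono)
  then show "power_kernel M x y \<le> exp (- real M * (dist x y)\<^sup>2 / 4)"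
    by (simp flip: exp_of_nat_mult)
qed

lemma power_kernel_self: "x \<in> S2 \<Longrightarrow> power_kernel M x x = 1"
  by (simp add: power_kernel_def power2_norm_eq_inner[symmetric])

section \<open>Diagonal dominance of the comparison kernel\<close>

definition separated :: "real \<Rightarrow> (real ^ 3) set \<Rightarrow> bool"
  where "separated \<delta> X \<longleftrightarrow> (\<forall>x\<in>X. \<forall>y\<in>X. x \<noteq> y \<longrightarrow> \<delta> \<le> dist x y)"

text \<open>The diagonal entries of the kernel on the sphere are 1, so this leaves half of the
  diagonal over.\<close>

definition diag_dominant :: "nat \<Rightarrow> (real ^ 3) set \<Rightarrow> bool"
  where "diag_dominant M X \<longleftrightarrow> (\<forall>x\<in>X. (\<Sum>y\<in>X - {x}. power_kernel M x y) \<le> 1 / 2)"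

lemma ex_diag_dominant:
  "\<exists>B>0. \<forall>\<delta> X. 0 < \<delta> \<longrightarrow> \<delta> \<le> 2 \<longrightarrow> finite X \<longrightarrow> X \<subseteq> S2 \<longrightarrow> separated \<delta> X
    \<longrightarrow> (\<exists>M\<ge>1. real M \<le> B / \<delta>\<^sup>2 \<and> diag_dominant M X)"
proof -
  \<comment> \<open>Chosen so that exp (- E) brings the Gaussian sum, at most 27 exp 6, down to
    1/2.\<close>
  define E where "E = ln (54 * exp 6 :: real)"
  have E: "E > 0" "exp (- E) * (27 * exp 6) = 1 / 2"
  proof -
    have "exp 6 \<ge> (1::real)" by simp
    then show "E > 0" unfolding E_def by (intro ln_gt_zero) linarith
    show "exp (- E) * (27 * exp 6) = 1 / 2" by (simp add: E_def exp_minus)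
  qed
  have "\<exists>M\<ge>1. real M \<le> (20 + 4 * E) / \<delta>\<^sup>2 \<and> diag_dominant M X"
    if d: "0 < \<delta>" "\<delta> \<le> 2" and X: "finite X" "X \<subseteq> S2" "separated \<delta> X" for \<delta> X
  proof -
    \<comment> \<open>With M \<delta>^2 >= 16 + 4 E the exponent M d^2/4 at distance d splits into 4
      d^2/\<delta>^2, as in the Gaussian sum, and E d^2/\<delta>^2, which is at least E off the
      diagonal. Rounding up costs 1 <= 4/\<delta>^2, whence 20 in place of 16.\<close>
    define M where "M = nat \<lceil>(16 + 4 * E) / \<delta>\<^sup>2\<rceil>"
    have d2: "\<delta>\<^sup>2 \<le> 4" using d power_mono[of \<delta> 2 2] by simp
    have pos: "(16 + 4 * E) / \<delta>\<^sup>2 > 0" using d E by simp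
    have M1: "M \<ge> 1" using pos by (simp add: M_def Suc_le_eq)
    have Mge: "real M \<ge> (16 + 4 * E) / \<delta>\<^sup>2" unfolding M_def by (rule real_nat_ceiling_ge)
    have "real M \<le> (16 + 4 * E) / \<delta>\<^sup>2 + 1" unfolding M_def using pos by linarith
    also have "1 \<le> 4 / \<delta>\<^sup>2" using d d2 by (simp add: pos_le_divide_eq)
    finally have Mle: "real M \<le> (20 + 4 * E) / \<delta>\<^sup>2" by (simp add: add_divide_distrib)
    have "(\<Sum>y\<in>X - {x}. power_kernel M x y) \<le> 1 / 2" if x: "x \<in> X" for x
    proof -
      have "power_kernel M x y \<le> exp (- E) * exp (- 4 * (dist x y)\<^sup>2 / \<delta>\<^sup>2)" if y: "y \<in> X - {x}" for y
      proof -
        have "\<delta>\<^sup>2 \<le> (dist x y)\<^sup>2" using X(3) x y d by (intro power_mono) (auto simp: separated_def)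
        then have 1: "E \<le> E * ((dist x y)\<^sup>2 / \<delta>\<^sup>2)" using E d by (simp add: pos_le_divide_eq)
        have "(16 + 4 * E) / \<delta>\<^sup>2 * ((dist x y)\<^sup>2 / 4) \<le> real M * ((dist x y)\<^sup>2 / 4)"
          by (intro mult_right_mono Mge) auto
        then have "- real M * (dist x y)\<^sup>2 / 4 \<le> - (4 * (dist x y)\<^sup>2 / \<delta>\<^sup>2 + E * ((dist x y)\<^sup>2 / \<delta>\<^sup>2))"
          by (simp add: add_divide_distrib algebra_simps)
        also have "\<dots> \<le> - E + (- 4 * (dist x y)\<^sup>2 / \<delta>\<^sup>2)" using 1 by simp
        finally have "exp (- real M * (dist x y)\<^sup>2 / 4) \<le> exp (- E + (- 4 * (dist x y)\<^sup>2 / \<delta>\<^sup>2))" by simp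
        then have "exp (- real M * (dist x y)\<^sup>2 / 4) \<le> exp (- E) * exp (- 4 * (dist x y)\<^sup>2 / \<delta>\<^sup>2)"
          by (simp only: exp_add)
        moreover have "power_kernel M x y \<le> exp (- real M * (dist x y)\<^sup>2 / 4)"
          using X x y by (intro power_kernel_le_exp) auto
        ultimately show ?thesis by linarith
      qed
      then have "(\<Sum>y\<in>X - {x}. power_kernel M x y) \<le> (\<Sum>y\<in>X - {x}. exp (- E) * exp (- 4 * (dist x y)\<^sup>2 / \<delta>\<^sup>2))"
        by (rule sum_mono)
      also have "\<dots> = exp (- E) * (\<Sum>y\<in>X - {x}. exp (- 4 * (dist x y)\<^sup>2 / \<delta>\<^sup>2))"
        by (simp add: sum_distrib_left)
      also have "\<dots> \<le> exp (- E) * (27 * exp 6)"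
        using X d by (intro mult_left_mono sum_gaussian_separated_le) (auto simp: separated_def)
      finally show ?thesis using E by simp
    qed
    then show ?thesis using M1 Mle by (auto simp: diag_dominant_def)
  qed
  then show ?thesis using E(1) by (intro exI[of _ "20 + 4 * E"]) auto
qed

text \<open>Each mixed product is at least minus half the sum of the two squares, since the entries
  are nonnegative. By symmetry of the kernel both halves give the same sum, at most half of the
  diagonal.\<close>

lemma diag_dominant_form_ge:
  assumes "finite X" "X \<subseteq> S2" "diag_dominant M X"
  shows "(\<Sum>x\<in>X. (A x)\<^sup>2) / 2 \<le> (\<Sum>x\<in>X. \<Sum>y\<in>X. A x * A y * power_kernel M x y)"
proof -
  let ?K = "power_kernel M"
  have split: "(\<Sum>y\<in>X. A x * A y * ?K x y) = (A x)\<^sup>2 + (\<Sum>y\<in>X - {x}. A x * A y * ?K x y)" if "x \<in> X" for x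
    using that assms by (subst sum.remove[of _ x]) (auto simp: power_kernel_self power2_eq_square)
  have K0: "0 \<le> ?K x y" if "x \<in> X" "y \<in> X" for x y using that assms power_kernel_le_exp(1) by blast
  have ge: "- (((A x)\<^sup>2 * ?K x y + (A y)\<^sup>2 * ?K x y) / 2) \<le> A x * A y * ?K x y" if "x \<in> X" "y \<in> X" for x y
  proof -
    have "0 \<le> (A x + A y)\<^sup>2 * ?K x y" using K0[OF that] by simp
    also have "(A x + A y)\<^sup>2 * ?K x y = (A x)\<^sup>2 * ?K x y + (A y)\<^sup>2 * ?K x y + 2 * (A x * A y * ?K x y)"
      by (simp add: power2_eq_square algebra_simps)
    finally have *: "0 \<le> (A x)\<^sup>2 * ?K x y + (A y)\<^sup>2 * ?K x y + 2 * (A x * A y * ?K x y)" .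
    have "- ((p + q) / 2) \<le> r" if "0 \<le> p + q + 2 * r" for p q r :: real using that by (simp add: field_simps)
    from this[OF *] show ?thesis .
  qed
  have off: "(\<Sum>x\<in>X. \<Sum>y\<in>X - {x}. (A x)\<^sup>2 * ?K x y) \<le> (\<Sum>x\<in>X. (A x)\<^sup>2) / 2"
  proof -
    have "(\<Sum>y\<in>X - {x}. (A x)\<^sup>2 * ?K x y) \<le> (A x)\<^sup>2 * (1 / 2)" if "x \<in> X" for x
      using that assms(3) unfolding diag_dominant_def sum_distrib_left[symmetric] by (intro mult_left_mono) auto
    then have "(\<Sum>x\<in>X. \<Sum>y\<in>X - {x}. (A x)\<^sup>2 * ?K x y) \<le> (\<Sum>x\<in>X. (A x)\<^sup>2 * (1 / 2))" by (rule sum_mono)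
    then show ?thesis by (simp add: sum_divide_distrib)
  qed
  have swap: "(\<Sum>x\<in>X. \<Sum>y\<in>X - {x}. (A y)\<^sup>2 * ?K x y) = (\<Sum>x\<in>X. \<Sum>y\<in>X - {x}. (A x)\<^sup>2 * ?K x y)"
  proof -
    have "(\<Sum>x\<in>X. \<Sum>y\<in>X - {x}. (A y)\<^sup>2 * ?K x y) = (\<Sum>x\<in>X. \<Sum>y\<in>X. if x = y then 0 else (A y)\<^sup>2 * ?K x y)"
      by (intro sum.cong[OF refl] sum.mono_neutral_cong_left) (use assms in auto)
    also have "\<dots> = (\<Sum>y\<in>X. \<Sum>x\<in>X. if x = y then 0 else (A y)\<^sup>2 * ?K x y)" by (rule sum.swap)
    also have "\<dots> = (\<Sum>y\<in>X. \<Sum>x\<in>X - {y}. (A y)\<^sup>2 * ?K y x)"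
      by (intro sum.cong[OF refl] sum.mono_neutral_cong_right) (use assms in \<open>auto simp: power_kernel_commute\<close>)
    finally show ?thesis .
  qed
  have "- ((\<Sum>x\<in>X. (A x)\<^sup>2) / 2) \<le> - (((\<Sum>x\<in>X. \<Sum>y\<in>X - {x}. (A x)\<^sup>2 * ?K x y) + (\<Sum>x\<in>X. \<Sum>y\<in>X - {x}. (A y)\<^sup>2 * ?K x y)) / 2)"
    using off swap by simp
  also have "\<dots> = (\<Sum>x\<in>X. \<Sum>y\<in>X - {x}. - (((A x)\<^sup>2 * ?K x y + (A y)\<^sup>2 * ?K x y) / 2))"
    by (simp only: sum.distrib sum_divide_distrib[symmetric] sum_negf)
  also have "\<dots> \<le> (\<Sum>x\<in>X. \<Sum>y\<in>X - {x}. A x * A y * ?K x y)"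
    by (intro sum_mono ge) auto
  finally show ?thesis by (simp add: split sum.distrib)
qed

lemma card_le_diag_dominant:
  assumes "finite X" "X \<subseteq> S2" "diag_dominant M X" "M \<ge> 1"
  shows "real (card X) \<le> 3 * real M"
proof (cases "X = {}")
  case False
  let ?N = "real (card X)"
  have N: "?N > 0" using False assms by (simp add: card_gt_0_iff)
  \<comment> \<open>The harmonic of degree 0 is the constant 1 / sqrt (4 pi). This single term of a
    nonnegative sum gives N^2/(M + 1), while the row sums give at most 3/2 N.\<close>
  have "?N\<^sup>2 / (4 * pi) = zonal_energy X (\<lambda>_. 1) 0"
    by (simp add: zonal_energy_def sph_harm_def legendre_poly_def power_mult_distrib power_divide real_sqrt_divide)
  then have "?N\<^sup>2 / (real M + 1) = 4 * pi * (power_coeff M 0 * zonal_energy X (\<lambda>_. 1) 0)"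
    by (simp add: power_coeff_0 field_simps)
  also have "\<dots> \<le> 4 * pi * (\<Sum>l\<le>M. power_coeff M l * zonal_energy X (\<lambda>_. 1) l)"
    by (intro mult_left_mono member_le_sum) (auto simp: power_coeff_nonneg zonal_energy_nonneg)
  also have "\<dots> = (\<Sum>x\<in>X. \<Sum>y\<in>X. 1 * 1 * power_kernel M x y)"
    by (rule power_kernel_form[OF assms(2), of "\<lambda>_. 1", symmetric])
  also have "\<dots> = (\<Sum>x\<in>X. 1 + (\<Sum>y\<in>X - {x}. power_kernel M x y))"
    using assms by (intro sum.cong[OF refl]) (subst sum.remove, auto simp: power_kernel_self)
  also have "\<dots> \<le> (\<Sum>x\<in>X. 1 + 1 / 2)"
    using assms(3) by (intro sum_mono add_left_mono) (auto simp: diag_dominant_def)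
  also have "\<dots> = 3 / 2 * ?N" by simp
  finally have "?N * ?N \<le> (3 / 2 * (real M + 1)) * ?N"
    by (simp add: pos_divide_le_eq power2_eq_square mult_ac)
  then have "?N \<le> 3 / 2 * (real M + 1)" using N by simp
  then show ?thesis using assms(4) by simp
qed simp

text \<open>Above mt the coefficients \<psi> dominate a multiple of M^(1-s) times those of the
  comparison kernel; the energies of the degrees up to mt vanish. So the form with coefficients
  \<psi> inherits the lower bound from diagonal dominance.\<close>

lemma energy_sum_lower_bound:
  fixes \<psi> :: "nat \<Rightarrow> real"
  assumes s: "s > 1" and c: "c > 0"
    and psi: "\<And>l. int l > mt \<Longrightarrow> \<psi> l \<ge> (if l = 0 then c else c * real l powr (- 2 * s))"
  shows "\<exists>\<kappa>>0. \<forall>M X A S. 1 \<le> M \<longrightarrow> finite X \<longrightarrow> X \<subseteq> S2 \<longrightarrow> diag_dominant M X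
      \<longrightarrow> (\<forall>l. int l \<le> mt \<longrightarrow> zonal_energy X A l = 0) \<longrightarrow> (\<lambda>l. \<psi> l * zonal_energy X A l) sums S
      \<longrightarrow> \<kappa> * real M powr (1 - s) * (\<Sum>x\<in>X. (A x)\<^sup>2) \<le> S"
proof -
  \<comment> \<open>The second entry serves the degrees l >= 1 through
    \<open>power_coeff_le_powr\<close>, the entry 1 serves l = 0.\<close>
  define D where "D = max 1 ((4 * s) powr s)"
  have D: "D \<ge> 1" by (simp add: D_def)
  have main: "c / (8 * pi * D) * real M powr (1 - s) * (\<Sum>x\<in>X. (A x)\<^sup>2) \<le> S"
    if M: "1 \<le> M" and X: "finite X" "X \<subseteq> S2" "diag_dominant M X"
      and z: "\<And>l. int l \<le> mt \<Longrightarrow> zonal_energy X A l = 0" and sums: "(\<lambda>l. \<psi> l * zonal_energy X A l) sums S"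
    for M X A S
  proof -
    have coeff: "c / D * real M powr (1 - s) * power_coeff M l \<le> \<psi> l" if l: "int l > mt" for l
    proof (cases "l = 0")
      case True
      have "real M powr (1 - s) \<le> real M powr 0" using s M by (intro powr_mono) auto
      then have "real M powr (1 - s) \<le> 1" using M by simp
      moreover have "power_coeff M 0 \<le> 1" by (simp add: power_coeff_0)
      ultimately have "real M powr (1 - s) * power_coeff M 0 \<le> 1 * 1"
        by (intro mult_mono) (auto simp: power_coeff_nonneg)
      then have "c / D * (real M powr (1 - s) * power_coeff M 0) \<le> c / D * 1"
        using c D by (intro mult_left_mono) auto
      also have "\<dots> \<le> c" using c D by (simp add: field_simps)
      finally show ?thesis using psi[OF l] True by (simp add: mult.assoc)
    next
      case False
      have "power_coeff M l \<le> (4 * s) powr s * real M powr (s - 1) * real l powr (- 2 * s)"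
        using s False M by (intro power_coeff_le_powr) auto
      also have "\<dots> \<le> D * real M powr (s - 1) * real l powr (- 2 * s)"
        by (intro mult_right_mono) (auto simp: D_def)
      finally have "c / D * real M powr (1 - s) * power_coeff M l \<le> c / D * real M powr (1 - s) * (D * real M powr (s - 1) * real l powr (- 2 * s))"
        using c D by (intro mult_left_mono) auto
      also have "\<dots> = c * (real M powr (1 - s) * real M powr (s - 1)) * real l powr (- 2 * s)"
        using D by simp
      also have "real M powr (1 - s) * real M powr (s - 1) = 1"
        using M by (simp flip: powr_add)
      finally show ?thesis using psi[OF l] False by simp
    qed
    have "(\<Sum>x\<in>X. (A x)\<^sup>2) / 2 \<le> 4 * pi * (\<Sum>l\<le>M. power_coeff M l * zonal_energy X A l)"
      using diag_dominant_form_ge[OF X, of A] unfolding power_kernel_form[OF X(2)] .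
    \<comment> \<open>The 4 pi comes from \<open>power_kernel_form\<close> and the 2 from diagonal
      dominance; with D they make up the 8 pi D in the constant.\<close>
    then have "(c / D * real M powr (1 - s) / (4 * pi)) * ((\<Sum>x\<in>X. (A x)\<^sup>2) / 2) \<le>
        (c / D * real M powr (1 - s) / (4 * pi)) * (4 * pi * (\<Sum>l\<le>M. power_coeff M l * zonal_energy X A l))"
      using c D by (intro mult_left_mono) auto
    also have "\<dots> = (\<Sum>l\<le>M. c / D * real M powr (1 - s) * power_coeff M l * zonal_energy X A l)"
      by (simp add: sum_distrib_left mult_ac)
    also have "\<dots> \<le> (\<Sum>l\<le>M. \<psi> l * zonal_energy X A l)"
    proof (rule sum_mono)
      fix l
      show "c / D * real M powr (1 - s) * power_coeff M l * zonal_energy X A l \<le> \<psi> l * zonal_energy X A l"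
        using mult_right_mono[OF coeff zonal_energy_nonneg, of l X A] z[of l] by (cases "int l \<le> mt") auto
    qed
    also have "\<dots> \<le> S"
      unfolding sums_unique[OF sums]
    proof (rule sum_le_suminf)
      show "0 \<le> \<psi> l * zonal_energy X A l" for l
      proof (cases "int l \<le> mt")
        case False
        then have "\<psi> l \<ge> 0" using psi[of l] c by (auto split: if_splits intro: order_trans[rotated])
        then show ?thesis by (simp add: zonal_energy_nonneg)
      qed (simp add: z)
    qed (use sums in \<open>auto simp: sums_iff\<close>)
    finally show ?thesis by (simp add: mult_ac)
  qed
  show ?thesis
    using c D by (intro exI[of _ "c / (8 * pi * D)"] conjI allI impI main) auto
qed

section \<open>The Laplace-Beltrami operator\<close>

text \<open>Value, first and second derivative at 0. The first derivative is required on an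
  interval, so that it can be differentiated again; for unit vectors x and b the radius 1/2 keeps x
  + t b away from 0. The general range admits complex values, needed for the powers of x1 + i
  x2.\<close>

definition jet2 :: "(real \<Rightarrow> 'a :: real_normed_vector) \<Rightarrow> 'a \<Rightarrow> 'a \<Rightarrow> 'a \<Rightarrow> bool"
  where "jet2 g v d e \<longleftrightarrow> (\<exists>g'. g 0 = v \<and> g' 0 = d \<and>
    (\<forall>t. \<bar>t\<bar> < 1 / 2 \<longrightarrow> (g has_vector_derivative g' t) (at t)) \<and> (g' has_vector_derivative e) (at 0))"

lemma jet2_cong:
  assumes "jet2 f v d e" "\<And>t. \<bar>t\<bar> < 1 / 2 \<Longrightarrow> f t = g t"
  shows "jet2 g v d e"
proof -
  obtain f' where f: "f 0 = v" "f' 0 = d" "\<And>t. \<bar>t\<bar> < 1 / 2 \<Longrightarrow> (f has_vector_derivative f' t) (at t)" "(f' has_vector_derivative e) (at 0)"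
    using assms(1) unfolding jet2_def by blast
  have "(g has_vector_derivative f' t) (at t)" if t: "\<bar>t\<bar> < 1 / 2" for t
    by (rule has_vector_derivative_transform_within_open[OF f(3)[OF t], of "{-1/2<..<1/2}"])
      (use t assms(2) in auto)
  then show ?thesis unfolding jet2_def using f assms(2)[of 0] by (intro exI[of _ f']) auto
qed

lemma jet2_const: "jet2 (\<lambda>_. c) c 0 0"
  unfolding jet2_def by (intro exI[of _ "\<lambda>_. 0"]) auto

lemma jet2_add:
  assumes "jet2 f v d e" "jet2 g v' d' e'"
  shows "jet2 (\<lambda>t. f t + g t) (v + v') (d + d') (e + e')"
proof -
  obtain f' g' where "f 0 = v" "f' 0 = d" "\<And>t. \<bar>t\<bar> < 1 / 2 \<Longrightarrow> (f has_vector_derivative f' t) (at t)" "(f' has_vector_derivative e) (at 0)"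
    "g 0 = v'" "g' 0 = d'" "\<And>t. \<bar>t\<bar> < 1 / 2 \<Longrightarrow> (g has_vector_derivative g' t) (at t)" "(g' has_vector_derivative e') (at 0)"
    using assms unfolding jet2_def by blast
  then show ?thesis unfolding jet2_def
    by (intro exI[of _ "\<lambda>t. f' t + g' t"]) (auto intro: has_vector_derivative_add)
qed

lemma jet2_linear:
  assumes "jet2 f v d e" "bounded_linear h"
  shows "jet2 (\<lambda>t. h (f t)) (h v) (h d) (h e)"
proof -
  obtain f' where "f 0 = v" "f' 0 = d" "\<And>t. \<bar>t\<bar> < 1 / 2 \<Longrightarrow> (f has_vector_derivative f' t) (at t)" "(f' has_vector_derivative e) (at 0)"
    using assms unfolding jet2_def by blast
  then show ?thesis unfolding jet2_def
    by (intro exI[of _ "\<lambda>t. h (f' t)"]) (auto intro: bounded_linear.has_vector_derivative[OF assms(2)])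
qed

lemma jet2_mult:
  fixes f g :: "real \<Rightarrow> 'a :: real_normed_field"
  assumes "jet2 f v d e" "jet2 g v' d' e'"
  shows "jet2 (\<lambda>t. f t * g t) (v * v') (d * v' + v * d') (e * v' + 2 * d * d' + v * e')"
proof -
  obtain f' g' where fg: "f 0 = v" "f' 0 = d" "\<And>t. \<bar>t\<bar> < 1 / 2 \<Longrightarrow> (f has_vector_derivative f' t) (at t)" "(f' has_vector_derivative e) (at 0)"
    "g 0 = v'" "g' 0 = d'" "\<And>t. \<bar>t\<bar> < 1 / 2 \<Longrightarrow> (g has_vector_derivative g' t) (at t)" "(g' has_vector_derivative e') (at 0)"
    using assms unfolding jet2_def by blast
  have 1: "((\<lambda>t. f t * g t) has_vector_derivative f' t * g t + f t * g' t) (at t)" if "\<bar>t\<bar> < 1 / 2" for t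
    using has_vector_derivative_mult[OF fg(3)[OF that] fg(7)[OF that]] by (simp add: add.commute)
  have "((\<lambda>t. f' t * g t + f t * g' t) has_vector_derivative (f' 0 * g' 0 + e * g 0) + (f 0 * e' + f' 0 * g' 0)) (at 0)"
    by (intro has_vector_derivative_add has_vector_derivative_mult fg) auto
  then have 2: "((\<lambda>t. f' t * g t + f t * g' t) has_vector_derivative (e * v' + 2 * d * d' + v * e')) (at 0)"
    by (simp add: fg algebra_simps)
  show ?thesis unfolding jet2_def
    by (intro exI[of _ "\<lambda>t. f' t * g t + f t * g' t"] conjI) (use 1 2 fg in auto)
qed

lemma jet2_power:
  fixes f :: "real \<Rightarrow> 'a :: real_normed_field"
  assumes "jet2 f v d e"
  shows "jet2 (\<lambda>t. f t ^ k) (v ^ k) (of_nat k * v ^ (k - 1) * d)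
    (of_nat k * v ^ (k - 1) * e + of_nat k * of_nat (k - 1) * v ^ (k - 2) * d\<^sup>2)"
proof (induction k)
  case 0
  then show ?case using jet2_const[of 1] by simp
next
  case (Suc k)
  consider "k = 0" | "k = 1" | j where "k = Suc (Suc j)" by (metis One_nat_def not0_implies_Suc)
  then show ?case
    using jet2_mult[OF assms Suc] by cases (simp_all add: algebra_simps power2_eq_square)
qed

lemma jet2_poly:
  assumes "jet2 f v d e"
  shows "jet2 (\<lambda>t. poly q (f t)) (poly q v) (poly (pderiv q) v * d)
    (poly (pderiv (pderiv q)) v * d\<^sup>2 + poly (pderiv q) v * (e :: real))"
proof (induction q)
  case 0
  then show ?case using jet2_const[of 0] by simp
next
  case (pCons a q)
  show ?case
    using jet2_add[OF jet2_const[of a] jet2_mult[OF assms pCons.IH]]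
    by (simp add: pderiv_pCons pderiv_add algebra_simps power2_eq_square)
qed

lemma jet2_imp_deriv:
  assumes "jet2 g v d (e :: real)"
  shows "(deriv ^^ 2) g 0 = e"
proof -
  obtain g' where g: "\<And>t. \<bar>t\<bar> < 1 / 2 \<Longrightarrow> (g has_real_derivative g' t) (at t)" "(g' has_real_derivative e) (at 0)"
    using assms unfolding jet2_def has_real_derivative_iff_has_vector_derivative by blast
  have "(deriv g has_real_derivative e) (at 0)"
    by (rule has_field_derivative_transform_within_open[OF g(2), of "{-1/2<..<1/2}"])
      (auto intro!: DERIV_imp_deriv[symmetric] g(1))
  then show ?thesis by (simp add: numeral_2_eq_2 DERIV_imp_deriv)
qed

section \<open>Curves obtained by radial projection of lines\<close>

abbreviation sph_curve :: "real ^ 3 \<Rightarrow> real ^ 3 \<Rightarrow> real \<Rightarrow> real ^ 3"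
  where "sph_curve x b t \<equiv> (x + t *\<^sub>R b) /\<^sub>R norm (x + t *\<^sub>R b)"

text \<open>First and second derivative at 0 of the inner product with y along the curve.\<close>

abbreviation curve_d1 :: "real ^ 3 \<Rightarrow> real ^ 3 \<Rightarrow> real ^ 3 \<Rightarrow> real"
  where "curve_d1 x b y \<equiv> inner b y - inner x b * inner x y"

abbreviation curve_d2 :: "real ^ 3 \<Rightarrow> real ^ 3 \<Rightarrow> real ^ 3 \<Rightarrow> real"
  where "curve_d2 x b y \<equiv> - 2 * inner x b * inner b y + 3 * (inner x b)\<^sup>2 * inner x y - inner x y"

text \<open>These are the curves in the definition of \<open>laplace_beltrami\<close>. There b is a
  coordinate vector, in general not tangent at x, which causes the terms in
  \<open>inner x b\<close>.\<close>

locale great_circle_step =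
  fixes x b :: "real ^ 3"
  assumes x: "norm x = 1" and b: "norm b = 1"
begin

text \<open>The inner product of x + t b with b. Thus p n is the derivative of the norm, and - p n^3
  that of its inverse n.\<close>

definition p :: "real \<Rightarrow> real" where "p t = inner x b + t"
definition n :: "real \<Rightarrow> real" where "n t = inverse (norm (x + t *\<^sub>R b))"

lemma norm_ge: "\<bar>t\<bar> < 1 / 2 \<Longrightarrow> norm (x + t *\<^sub>R b) \<ge> 1 / 2"
  using norm_triangle_ineq2[of x "- t *\<^sub>R b"] x b by simp

lemma n_bounds: "\<bar>t\<bar> < 1 / 2 \<Longrightarrow> 0 < n t \<and> n t \<le> 2"
  using norm_ge[of t] by (auto simp: n_def inverse_eq_divide divide_simps)

lemma p_bounds: "\<bar>t\<bar> < 1 / 2 \<Longrightarrow> \<bar>p t\<bar> \<le> 3 / 2"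
  using Cauchy_Schwarz_ineq2[of x b] abs_triangle_ineq[of "inner x b" t] x b by (simp add: p_def)

lemma curve_in_S2: "\<bar>t\<bar> < 1 / 2 \<Longrightarrow> sph_curve x b t \<in> S2"
  using norm_ge[of t] by (cases "norm (x + t *\<^sub>R b) = 0") (auto simp del: norm_eq_zero)

lemma n_deriv:
  assumes "\<bar>t\<bar> < 1 / 2"
  shows "(n has_real_derivative - p t * n t ^ 3) (at t)"
proof -
  define r where "r t = 1 + 2 * t * inner x b + t\<^sup>2" for t
  have r: "(norm (x + t *\<^sub>R b))\<^sup>2 = r t" for t
    using x b unfolding power2_norm_eq_inner
    by (simp add: inner_add inner_commute r_def norm_eq_1 power2_eq_square algebra_simps)
  then have nr: "n = (\<lambda>t. inverse (sqrt (r t)))"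
    by (auto simp: n_def simp flip: r)
  have pos: "r t > 0" using norm_ge[OF assms] unfolding r[symmetric] by (intro zero_less_power) linarith
  have "(n has_real_derivative - (inverse (sqrt (r t)) * ((2 * inner x b + 2 * t) * (inverse (sqrt (r t)) / 2)) * inverse (sqrt (r t)))) (at t)"
    unfolding nr r_def using pos unfolding r_def
    by (auto intro!: derivative_eq_intros)
  then show ?thesis by (simp add: nr p_def power3_eq_cube algebra_simps)
qed

definition z :: "real ^ 3 \<Rightarrow> real \<Rightarrow> real" where "z y t = inner (sph_curve x b t) y"
definition z' :: "real ^ 3 \<Rightarrow> real \<Rightarrow> real" where "z' y t = inner b y * n t - z y t * p t * (n t)\<^sup>2"
definition z'' :: "real ^ 3 \<Rightarrow> real \<Rightarrow> real"
  where "z'' y t = - inner b y * p t * n t ^ 3 - z' y t * p t * (n t)\<^sup>2 - z y t * (n t)\<^sup>2 + 2 * z y t * (p t)\<^sup>2 * n t ^ 4"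

lemma z_eq: "z y t = (inner x y + t * inner b y) * n t"
  by (simp add: z_def n_def inner_add algebra_simps)

lemma z_deriv:
  assumes "\<bar>t\<bar> < 1 / 2"
  shows "(z y has_real_derivative z' y t) (at t)"
proof -
  have "((\<lambda>t. (inner x y + t * inner b y) * n t) has_real_derivative
      inner b y * n t + (inner x y + t * inner b y) * (- p t * n t ^ 3)) (at t)"
    by (auto intro!: derivative_eq_intros n_deriv[OF assms])
  moreover have "z y = (\<lambda>t. (inner x y + t * inner b y) * n t)" by (auto simp: z_eq)
  ultimately show ?thesis by (simp add: z'_def z_eq power2_eq_square power3_eq_cube algebra_simps)
qed

lemma z'_deriv:
  assumes "\<bar>t\<bar> < 1 / 2"
  shows "(z' y has_real_derivative z'' y t) (at t)"
proof -
  have "(p has_real_derivative 1) (at t)" unfolding p_def by (auto intro!: derivative_eq_intros)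
  note d = this z_deriv[OF assms, of y] n_deriv[OF assms]
  have "((\<lambda>t. inner b y * n t - z y t * p t * (n t)\<^sup>2) has_real_derivative
      inner b y * (- p t * n t ^ 3) - ((z' y t * p t + z y t) * (n t)\<^sup>2 + (z y t * p t) * (2 * n t * (- p t * n t ^ 3)))) (at t)"
    by (auto intro!: derivative_eq_intros d)
  then show ?thesis unfolding z'_def[abs_def] z''_def
    by (rule DERIV_cong) (simp add: z'_def power2_eq_square power3_eq_cube power4_eq_xxxx algebra_simps)
qed

lemma z_abs_le: "\<bar>t\<bar> < 1 / 2 \<Longrightarrow> y \<in> S2 \<Longrightarrow> \<bar>z y t\<bar> \<le> 1"
  using Cauchy_Schwarz_ineq2[of "sph_curve x b t" y] curve_in_S2[of t] unfolding z_def by simp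

text \<open>z is the cosine of the angle between the curve point u and y. The velocity u' is
  orthogonal to u, so z' is its inner product with y - z u, whose squared norm is 1 - z^2. The speed
  is at most 2 + 6 = 8.\<close>

lemma z'_sq_le:
  assumes t: "\<bar>t\<bar> < 1 / 2" and y: "y \<in> S2"
  shows "(z' y t)\<^sup>2 \<le> 64 * (1 - (z y t)\<^sup>2)"
proof -
  define u where "u = sph_curve x b t"
  define u' where "u' = n t *\<^sub>R b - (p t * (n t)\<^sup>2) *\<^sub>R u"
  have u: "norm u = 1" "inner u u = 1" using curve_in_S2[OF t] unfolding u_def[symmetric] by (simp_all add: norm_eq_1)
  have y1: "inner y y = 1" using y by (simp add: norm_eq_1)
  have ub: "inner u b = p t * n t"
    using b by (simp add: u_def n_def p_def inner_add norm_eq_1)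
  have "inner u' (y - z y t *\<^sub>R u) = z' y t - z y t * inner u' u"
    by (simp add: u'_def z'_def inner_diff z_def[of y t, folded u_def] algebra_simps)
  also have "inner u' u = 0"
    using ub u by (simp add: u'_def inner_diff inner_commute power2_eq_square)
  finally have "z' y t = inner u' (y - z y t *\<^sub>R u)" by simp
  then have "(z' y t)\<^sup>2 \<le> (norm u' * norm (y - z y t *\<^sub>R u))\<^sup>2"
    using Cauchy_Schwarz_ineq2[of u' "y - z y t *\<^sub>R u"] by (simp only: abs_le_square_iff[symmetric]; simp)
  also have "\<dots> = (norm u')\<^sup>2 * (norm (y - z y t *\<^sub>R u))\<^sup>2" by (simp add: power_mult_distrib)
  also have "(norm (y - z y t *\<^sub>R u))\<^sup>2 = 1 - (z y t)\<^sup>2"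
    unfolding power2_norm_eq_inner using u y1
    by (simp add: inner_diff z_def[of y t, folded u_def] inner_commute power2_eq_square)
  also have "(norm u')\<^sup>2 * (1 - (z y t)\<^sup>2) \<le> 8\<^sup>2 * (1 - (z y t)\<^sup>2)"
  proof (intro mult_right_mono power_mono)
    have "norm u' \<le> n t * 1 + \<bar>p t\<bar> * (n t)\<^sup>2 * 1"
      unfolding u'_def using n_bounds[OF t] u b by (intro order_trans[OF norm_triangle_ineq4]) (simp add: abs_mult)
    also have "\<dots> \<le> 2 * 1 + 3 / 2 * 2\<^sup>2 * 1"
      using n_bounds[OF t] p_bounds[OF t] by (intro add_mono mult_mono power_mono) auto
    finally show "norm u' \<le> 8" by simp
    show "0 \<le> 1 - (z y t)\<^sup>2" using z_abs_le[OF t y] by (simp add: abs_square_le_1)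
  qed simp
  finally show ?thesis by simp
qed

lemma z''_abs_le:
  assumes t: "\<bar>t\<bar> < 1 / 2" and y: "y \<in> S2"
  shows "\<bar>z'' y t\<bar> \<le> 136"
proof -
  note nb = n_bounds[OF t] and pb = p_bounds[OF t] and zb = z_abs_le[OF t y]
  have "(z' y t)\<^sup>2 \<le> 64 * 1"
    using z'_sq_le[OF t y] by (rule order_trans) simp
  then have z'b: "\<bar>z' y t\<bar> \<le> 8" using abs_le_square_iff[of "z' y t" 8] by simp
  \<comment> \<open>The three bounds and this one make the four terms of \<open>z''\<close> at most
    12, 48, 4 and 72.\<close>
  have e: "\<bar>inner b y\<bar> \<le> 1" using Cauchy_Schwarz_ineq2[of b y] b y by simp
  have "\<bar>inner b y * p t * n t ^ 3\<bar> \<le> 1 * (3 / 2) * 2 ^ 3"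
    unfolding abs_mult power_abs using nb pb e by (intro mult_mono power_mono) auto
  moreover have "\<bar>z' y t * p t * (n t)\<^sup>2\<bar> \<le> 8 * (3 / 2) * 2\<^sup>2"
    unfolding abs_mult power_abs using nb pb z'b by (intro mult_mono power_mono) auto
  moreover have "\<bar>z y t * (n t)\<^sup>2\<bar> \<le> 1 * 2\<^sup>2"
    unfolding abs_mult power_abs using nb zb by (intro mult_mono power_mono) auto
  moreover have "\<bar>2 * z y t * (p t)\<^sup>2 * n t ^ 4\<bar> \<le> 2 * 1 * (3 / 2)\<^sup>2 * 2 ^ 4"
    unfolding abs_mult power_abs using nb pb zb by (intro mult_mono power_mono) auto
  ultimately show ?thesis unfolding z''_def by (simp add: power2_eq_square)
qed

lemma at_0: "p 0 = inner x b" "n 0 = 1" "z y 0 = inner x y" "z' y 0 = curve_d1 x b y"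
    "z'' y 0 = curve_d2 x b y"
  using x by (simp_all add: p_def n_def z_def z'_def z''_def power2_eq_square algebra_simps)

lemma z_jet: "jet2 (z y) (inner x y) (curve_d1 x b y) (curve_d2 x b y)"
  unfolding jet2_def
  by (intro exI[of _ "z' y"]) (use z_deriv z'_deriv[of 0 y] at_0 in \<open>auto simp: has_real_derivative_iff_has_vector_derivative\<close>)

text \<open>Termwise differentiation, justified by uniform majorants of the first and second
  derivatives that are multiples of |a l| l(l+1). In the second derivative the critical term
  \<open>legendre''\<close> comes with the square of z', that is, with the weight 1 - z^2.\<close>

lemma zonal_series_jet:
  assumes a: "summable (\<lambda>l. \<bar>a l\<bar> * eigval l)" and a0: "summable (\<lambda>l. \<bar>a l\<bar>)" and y: "y \<in> S2"
  shows "\<exists>v d. jet2 (\<lambda>t. \<Sum>l. a l * legendre l (z y t)) v d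
      (\<Sum>l. a l * (legendre'' l (inner x y) * (curve_d1 x b y)\<^sup>2
        + legendre' l (inner x y) * curve_d2 x b y))
    \<and> summable (\<lambda>l. a l * (legendre'' l (inner x y) * (curve_d1 x b y)\<^sup>2
        + legendre' l (inner x y) * curve_d2 x b y))"
proof -
  let ?S = "{- 1 / 2 <..< 1 / 2 :: real}"
  define f where "f l t = a l * legendre l (z y t)" for l t
  define f' where "f' l t = a l * (legendre' l (z y t) * z' y t)" for l t
  define f'' where "f'' l t = a l * (legendre'' l (z y t) * (z' y t)\<^sup>2 + legendre' l (z y t) * z'' y t)" for l t
  have S: "\<bar>t\<bar> < 1 / 2" if "t \<in> ?S" for t using that by auto
  have d1: "(f l has_real_derivative f' l t) (at t)" if "t \<in> ?S" for l t
    unfolding f_def[abs_def] f'_def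
    by (intro DERIV_cmult DERIV_chain2[OF poly_DERIV] z_deriv S that)
  have d2: "(f' l has_real_derivative f'' l t) (at t)" if "t \<in> ?S" for l t
  proof -
    have "((\<lambda>t. legendre' l (z y t) * z' y t) has_real_derivative
      (legendre'' l (z y t) * z' y t) * z' y t + z'' y t * legendre' l (z y t)) (at t)"
      by (intro DERIV_mult DERIV_chain2[OF poly_DERIV] z_deriv z'_deriv S that)
    then show ?thesis unfolding f'_def[abs_def] f''_def
      by (intro DERIV_cmult) (simp add: power2_eq_square mult_ac)
  qed
  have z1: "\<bar>z y t\<bar> \<le> 1" if "t \<in> ?S" for t using z_abs_le[OF S[OF that] y] .
  have pd: "\<bar>legendre' l (z y t)\<bar> \<le> eigval l / 2" if "t \<in> ?S" for l t
    using abs_legendre_deriv_le[OF z1[OF that]] .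
  have b1: "norm (f' l t) \<le> \<bar>a l\<bar> * eigval l * 4" if "t \<in> ?S" for l t
  proof -
    have "(z' y t)\<^sup>2 \<le> 64 * 1" using z'_sq_le[OF S[OF that] y] by (rule order_trans) simp
    then have "\<bar>z' y t\<bar> \<le> 8" using abs_le_square_iff[of "z' y t" 8] by simp
    then have "\<bar>legendre' l (z y t)\<bar> * \<bar>z' y t\<bar> \<le> (eigval l / 2) * 8"
      by (intro mult_mono pd that) auto
    then show ?thesis unfolding f'_def using mult_left_mono[of _ _ "\<bar>a l\<bar>"] by (force simp: abs_mult)
  qed
  have b2: "norm (f'' l t) \<le> \<bar>a l\<bar> * eigval l * 196" if "t \<in> ?S" for l t
  proof -
    have "\<bar>legendre'' l (z y t)\<bar> * (z' y t)\<^sup>2 \<le> \<bar>legendre'' l (z y t)\<bar> * (64 * (1 - (z y t)\<^sup>2))"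
      by (intro mult_left_mono z'_sq_le S that y) auto
    also have "\<dots> = 64 * ((1 - (z y t)\<^sup>2) * \<bar>legendre'' l (z y t)\<bar>)" by simp
    also have "\<dots> \<le> 64 * (2 * eigval l)"
      by (intro mult_left_mono abs_legendre_deriv_2_le z1 that) auto
    finally have 1: "\<bar>legendre'' l (z y t) * (z' y t)\<^sup>2\<bar> \<le> 128 * eigval l"
      by (simp add: abs_mult)
    have 2: "\<bar>legendre' l (z y t) * z'' y t\<bar> \<le> (eigval l / 2) * 136"
      unfolding abs_mult by (intro mult_mono pd that z''_abs_le S y) auto
    \<comment> \<open>196 = 64 * 2 + 136 / 2.\<close>
    have "\<bar>legendre'' l (z y t) * (z' y t)\<^sup>2 + legendre' l (z y t) * z'' y t\<bar> \<le> eigval l * 196"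
      using 1 2 by linarith
    then show ?thesis unfolding f''_def using mult_left_mono[of _ _ "\<bar>a l\<bar>"] by (force simp: abs_mult)
  qed
  have u1: "uniformly_convergent_on ?S (\<lambda>n t. \<Sum>l<n. f' l t)"
    by (rule Weierstrass_m_test') (use b1 summable_mult2[OF a, of 4] in auto)
  have u2: "uniformly_convergent_on ?S (\<lambda>n t. \<Sum>l<n. f'' l t)"
    by (rule Weierstrass_m_test') (use b2 summable_mult2[OF a, of 196] in auto)
  have s1: "summable (\<lambda>l. f l 0)"
  proof (rule summable_comparison_test'[OF a0])
    show "norm (f l 0) \<le> \<bar>a l\<bar>" for l
      using abs_legendre_poly_le_1[OF z1[of 0], of l] mult_left_mono[of "\<bar>legendre l (z y 0)\<bar>" 1 "\<bar>a l\<bar>"]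
      by (simp add: f_def abs_mult)
  qed
  have s2: "summable (\<lambda>l. f' l 0)"
    by (rule summable_comparison_test'[OF summable_mult2[OF a, of 4]]) (use b1[of 0] in auto)
  have s3: "summable (\<lambda>l. f'' l 0)"
    by (rule summable_comparison_test'[OF summable_mult2[OF a, of 196]]) (use b2[of 0] in auto)
  have i: "t \<in> interior ?S" if "\<bar>t\<bar> < 1 / 2" for t using that by (auto simp: interior_open)
  have D1: "((\<lambda>t. \<Sum>l. f l t) has_real_derivative (\<Sum>l. f' l t)) (at t)" if "\<bar>t\<bar> < 1 / 2" for t
    by (rule has_field_derivative_series'(2)[OF _ has_field_derivative_at_within[OF d1] u1 _ s1 i[OF that]]) auto
  have D2: "((\<lambda>t. \<Sum>l. f' l t) has_real_derivative (\<Sum>l. f'' l 0)) (at 0)"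
    by (rule has_field_derivative_series'(2)[OF _ has_field_derivative_at_within[OF d2] u2 _ s2 i]) auto
  have "jet2 (\<lambda>t. \<Sum>l. f l t) (\<Sum>l. f l 0) (\<Sum>l. f' l 0) (\<Sum>l. f'' l 0)"
    unfolding jet2_def using D1 D2
    by (intro exI[of _ "\<lambda>t. \<Sum>l. f' l t"]) (auto simp: has_real_derivative_iff_has_vector_derivative)
  with s3 show ?thesis unfolding f_def[abs_def] f''_def at_0 by blast
qed

end

section \<open>The Laplace-Beltrami operator on zonal series and spherical harmonics\<close>

definition has_jet2 :: "(real \<Rightarrow> real) \<Rightarrow> real \<Rightarrow> bool"
  where "has_jet2 g e \<longleftrightarrow> (\<exists>v d. jet2 g v d e)"

lemma has_jet2_add: "has_jet2 f d \<Longrightarrow> has_jet2 g e \<Longrightarrow> has_jet2 (\<lambda>t. f t + g t) (d + e)"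
  unfolding has_jet2_def by (blast intro: jet2_add)

lemma has_jet2_cmult: "has_jet2 f e \<Longrightarrow> has_jet2 (\<lambda>t. c * f t) (c * e)"
  unfolding has_jet2_def by (blast intro: jet2_linear[OF _ bounded_linear_mult_right])

text \<open>A relation that carries the existence of the second derivatives along:
  \<open>deriv\<close> is total and is additive only where the derivatives exist.\<close>

definition has_laplace_beltrami :: "(real ^ 3 \<Rightarrow> real) \<Rightarrow> real ^ 3 \<Rightarrow> real \<Rightarrow> bool"
  where "has_laplace_beltrami f x L \<longleftrightarrow>
    (\<exists>J. (\<forall>b\<in>Basis. has_jet2 (\<lambda>t. f (sph_curve x b t)) (J b)) \<and> L = (\<Sum>b\<in>Basis. J b))"

lemma has_laplace_beltramiI:
  "(\<And>b. b \<in> Basis \<Longrightarrow> has_jet2 (\<lambda>t. f (sph_curve x b t)) (J b)) \<Longrightarrow> has_laplace_beltrami f x (\<Sum>b\<in>Basis. J b)"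
  unfolding has_laplace_beltrami_def by blast

lemma has_laplace_beltramiE:
  assumes "has_laplace_beltrami f x L"
  obtains J where "\<And>b. b \<in> Basis \<Longrightarrow> has_jet2 (\<lambda>t. f (sph_curve x b t)) (J b)" "L = (\<Sum>b\<in>Basis. J b)"
  using assms unfolding has_laplace_beltrami_def by blast

lemma has_laplace_beltrami_imp_eq: "has_laplace_beltrami f x L \<Longrightarrow> laplace_beltrami f x = L"
  by (erule has_laplace_beltramiE)
    (auto simp: laplace_beltrami_def laplacian_def has_jet2_def dest!: jet2_imp_deriv intro!: sum.cong)

lemma has_laplace_beltrami_add:
  assumes "has_laplace_beltrami f x L" "has_laplace_beltrami g x K"
  shows "has_laplace_beltrami (\<lambda>u. f u + g u) x (L + K)"
proof -
  obtain I J where "\<And>b. b \<in> Basis \<Longrightarrow> has_jet2 (\<lambda>t. f (sph_curve x b t)) (I b)" and L: "L = (\<Sum>b\<in>Basis. I b)"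
    and "\<And>b. b \<in> Basis \<Longrightarrow> has_jet2 (\<lambda>t. g (sph_curve x b t)) (J b)" and K: "K = (\<Sum>b\<in>Basis. J b)"
    using assms by (elim has_laplace_beltramiE) blast
  then have "has_jet2 (\<lambda>t. f (sph_curve x b t) + g (sph_curve x b t)) (I b + J b)" if "b \<in> Basis" for b
    using that by (intro has_jet2_add) auto
  from has_laplace_beltramiI[of "\<lambda>u. f u + g u", OF this] show ?thesis
    by (simp add: L K sum.distrib)
qed

lemma has_laplace_beltrami_cmult:
  assumes "has_laplace_beltrami f x L"
  shows "has_laplace_beltrami (\<lambda>u. c * f u) x (c * L)"
proof -
  obtain I where "\<And>b. b \<in> Basis \<Longrightarrow> has_jet2 (\<lambda>t. f (sph_curve x b t)) (I b)" and L: "L = (\<Sum>b\<in>Basis. I b)"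
    using assms by (elim has_laplace_beltramiE) blast
  then have "has_jet2 (\<lambda>t. c * f (sph_curve x b t)) (c * I b)" if "b \<in> Basis" for b
    using that by (intro has_jet2_cmult) auto
  from has_laplace_beltramiI[of "\<lambda>u. c * f u", OF this] show ?thesis
    by (simp add: L sum_distrib_left)
qed

lemma has_laplace_beltrami_0: "has_laplace_beltrami (\<lambda>u. 0) x 0"
  using has_laplace_beltramiI[of "\<lambda>u. 0" x "\<lambda>b. 0"] jet2_const[of "0 :: real"] by (auto simp: has_jet2_def)

lemma has_laplace_beltrami_sum:
  assumes "\<And>i. i \<in> I \<Longrightarrow> has_laplace_beltrami (f i) x (L i)"
  shows "has_laplace_beltrami (\<lambda>u. \<Sum>i\<in>I. f i u) x (\<Sum>i\<in>I. L i)"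
  using assms
  by (induction I rule: infinite_finite_induct) (auto simp: has_laplace_beltrami_0 intro!: has_laplace_beltrami_add)

lemma has_laplace_beltrami_cong:
  assumes "has_laplace_beltrami f x L" "\<And>u. u \<in> S2 \<Longrightarrow> f u = g u" "x \<in> S2"
  shows "has_laplace_beltrami g x L"
proof -
  obtain I where I: "\<And>b. b \<in> Basis \<Longrightarrow> has_jet2 (\<lambda>t. f (sph_curve x b t)) (I b)" and L: "L = (\<Sum>b\<in>Basis. I b)"
    using assms(1) by (elim has_laplace_beltramiE) blast
  have "has_jet2 (\<lambda>t. g (sph_curve x b t)) (I b)" if bB: "b \<in> Basis" for b
  proof -
    interpret great_circle_step x b using assms(3) bB by unfold_locales auto
    obtain v d where "jet2 (\<lambda>t. f (sph_curve x b t)) v d (I b)" using I[OF bB] unfolding has_jet2_def by blast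
    then have "jet2 (\<lambda>t. g (sph_curve x b t)) v d (I b)"
      by (rule jet2_cong) (intro assms(2) curve_in_S2)
    then show ?thesis unfolding has_jet2_def by blast
  qed
  from has_laplace_beltramiI[OF this] show ?thesis by (simp add: L)
qed

text \<open>\<open>curve_d1 x b y\<close> is the inner product of b with the tangential part y -
  (x.y) x of y, so this is Parseval's identity for two tangential parts.\<close>

lemma sum_Basis_tangent:
  fixes x y y' :: "real ^ 3"
  assumes "x \<in> S2"
  shows "(\<Sum>b\<in>Basis. curve_d1 x b y * curve_d1 x b y') = inner y y' - inner x y * inner x y'"
proof -
  have e: "curve_d1 x b y * curve_d1 x b y' =
     inner y b * inner y' b - inner x y' * (inner x b * inner y b) - inner x y * (inner x b * inner y' b) + inner x y * inner x y' * (inner x b * inner x b)" for b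
    by (simp add: inner_commute algebra_simps)
  have "inner x x = 1" using assms by (simp add: norm_eq_1)
  then show ?thesis unfolding e
    by (simp only: sum.distrib sum_subtractf sum_distrib_left[symmetric] euclidean_inner[symmetric])
      (simp add: inner_commute)
qed

text \<open>The operator applied to the linear function \<open>inner u y\<close> of u, a harmonic of
  degree 1 with eigenvalue -2.\<close>

lemma sum_Basis_second:
  fixes x y :: "real ^ 3"
  assumes "x \<in> S2"
  shows "(\<Sum>b\<in>Basis. curve_d2 x b y) = - 2 * inner x y"
proof -
  have e: "curve_d2 x b y =
     (-2) * (inner x b * inner y b) + 3 * inner x y * (inner x b * inner x b) - inner x y" for b
    by (simp add: inner_commute power2_eq_square algebra_simps)
  have "inner x x = 1" using assms by (simp add: norm_eq_1)
  then show ?thesis unfolding e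
    by (simp only: sum.distrib sum_subtractf sum_distrib_left[symmetric] euclidean_inner[symmetric])
      (simp add: inner_commute)
qed

text \<open>By the chain rule a function f of s = x.y is mapped to (1 - s^2) f'' - 2 s f', and
  Legendre's equation makes each term an eigenfunction.\<close>

lemma has_laplace_beltrami_zonal_series:
  assumes a: "summable (\<lambda>l. \<bar>a l\<bar> * eigval l)" "summable (\<lambda>l. \<bar>a l\<bar>)" and y: "y \<in> S2" and x: "x \<in> S2"
  shows "has_laplace_beltrami (\<lambda>u. \<Sum>l. a l * legendre l (inner u y)) x
      (\<Sum>l. - eigval l * a l * legendre l (inner x y))"
proof -
  define D where "D b l = a l * (legendre'' l (inner x y) * (curve_d1 x b y)\<^sup>2
        + legendre' l (inner x y) * curve_d2 x b y)" for b l
  have J: "has_jet2 (\<lambda>t. \<Sum>l. a l * legendre l (inner (sph_curve x b t) y)) (\<Sum>l. D b l)" "summable (D b)"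
    if bB: "b \<in> Basis" for b
  proof -
    interpret great_circle_step x b using x bB by unfold_locales auto
    show "has_jet2 (\<lambda>t. \<Sum>l. a l * legendre l (inner (sph_curve x b t) y)) (\<Sum>l. D b l)" "summable (D b)"
      using zonal_series_jet[OF a y] unfolding D_def[abs_def] z_def has_jet2_def by blast+
  qed
  have "(\<Sum>b\<in>Basis. D b l) = - eigval l * a l * legendre l (inner x y)" for l
  proof -
    let ?s = "inner x y"
    have t: "(\<Sum>b\<in>Basis. (curve_d1 x b y)\<^sup>2) = 1 - ?s\<^sup>2"
      using sum_Basis_tangent[OF x, of y y] y by (simp add: power2_eq_square norm_eq_1)
    have "(\<Sum>b\<in>Basis. D b l) = a l * (legendre'' l ?s * (\<Sum>b\<in>Basis. (curve_d1 x b y)\<^sup>2)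
        + legendre' l ?s * (\<Sum>b\<in>Basis. curve_d2 x b y))"
      unfolding D_def by (simp only: sum_distrib_left[symmetric] sum.distrib)
    also have "\<dots> = a l * ((1 - ?s\<^sup>2) * legendre'' l ?s - 2 * ?s * legendre' l ?s)"
      unfolding t sum_Basis_second[OF x] by (simp add: algebra_simps)
    also have "(1 - ?s\<^sup>2) * legendre'' l ?s - 2 * ?s * legendre' l ?s = - eigval l * legendre l ?s"
      using legendre_deriv_ode[where k=0 and l=l and t="?s"] by (simp add: numeral_2_eq_2 algebra_simps)
    finally show ?thesis by simp
  qed
  moreover have "(\<Sum>b\<in>Basis. \<Sum>l. D b l) = (\<Sum>l. \<Sum>b\<in>Basis. D b l)"
    by (rule suminf_sum[symmetric]) (use J(2) in auto)
  ultimately show ?thesis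
    using has_laplace_beltramiI[of "\<lambda>u. \<Sum>l. a l * legendre l (inner u y)", OF J(1)] by simp
qed

text \<open>Keeping the power of x1 + i x2 complex treats the cosine and sine harmonics together.
  After the product rule the sum over b only involves the five sums \<open>s1\<close> to
  \<open>s5\<close>.\<close>

lemma sph_harm_complex_laplacian:
  fixes q :: "real poly" and k :: nat
  assumes x: "x \<in> S2"
  defines "w \<equiv> \<lambda>u. Complex (vec_nth u 1) (vec_nth u 2)"
  shows "\<exists>J. (\<forall>b\<in>Basis. \<exists>v d. jet2 (\<lambda>t. of_real (poly q (vec_nth (sph_curve x b t) 3)) * w (sph_curve x b t) ^ k) v d (J b)) \<and>
    (\<Sum>b\<in>Basis. J b) = of_real ((1 - (vec_nth x 3)\<^sup>2) * poly (pderiv (pderiv q)) (vec_nth x 3)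
      - 2 * (real k + 1) * vec_nth x 3 * poly (pderiv q) (vec_nth x 3) - real k * (real k + 1) * poly q (vec_nth x 3)) * w x ^ k"
proof -
  define d where "d y b = curve_d1 x b y" for y b :: "real ^ 3"
  define e where "e y b = curve_d2 x b y" for y b :: "real ^ 3"
  define y1 y2 y3 :: "real ^ 3" where "y1 = axis 1 1" and "y2 = axis 2 1" and "y3 = axis 3 1"
  have comp: "inner u y1 = vec_nth u 1" "inner u y2 = vec_nth u 2" "inner u y3 = vec_nth u 3" for u :: "real ^ 3"
    by (simp_all add: y1_def y2_def y3_def inner_axis)
  have yy: "inner y1 y1 = 1" "inner y2 y2 = 1" "inner y3 y3 = 1" "inner y1 y2 = 0" "inner y3 y1 = 0" "inner y3 y2 = 0"
    by (simp_all add: comp) (simp_all add: y1_def y2_def y3_def axis_def)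
  define W W' W'' where "W = w x" and "W' b = Complex (d y1 b) (d y2 b)" and "W'' b = Complex (e y1 b) (e y2 b)" for b
  define Q0 Q1 Q2 where "Q0 = complex_of_real (poly q (vec_nth x 3))" and "Q1 = complex_of_real (poly (pderiv q) (vec_nth x 3))"
    and "Q2 = complex_of_real (poly (pderiv (pderiv q)) (vec_nth x 3))"
  define D E where "D b = complex_of_real (d y3 b)" and "E b = complex_of_real (e y3 b)" for b
  define J where "J b = (Q2 * (D b)\<^sup>2 + Q1 * E b) * W ^ k + 2 * (Q1 * D b) * (of_nat k * W ^ (k - 1) * W' b)
    + Q0 * (of_nat k * W ^ (k - 1) * W'' b + of_nat k * of_nat (k - 1) * W ^ (k - 2) * (W' b)\<^sup>2)" for b
  have jet: "\<exists>v d. jet2 (\<lambda>t. of_real (poly q (vec_nth (sph_curve x b t) 3)) * w (sph_curve x b t) ^ k) v d (J b)" if bB: "b \<in> Basis" for b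
  proof -
    interpret great_circle_step x b using x bB by unfold_locales auto
    have zj: "jet2 (z y) (inner x y) (d y b) (e y b)" for y
      unfolding d_def e_def by (rule z_jet)
    have "jet2 (\<lambda>t. poly q (z y3 t)) (poly q (vec_nth x 3)) (poly (pderiv q) (vec_nth x 3) * d y3 b)
      (poly (pderiv (pderiv q)) (vec_nth x 3) * (d y3 b)\<^sup>2 + poly (pderiv q) (vec_nth x 3) * e y3 b)"
      using jet2_poly[OF zj[of y3], of q] unfolding comp .
    from jet2_linear[OF this bounded_linear_of_real[where 'a=complex]]
    have q: "jet2 (\<lambda>t. complex_of_real (poly q (z y3 t))) Q0 (Q1 * D b) (Q2 * (D b)\<^sup>2 + Q1 * E b)"
      by (simp add: Q0_def Q1_def Q2_def D_def E_def)
    have C: "Complex r s = of_real r + \<i> * of_real s" for r s by (simp add: complex_eq_iff)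
    have "jet2 (\<lambda>t. complex_of_real (z y1 t) + \<i> * complex_of_real (z y2 t)) W (W' b) (W'' b)"
      unfolding W_def w_def W'_def W''_def C comp[symmetric]
      by (intro jet2_add jet2_linear[OF jet2_linear[OF zj bounded_linear_of_real] bounded_linear_mult_right]
          jet2_linear[OF zj bounded_linear_of_real])
    then have "jet2 (\<lambda>t. w (sph_curve x b t)) W (W' b) (W'' b)"
      unfolding C[symmetric] z_def comp w_def .
    from jet2_mult[OF q jet2_power[OF this, of k]]
    show ?thesis unfolding J_def z_def comp by blast
  qed
  have dd: "(\<Sum>b\<in>Basis. d y b * d y' b) = inner y y' - inner x y * inner x y'" for y y'
    unfolding d_def by (rule sum_Basis_tangent[OF x])
  have ee: "(\<Sum>b\<in>Basis. e y b) = - 2 * inner x y" for y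
    unfolding e_def by (rule sum_Basis_second[OF x])
  define X3 where "X3 = complex_of_real (vec_nth x 3)"
  have s1: "(\<Sum>b\<in>Basis. (D b)\<^sup>2) = 1 - X3\<^sup>2"
    using arg_cong[OF dd[of y3 y3], of complex_of_real] unfolding yy comp[of x] by (simp add: D_def X3_def power2_eq_square)
  have s2: "(\<Sum>b\<in>Basis. E b) = - 2 * X3"
    using arg_cong[OF ee[of y3], of complex_of_real] by (simp add: E_def X3_def comp)
  have s3: "(\<Sum>b\<in>Basis. D b * W' b) = - X3 * W"
    using dd[of y3 y1] dd[of y3 y2] unfolding yy comp[of x] by (simp add: complex_eq_iff D_def W'_def W_def w_def X3_def Re_sum Im_sum)
  have s4: "(\<Sum>b\<in>Basis. W'' b) = - 2 * W"
    using ee[of y1] ee[of y2] by (simp add: complex_eq_iff W''_def W_def w_def comp Re_sum Im_sum)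
  \<comment> \<open>The vector e1 + i e2 has bilinear square zero, so only the correction by the
    radial part remains.\<close>
  have s5: "(\<Sum>b\<in>Basis. (W' b)\<^sup>2) = - W\<^sup>2"
  proof -
    have "(W' b)\<^sup>2 = of_real (d y1 b * d y1 b) - of_real (d y2 b * d y2 b) + 2 * \<i> * of_real (d y1 b * d y2 b)" for b
      by (simp add: W'_def complex_eq_iff power2_eq_square)
    then have "(\<Sum>b\<in>Basis. (W' b)\<^sup>2) = of_real (\<Sum>b\<in>Basis. d y1 b * d y1 b) - of_real (\<Sum>b\<in>Basis. d y2 b * d y2 b)
        + 2 * \<i> * of_real (\<Sum>b\<in>Basis. d y1 b * d y2 b)"
      by (simp only: sum.distrib sum_subtractf sum_distrib_left of_real_sum)
    also have "\<dots> = - W\<^sup>2"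
      unfolding dd yy comp[of x] by (simp add: W_def w_def complex_eq_iff power2_eq_square)
    finally show ?thesis .
  qed
  have "(\<Sum>b\<in>Basis. J b) = (Q2 * (\<Sum>b\<in>Basis. (D b)\<^sup>2) + Q1 * (\<Sum>b\<in>Basis. E b)) * W ^ k
    + 2 * Q1 * of_nat k * W ^ (k - 1) * (\<Sum>b\<in>Basis. D b * W' b)
    + Q0 * (of_nat k * W ^ (k - 1) * (\<Sum>b\<in>Basis. W'' b) + of_nat k * of_nat (k - 1) * W ^ (k - 2) * (\<Sum>b\<in>Basis. (W' b)\<^sup>2))"
    unfolding J_def by (simp add: sum_distrib_left sum_distrib_right sum.distrib algebra_simps)
  also have "\<dots> = ((1 - X3\<^sup>2) * Q2 - 2 * (of_nat k + 1) * X3 * Q1 - of_nat k * (of_nat k + 1) * Q0) * W ^ k"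
  proof -
    consider "k = 0" | "k = 1" | j where "k = Suc (Suc j)" by (metis One_nat_def not0_implies_Suc)
    then show ?thesis unfolding s1 s2 s3 s4 s5
      by cases (simp_all add: algebra_simps power2_eq_square)
  qed
  finally have "(\<Sum>b\<in>Basis. J b) = of_real ((1 - (vec_nth x 3)\<^sup>2) * poly (pderiv (pderiv q)) (vec_nth x 3)
      - 2 * (real k + 1) * vec_nth x 3 * poly (pderiv q) (vec_nth x 3) - real k * (real k + 1) * poly q (vec_nth x 3)) * w x ^ k"
    by (simp add: X3_def Q0_def Q1_def Q2_def W_def)
  then show ?thesis using jet by blast
qed

text \<open>With q the k-th derivative of the Legendre polynomial, its differential equation
  contributes - (l - k)(l + k + 1), and subtracting k(k+1) gives - l(l+1) for every order.\<close>

lemma has_laplace_beltrami_sph_harm: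
  assumes x: "x \<in> S2"
  shows "has_laplace_beltrami (sph_harm l \<mu>) x (- eigval l * sph_harm l \<mu> x)"
proof -
  define k where "k = nat \<bar>\<mu>\<bar>"
  define q where "q = (pderiv ^^ k) (legendre_poly l)"
  define w where "w u = Complex (vec_nth u 1) (vec_nth u 2)" for u :: "real ^ 3"
  define s where "s = sqrt ((2 * real l + 1) / (4 * pi) * fact (l - k) / fact (l + k))"
  define h where "h c = (if \<mu> = 0 then Re c else if \<mu> > 0 then sqrt 2 * Re c else sqrt 2 * Im c)" for c
  have lin: "bounded_linear h"
    unfolding h_def[abs_def]
    by (cases "\<mu> = 0"; cases "\<mu> > 0")
      (auto intro: bounded_linear_Re bounded_linear_compose[OF bounded_linear_mult_right bounded_linear_Re]
        bounded_linear_compose[OF bounded_linear_mult_right bounded_linear_Im])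
  have hr: "h (of_real r * c) = r * h c" for r c by (simp add: h_def)
  have Y: "sph_harm l \<mu> u = s * h (of_real (poly q (vec_nth u 3)) * w u ^ k)" for u
    unfolding hr by (simp add: sph_harm_def Let_def k_def[symmetric] q_def s_def w_def h_def) (simp add: k_def)
  have ode: "(1 - (vec_nth x 3)\<^sup>2) * poly (pderiv (pderiv q)) (vec_nth x 3)
      - 2 * (real k + 1) * vec_nth x 3 * poly (pderiv q) (vec_nth x 3) - real k * (real k + 1) * poly q (vec_nth x 3)
      = - eigval l * poly q (vec_nth x 3)"
    using legendre_deriv_ode[where k=k and l=l and t="vec_nth x 3"]
    by (simp add: q_def numeral_2_eq_2 algebra_simps)
  obtain J where J: "\<forall>b\<in>Basis. \<exists>v d. jet2 (\<lambda>t. of_real (poly q (vec_nth (sph_curve x b t) 3)) * w (sph_curve x b t) ^ k) v d (J b)"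
    "(\<Sum>b\<in>Basis. J b) = of_real (- eigval l * poly q (vec_nth x 3)) * w x ^ k"
    using sph_harm_complex_laplacian[OF x, of q k] unfolding ode w_def by blast
  have "has_laplace_beltrami (\<lambda>u. h (of_real (poly q (vec_nth u 3)) * w u ^ k)) x (\<Sum>b\<in>Basis. h (J b))"
    by (rule has_laplace_beltramiI) (use J(1) jet2_linear[OF _ lin] in \<open>unfold has_jet2_def, blast\<close>)
  moreover have "(\<Sum>b\<in>Basis. h (J b)) = h (\<Sum>b\<in>Basis. J b)"
    using linear_sum[OF bounded_linear.linear[OF lin], of J Basis] by simp
  ultimately have "has_laplace_beltrami (sph_harm l \<mu>) x (s * h (\<Sum>b\<in>Basis. J b))"
    unfolding Y[abs_def] using has_laplace_beltrami_cmult by metis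
  then show ?thesis unfolding J(2) Y hr by (simp add: mult_ac)
qed

section \<open>Interpolants and their images under the Helmholtz operator\<close>

lemma set_sph_basis: "set (sph_basis mt) = {sph_harm l \<mu> | l \<mu>. int l \<le> mt \<and> \<mu> \<in> {- int l..int l}}"
proof -
  have *: "l \<in> set [0..<nat (mt + 1)] \<longleftrightarrow> int l \<le> mt" for l by auto
  have "set (sph_basis mt) = (\<Union>l\<in>set [0..<nat (mt + 1)]. sph_harm l ` {- int l..int l})"
    unfolding sph_basis_def set_concat set_map image_image set_upto by (rule refl)
  then have "f \<in> set (sph_basis mt) \<longleftrightarrow> (\<exists>l \<mu>. f = sph_harm l \<mu> \<and> int l \<le> mt \<and> \<mu> \<in> {- int l..int l})" for f
    by (simp only: UN_iff image_iff * Bex_def) blast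
  then show ?thesis by (simp only: set_eq_iff mem_Collect_eq) blast
qed

locale sbf_setting =
  fixes \<alpha> m :: real and mt :: int and \<phi> :: "real \<Rightarrow> real" and \<phi>hat :: "nat \<Rightarrow> real"
  assumes alpha_pos: "\<alpha> > 0" and m_gt: "m > 2" and mt_ge: "mt \<ge> -1"
    and SBF: "is_SBF \<phi> \<phi>hat" and decay: "coeffs_decay \<phi>hat mt m"
begin

definition a :: "nat \<Rightarrow> real" where "a l = \<phi>hat l * ((2 * real l + 1) / (4 * pi))"

definition K :: nat where "K = length (sph_basis mt)"

definition Y :: "nat \<Rightarrow> real ^ 3 \<Rightarrow> real" where "Y k = sph_basis mt ! k"

text \<open>The flat list \<open>sph_basis mt\<close> does not record degrees. Any admissible choice
  serves, since only the eigenvalue equation and the bound by mt are used.\<close>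

definition deg :: "nat \<Rightarrow> nat" where "deg k = (SOME l. int l \<le> mt \<and> (\<exists>\<mu>. Y k = sph_harm l \<mu>))"

definition ev :: "nat \<Rightarrow> real" where "ev k = \<alpha> + real (deg k) * (real (deg k) + 1)"

abbreviation shift :: "nat \<Rightarrow> real" where "shift l \<equiv> \<alpha> + eigval l"

definition \<psi> :: "real ^ 3 \<Rightarrow> real ^ 3 \<Rightarrow> real"
  where "\<psi> x y = (\<Sum>l. shift l * a l * legendre l (inner x y))"

definition moment_free :: "(real ^ 3) set \<Rightarrow> (real ^ 3 \<Rightarrow> real) \<Rightarrow> bool"
  where "moment_free X A \<longleftrightarrow> (\<forall>k<K. (\<Sum>x\<in>X. A x * Y k x) = 0)"

definition poly_part :: "(nat \<Rightarrow> real) \<Rightarrow> real ^ 3 \<Rightarrow> real"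
  where "poly_part b x = (\<Sum>k<K. b k * Y k x)"

definition interpolant :: "(real ^ 3) set \<Rightarrow> (real ^ 3 \<Rightarrow> real) \<Rightarrow> (nat \<Rightarrow> real) \<Rightarrow> real ^ 3 \<Rightarrow> real"
  where "interpolant X A b x = (\<Sum>y\<in>X. A y * \<phi> (inner x y)) + poly_part b x"

definition helm_interpolant :: "(real ^ 3) set \<Rightarrow> (real ^ 3 \<Rightarrow> real) \<Rightarrow> (nat \<Rightarrow> real) \<Rightarrow> real ^ 3 \<Rightarrow> real"
  where "helm_interpolant X A b x = (\<Sum>y\<in>X. A y * \<psi> x y) + poly_part (\<lambda>k. ev k * b k) x"

lemma Y_deg:
  assumes "k < K"
  shows "int (deg k) \<le> mt" "\<exists>\<mu>. Y k = sph_harm (deg k) \<mu>"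
proof -
  have "Y k \<in> set (sph_basis mt)" using assms by (auto simp: Y_def K_def)
  then have "\<exists>l. int l \<le> mt \<and> (\<exists>\<mu>. Y k = sph_harm l \<mu>)" unfolding set_sph_basis by blast
  from someI_ex[OF this] show "int (deg k) \<le> mt" "\<exists>\<mu>. Y k = sph_harm (deg k) \<mu>" unfolding deg_def by blast+
qed

lemma ev_ge: "ev k \<ge> \<alpha>"
  by (simp add: ev_def)

lemma sph_polys_eq: "sph_polys mt = {poly_part b | b. True}"
  unfolding sph_polys_def poly_part_def[abs_def] K_def Y_def by simp

lemma sph_polys_moment_iff: "(\<forall>P\<in>sph_polys mt. (\<Sum>y\<in>X. A y * P y) = 0) \<longleftrightarrow> moment_free X A"
proof
  assume *: "\<forall>P\<in>sph_polys mt. (\<Sum>y\<in>X. A y * P y) = 0"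
  have "Y k \<in> sph_polys mt" if "k < K" for k
  proof -
    have "poly_part (\<lambda>j. if j = k then 1 else 0) = Y k"
    proof
      fix u
      have "poly_part (\<lambda>j. if j = k then 1 else 0) u = (\<Sum>j<K. if j = k then Y j u else 0)"
        unfolding poly_part_def by (intro sum.cong) auto
      then show "poly_part (\<lambda>j. if j = k then 1 else 0) u = Y k u" using that by simp
    qed
    then have "Y k = poly_part (\<lambda>j. if j = k then 1 else 0)" by (rule sym)
    then show ?thesis unfolding sph_polys_eq by blast
  qed
  with * show "moment_free X A" unfolding moment_free_def by blast
next
  assume *: "moment_free X A"
  have "(\<Sum>y\<in>X. A y * poly_part b y) = 0" for b
  proof -
    have "(\<Sum>y\<in>X. A y * poly_part b y) = (\<Sum>k<K. b k * (\<Sum>y\<in>X. A y * Y k y))"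
      unfolding poly_part_def sum_distrib_left by (subst sum.swap) (simp add: mult_ac)
    then show ?thesis using * by (simp add: moment_free_def)
  qed
  then show "\<forall>P\<in>sph_polys mt. (\<Sum>y\<in>X. A y * P y) = 0" unfolding sph_polys_eq by blast
qed

lemma moment_free_poly_part: "moment_free X A \<Longrightarrow> (\<Sum>y\<in>X. A y * poly_part b y) = 0"
  using sph_polys_moment_iff[where X=X and A=A] unfolding sph_polys_eq by blast

lemma moment_free_energy:
  assumes "moment_free X A" "int l \<le> mt"
  shows "zonal_energy X A l = 0"
  unfolding zonal_energy_def
proof (rule sum.neutral, rule ballI)
  fix \<mu> assume "\<mu> \<in> {- int l..int l}"
  then have "sph_harm l \<mu> \<in> set (sph_basis mt)" using assms(2) unfolding set_sph_basis by blast
  then obtain k where "k < K" "Y k = sph_harm l \<mu>" by (auto simp: in_set_conv_nth K_def Y_def)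
  then have "(\<Sum>x\<in>X. A x * sph_harm l \<mu> x) = 0"
    using assms(1) unfolding moment_free_def by metis
  then show "(\<Sum>x\<in>X. A x * sph_harm l \<mu> x)\<^sup>2 = 0" by simp
qed

lemma decay_obtain:
  obtains c1 c2 where "c1 > 0" "c2 > 0" "mt = -1 \<Longrightarrow> \<phi>hat 0 > 0"
    "\<And>l. l \<ge> 1 \<Longrightarrow> int l > mt \<Longrightarrow> c1 * real l powr (- 2 * m) \<le> \<phi>hat l \<and> \<phi>hat l \<le> c2 * real l powr (- 2 * m)"
proof -
  obtain c1 c2 where c: "c1 > 0" "c2 > 0" "\<And>l. int l > mt \<Longrightarrow> (if l = 0 then \<phi>hat 0 > 0
       else c1 \<le> \<phi>hat l / real l powr (- 2 * m) \<and> \<phi>hat l / real l powr (- 2 * m) \<le> c2)"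
    using decay unfolding coeffs_decay_def by blast
  show ?thesis
  proof (rule that[OF c(1,2)])
    show "mt = -1 \<Longrightarrow> \<phi>hat 0 > 0" using c(3)[of 0] by simp
    show "c1 * real l powr (- 2 * m) \<le> \<phi>hat l \<and> \<phi>hat l \<le> c2 * real l powr (- 2 * m)" if "l \<ge> 1" "int l > mt" for l
    proof -
      have "real l powr (- 2 * m) > 0" using that by simp
      then show ?thesis using c(3)[OF that(2)] that(1) by (simp add: pos_le_divide_eq pos_divide_le_eq)
    qed
  qed
qed

text \<open>a l is of order l^(1-2m) by the factor 2 l + 1 of the addition theorem, so the terms are
  of order l^(3-2m), which is summable exactly for m > 2.\<close>

lemma summable_a_sq: "summable (\<lambda>l. \<bar>a l\<bar> * eigval l)"
proof -
  obtain c1 c2 where c: "c1 > 0" "c2 > 0"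
    "\<And>l. l \<ge> 1 \<Longrightarrow> int l > mt \<Longrightarrow> c1 * real l powr (- 2 * m) \<le> \<phi>hat l \<and> \<phi>hat l \<le> c2 * real l powr (- 2 * m)"
    by (rule decay_obtain) blast
  have sm: "summable (\<lambda>l. 6 * c2 * real l powr (3 - 2 * m))"
    using m_gt by (intro summable_mult) (simp add: summable_real_powr_iff)
  show ?thesis
  proof (rule summable_comparison_test_ev[OF _ sm])
    show "\<forall>\<^sub>F l in sequentially. norm (\<bar>a l\<bar> * eigval l) \<le> 6 * c2 * real l powr (3 - 2 * m)"
    proof (rule eventually_sequentiallyI[of "nat (mt + 1) + 1"])
      fix l assume "nat (mt + 1) + 1 \<le> l"
      then have l: "l \<ge> 1" "int l > mt" by linarith+
      then have h: "0 \<le> \<phi>hat l" "\<phi>hat l \<le> c2 * real l powr (- 2 * m)"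
        using c(1) c(3)[OF l] by (auto intro: order_trans[rotated])
      have "(2 * real l + 1) / (4 * pi) \<le> 3 * real l / 1" using l(1) pi_gt3 by (intro frac_le) auto
      then have "\<bar>a l\<bar> \<le> (c2 * real l powr (- 2 * m)) * (3 * real l)"
        unfolding a_def abs_mult using h by (intro mult_mono) auto
      moreover have "eigval l \<le> real l * (2 * real l)" using l(1) by (intro mult_left_mono) auto
      ultimately have "\<bar>a l\<bar> * eigval l \<le> (c2 * real l powr (- 2 * m)) * (3 * real l) * (real l * (2 * real l))"
        using c(2) l(1) by (intro mult_mono) auto
      also have "\<dots> = 6 * c2 * (real l powr (- 2 * m) * real l ^ 3)" by (simp add: power3_eq_cube)
      also have "real l powr (- 2 * m) * real l ^ 3 = real l powr (3 - 2 * m)"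
        using l(1) by (simp add: powr_diff powr_minus field_simps flip: powr_numeral)
      finally show "norm (\<bar>a l\<bar> * eigval l) \<le> 6 * c2 * real l powr (3 - 2 * m)" by simp
    qed
  qed
qed

lemma summable_a: "summable (\<lambda>l. \<bar>a l\<bar>)"
proof (rule summable_comparison_test_ev[OF _ summable_a_sq])
  show "\<forall>\<^sub>F l in sequentially. norm \<bar>a l\<bar> \<le> \<bar>a l\<bar> * eigval l"
  proof (rule eventually_sequentiallyI[of 1])
    fix l :: nat assume "1 \<le> l"
    then have "1 * 1 \<le> eigval l" by (intro mult_mono) auto
    then show "norm \<bar>a l\<bar> \<le> \<bar>a l\<bar> * eigval l"
      using mult_left_mono[of 1 "eigval l" "\<bar>a l\<bar>"] by simp
  qed
qed

lemma summable_a_ev: "summable (\<lambda>l. shift l * \<bar>a l\<bar>)"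
  using summable_add[OF summable_mult[OF summable_a, of \<alpha>] summable_a_sq] by (simp add: algebra_simps)

lemma inner_abs_le_1: "x \<in> S2 \<Longrightarrow> y \<in> S2 \<Longrightarrow> \<bar>inner x y\<bar> \<le> 1"
  using Cauchy_Schwarz_ineq2[of x y] by simp

lemma phi_sums:
  assumes "x \<in> S2" "y \<in> S2"
  shows "(\<lambda>l. a l * legendre l (inner x y)) sums \<phi> (inner x y)"
proof -
  have "(\<lambda>l. \<Sum>\<mu>\<in>{- int l..int l}. \<phi>hat l * sph_harm l \<mu> x * sph_harm l \<mu> y) sums \<phi> (inner x y)"
    using SBF assms unfolding is_SBF_def by blast
  moreover have "(\<Sum>\<mu>\<in>{- int l..int l}. \<phi>hat l * sph_harm l \<mu> x * sph_harm l \<mu> y) = a l * legendre l (inner x y)" for l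
    using arg_cong[OF legendre_addition[OF assms, of l], of "\<lambda>s. \<phi>hat l * s"]
    by (simp add: a_def sum_distrib_left mult_ac)
  ultimately show ?thesis by simp
qed

lemma psi_sums:
  assumes "x \<in> S2" "y \<in> S2"
  shows "(\<lambda>l. shift l * a l * legendre l (inner x y)) sums \<psi> x y"
proof -
  have "norm (shift l * a l * legendre l (inner x y)) \<le> shift l * \<bar>a l\<bar>" for l
    using abs_legendre_poly_le_1[OF inner_abs_le_1[OF assms], of l] alpha_pos
      mult_left_mono[of "\<bar>legendre l (inner x y)\<bar>" 1 "shift l * \<bar>a l\<bar>"]
    by (simp add: abs_mult)
  then show ?thesis unfolding \<psi>_def
    by (intro summable_sums summable_comparison_test'[OF summable_a_ev]) auto
qed

lemma phi_psi_bounded: "\<exists>G\<ge>0. \<forall>x\<in>S2. \<forall>y\<in>S2. \<bar>\<phi> (inner x y)\<bar> \<le> G \<and> \<bar>\<psi> x y\<bar> \<le> G"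
proof -
  define F1 where "F1 = (\<Sum>l. \<bar>a l\<bar>)"
  define F2 where "F2 = (\<Sum>l. shift l * \<bar>a l\<bar>)"
  have nn: "F1 \<ge> 0" "F2 \<ge> 0" unfolding F1_def F2_def using alpha_pos
    by (auto intro!: suminf_nonneg summable_a summable_a_ev)
  have "\<bar>\<phi> (inner x y)\<bar> \<le> F1 \<and> \<bar>\<psi> x y\<bar> \<le> F2" if S: "x \<in> S2" "y \<in> S2" for x y
  proof -
    have P: "\<bar>legendre l (inner x y)\<bar> \<le> 1" for l
      by (intro abs_legendre_poly_le_1 inner_abs_le_1 S)
    have 1: "norm (a l * legendre l (inner x y)) \<le> \<bar>a l\<bar>" for l
      using mult_left_mono[OF P[of l], of "\<bar>a l\<bar>"] by (simp add: abs_mult)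
    have 2: "norm (shift l * a l * legendre l (inner x y)) \<le> shift l * \<bar>a l\<bar>" for l
      using mult_left_mono[OF P[of l], of "shift l * \<bar>a l\<bar>"] alpha_pos by (simp add: abs_mult)
    have "norm (\<phi> (inner x y)) \<le> F1"
      unfolding F1_def sums_unique[OF phi_sums[OF S]]
      by (intro norm_suminf_le 1 summable_a)
    moreover have "norm (\<psi> x y) \<le> F2"
      unfolding F2_def sums_unique[OF psi_sums[OF S]]
      by (intro norm_suminf_le 2 summable_a_ev)
    ultimately show ?thesis by simp
  qed
  then show ?thesis using nn by (intro exI[of _ "F1 + F2"]) fastforce
qed

lemma helmholtz_interpolant:
  assumes "X \<subseteq> S2" "x \<in> S2"
  shows "helmholtz \<alpha> (interpolant X A b) x = helm_interpolant X A b x"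
proof -
  \<comment> \<open>\<phi> is tied to its series only for inner products of points of the sphere. So
    the operator is applied to the series g, and the result is transferred by
    \<open>has_laplace_beltrami_cong\<close>.\<close>
  define g where "g y u = (\<Sum>l. a l * legendre l (inner u y))" for y u :: "real ^ 3"
  define e where "e y = (\<Sum>l. - eigval l * a l * legendre l (inner x y))" for y :: "real ^ 3"
  have g: "g y u = \<phi> (inner u y)" if "u \<in> S2" "y \<in> S2" for u y
    unfolding g_def using phi_sums[OF that] by (simp add: sums_iff)
  have k: "has_laplace_beltrami (\<lambda>u. \<Sum>y\<in>X. A y * g y u) x (\<Sum>y\<in>X. A y * e y)"
    unfolding g_def e_def
    by (intro has_laplace_beltrami_sum has_laplace_beltrami_cmult has_laplace_beltrami_zonal_series summable_a_sq summable_a)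
      (use assms in auto)
  have p: "has_laplace_beltrami (poly_part b) x (\<Sum>k<K. b k * (- (real (deg k) * (real (deg k) + 1)) * Y k x))"
    unfolding poly_part_def[abs_def]
  proof (intro has_laplace_beltrami_sum has_laplace_beltrami_cmult)
    fix k assume "k \<in> {..<K}"
    then obtain \<mu> where "Y k = sph_harm (deg k) \<mu>" using Y_deg by blast
    then show "has_laplace_beltrami (Y k) x (- (real (deg k) * (real (deg k) + 1)) * Y k x)"
      using has_laplace_beltrami_sph_harm[OF assms(2)] by metis
  qed
  have "has_laplace_beltrami (interpolant X A b) x ((\<Sum>y\<in>X. A y * e y) + (\<Sum>k<K. b k * (- (real (deg k) * (real (deg k) + 1)) * Y k x)))"
    by (rule has_laplace_beltrami_cong[OF has_laplace_beltrami_add[OF k p]])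
      (use assms in \<open>auto simp: interpolant_def g intro!: sum.cong\<close>)
  then have "helmholtz \<alpha> (interpolant X A b) x = \<alpha> * interpolant X A b x - ((\<Sum>y\<in>X. A y * e y) + (\<Sum>k<K. b k * (- (real (deg k) * (real (deg k) + 1)) * Y k x)))"
    unfolding helmholtz_def by (simp only: has_laplace_beltrami_imp_eq)
  also have "\<dots> = (\<Sum>y\<in>X. A y * (\<alpha> * \<phi> (inner x y) - e y)) + poly_part (\<lambda>k. ev k * b k) x"
    unfolding interpolant_def poly_part_def ev_def
    by (simp add: algebra_simps sum_distrib_left sum.distrib sum_subtractf sum_negf)
  also have "\<alpha> * \<phi> (inner x y) - e y = \<psi> x y" if "y \<in> X" for y
  proof -
    have y: "y \<in> S2" using that assms by blast
    have "(\<lambda>l. \<alpha> * (a l * legendre l (inner x y)) - shift l * a l * legendre l (inner x y)) sums (\<alpha> * \<phi> (inner x y) - \<psi> x y)"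
      by (intro sums_diff sums_mult phi_sums psi_sums assms y)
    then have "e y = \<alpha> * \<phi> (inner x y) - \<psi> x y"
      unfolding e_def by (simp add: sums_iff algebra_simps)
    then show ?thesis by simp
  qed
  then have "(\<Sum>y\<in>X. A y * (\<alpha> * \<phi> (inner x y) - e y)) = (\<Sum>y\<in>X. A y * \<psi> x y)" by simp
  finally show ?thesis by (simp add: helm_interpolant_def)
qed

lemma psi_form_sums:
  assumes "X \<subseteq> S2"
  shows "(\<lambda>l. shift l * \<phi>hat l * zonal_energy X A l) sums (\<Sum>x\<in>X. \<Sum>y\<in>X. A x * A y * \<psi> x y)"
proof -
  have "(\<lambda>l. \<Sum>x\<in>X. \<Sum>y\<in>X. A x * A y * (shift l * a l * legendre l (inner x y))) sums (\<Sum>x\<in>X. \<Sum>y\<in>X. A x * A y * \<psi> x y)"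
    by (intro sums_sum sums_mult psi_sums) (use assms in auto)
  moreover have "(\<Sum>x\<in>X. \<Sum>y\<in>X. A x * A y * (shift l * a l * legendre l (inner x y))) = shift l * \<phi>hat l * zonal_energy X A l" for l
    unfolding zonal_energy_eq[OF assms] sum_distrib_left by (intro sum.cong[OF refl]) (simp add: a_def mult_ac)
  ultimately show ?thesis by simp
qed

lemma kernel_coefficients_bound:
  "\<exists>\<kappa>>0. \<forall>M X A b. 1 \<le> M \<longrightarrow> finite X \<longrightarrow> X \<subseteq> S2 \<longrightarrow> diag_dominant M X \<longrightarrow> moment_free X A
    \<longrightarrow> \<kappa> * real M powr (2 - m) * L2_set A X \<le> L2_set (helm_interpolant X A b) X"
proof -
  obtain c1 c2 where c: "c1 > 0" "c2 > 0" "mt = -1 \<Longrightarrow> \<phi>hat 0 > 0"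
    "\<And>l. l \<ge> 1 \<Longrightarrow> int l > mt \<Longrightarrow> c1 * real l powr (- 2 * m) \<le> \<phi>hat l \<and> \<phi>hat l \<le> c2 * real l powr (- 2 * m)"
    by (rule decay_obtain) blast
  \<comment> \<open>Only for mt = -1 does degree 0 enter the form, with coefficient \<alpha> times
    \<open>\<phi>hat 0\<close>.\<close>
  define c where "c = (if mt = -1 then min c1 (\<alpha> * \<phi>hat 0) else c1)"
  have cpos: "c > 0" and cle: "c \<le> c1" using c alpha_pos by (auto simp: c_def)
  \<comment> \<open>The factor \<alpha> + l(l+1) >= l^2 lowers the order of decay from 2 m to 2 (m -
    1), so the comparison is made with s = m - 1, where s > 1 is m > 2.\<close>
  have psi: "shift l * \<phi>hat l \<ge> (if l = 0 then c else c * real l powr (- 2 * (m - 1)))" if l: "int l > mt" for l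
  proof (cases "l = 0")
    case True
    then have "mt = -1" using l mt_ge by simp
    then show ?thesis using True by (simp add: c_def)
  next
    case False
    then have h: "c1 * real l powr (- 2 * m) \<le> \<phi>hat l" using c(4)[OF _ l] by simp
    have "c * real l powr (- 2 * (m - 1)) = (real l)\<^sup>2 * (c * real l powr (- 2 * m))"
    proof -
      have "real l powr (- 2 * (m - 1)) = real l powr (2 + - 2 * m)" by (simp add: algebra_simps)
      also have "\<dots> = (real l)\<^sup>2 * real l powr (- 2 * m)" using False by (simp only: powr_add) simp
      finally show ?thesis by simp
    qed
    also have "\<dots> \<le> shift l * \<phi>hat l"
    proof (intro mult_mono)
      show "c * real l powr (- 2 * m) \<le> \<phi>hat l"
        using h mult_right_mono[OF cle, of "real l powr (- 2 * m)"] by simp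
      show "(real l)\<^sup>2 \<le> \<alpha> + eigval l" using alpha_pos by (simp add: power2_eq_square algebra_simps)
    qed (use cpos alpha_pos in auto)
    finally show ?thesis using False by simp
  qed
  obtain \<kappa> where \<kappa>: "\<kappa> > 0" "\<And>M X A S. 1 \<le> M \<Longrightarrow> finite X \<Longrightarrow> X \<subseteq> S2 \<Longrightarrow> diag_dominant M X
      \<Longrightarrow> (\<And>l. int l \<le> mt \<Longrightarrow> zonal_energy X A l = 0) \<Longrightarrow> (\<lambda>l. shift l * \<phi>hat l * zonal_energy X A l) sums S
      \<Longrightarrow> \<kappa> * real M powr (1 - (m - 1)) * (\<Sum>x\<in>X. (A x)\<^sup>2) \<le> S"
    using energy_sum_lower_bound[of "m - 1" c mt "\<lambda>l. shift l * \<phi>hat l", OF _ cpos psi] m_gt by force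
  have "\<kappa> * real M powr (2 - m) * L2_set A X \<le> L2_set (helm_interpolant X A b) X"
    if X: "1 \<le> M" "finite X" "X \<subseteq> S2" "diag_dominant M X" and mom: "moment_free X A" for M X A b
  proof -
    have "\<kappa> * real M powr (1 - (m - 1)) * (\<Sum>x\<in>X. (A x)\<^sup>2) \<le> (\<Sum>x\<in>X. \<Sum>y\<in>X. A x * A y * \<psi> x y)"
      by (rule \<kappa>(2)[OF X moment_free_energy[OF mom] psi_form_sums[OF X(3)]])
    also have "\<dots> = (\<Sum>x\<in>X. A x * helm_interpolant X A b x)"
      unfolding helm_interpolant_def
      by (simp add: distrib_left sum.distrib moment_free_poly_part[OF mom] sum_distrib_left mult_ac)
    also have "\<dots> \<le> (\<Sum>x\<in>X. \<bar>A x\<bar> * \<bar>helm_interpolant X A b x\<bar>)"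
      by (intro sum_mono) (simp flip: abs_mult)
    also have "\<dots> \<le> L2_set A X * L2_set (helm_interpolant X A b) X" by (rule L2_set_mult_ineq)
    finally have *: "(\<kappa> * real M powr (2 - m) * L2_set A X) * L2_set A X \<le> L2_set (helm_interpolant X A b) X * L2_set A X"
      by (simp add: L2_set_def sum_nonneg mult_ac)
    show ?thesis
    proof (cases "L2_set A X = 0")
      case False
      then have "L2_set A X > 0" by (simp add: order.not_eq_order_implies_strict L2_set_nonneg less_le)
      then show ?thesis using * by (simp only: mult_le_cancel_right_pos)
    qed (simp add: L2_set_nonneg)
  qed
  then show ?thesis using \<kappa>(1) by blast
qed

end

section \<open>Chordal and geodesic distance, separation and covering\<close>

lemma dist_sq_sphere:
  assumes "x \<in> S2" "y \<in> S2"
  shows "(dist x y)\<^sup>2 = 2 - 2 * inner x y"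
  using assms unfolding dist_norm power2_norm_eq_inner
  by (simp add: inner_diff inner_commute norm_eq_1)

lemma dist_sphere_eq_sin:
  assumes "x \<in> S2" "y \<in> S2"
  shows "dist x y = 2 * sin (geodesic_dist x y / 2)" "0 \<le> geodesic_dist x y" "geodesic_dist x y \<le> pi"
proof -
  define \<theta> where "\<theta> = geodesic_dist x y"
  have i: "- 1 \<le> inner x y" "inner x y \<le> 1"
    using Cauchy_Schwarz_ineq2[of x y] assms by (auto simp: abs_le_iff)
  show t: "0 \<le> geodesic_dist x y" "geodesic_dist x y \<le> pi"
    using i by (auto simp: geodesic_dist_def arccos_lbound arccos_ubound)
  have "inner x y = cos (2 * (\<theta> / 2))" using i by (simp add: \<theta>_def geodesic_dist_def)
  then have "(dist x y)\<^sup>2 = (2 * sin (\<theta> / 2))\<^sup>2"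
    unfolding dist_sq_sphere[OF assms] cos_double_sin by (simp add: power_mult_distrib)
  moreover have "0 \<le> sin (\<theta> / 2)" using t by (intro sin_ge_zero) (auto simp: \<theta>_def)
  ultimately have "dist x y = 2 * sin (\<theta> / 2)"
    using power2_eq_iff_nonneg[of "dist x y" "2 * sin (\<theta> / 2)"] by simp
  then show "dist x y = 2 * sin (geodesic_dist x y / 2)" by (simp add: \<theta>_def)
qed

lemma dist_le_geodesic_dist:
  assumes "x \<in> S2" "y \<in> S2"
  shows "dist x y \<le> geodesic_dist x y"
  using dist_sphere_eq_sin[OF assms] sin_x_le_x[of "geodesic_dist x y / 2"] by simp

text \<open>With u half the angle this is u <= 4 sin u. Up to pi/3 the derivative of the sine is at
  least 1/2; beyond, the sine is at least 1/2 while u <= pi/2 < 2.\<close>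

lemma geodesic_dist_le_dist:
  assumes "x \<in> S2" "y \<in> S2"
  shows "geodesic_dist x y \<le> 4 * dist x y"
proof -
  define u where "u = geodesic_dist x y / 2"
  note d = dist_sphere_eq_sin[OF assms]
  have u: "0 \<le> u" "u \<le> pi / 2" using d by (auto simp: u_def)
  have "u \<le> 4 * sin u"
  proof (cases "u \<le> pi / 3")
    case True
    have "sin 0 - 0 / 2 \<le> sin u - u / 2"
    proof (rule DERIV_nonneg_imp_nondecreasing[OF u(1)])
      fix t assume t: "0 \<le> t" "t \<le> u"
      have "cos (pi / 3) \<le> cos t" using t True by (intro cos_monotone_0_pi_le) auto
      then have "0 \<le> cos t - 1 / 2" by (simp add: cos_60)
      moreover have "((\<lambda>t. sin t - t / 2) has_real_derivative cos t - 1 / 2) (at t)"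
        by (auto intro!: derivative_eq_intros)
      ultimately show "\<exists>y. ((\<lambda>t. sin t - t / 2) has_real_derivative y) (at t) \<and> 0 \<le> y" by blast
    qed
    then show ?thesis using u by simp
  next
    case False
    have "sin (pi / 6) \<le> sin u" using u False by (intro sin_monotone_2pi_le) auto
    then have "1 / 2 \<le> sin u" by (simp add: sin_30)
    then show ?thesis using u pi_less_4 by linarith
  qed
  then show ?thesis using d(1) by (simp add: u_def)
qed

text \<open>Geodesic distances of distinct points are at least twice the separation radius and at
  most four times the chordal ones; the quotient 1/2 is the chordal separation.\<close>

lemma separation_radius_bounds:
  assumes "finite X" "X \<subseteq> S2" "card X \<ge> 2"
  shows "0 < separation_radius X" "separation_radius X / 2 \<le> 2" "separated (separation_radius X / 2) X"
proof -
  define D where "D = {geodesic_dist x y | x y. x \<in> X \<and> y \<in> X \<and> x \<noteq> y}"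
  have q: "separation_radius X = Min D / 2" by (simp add: separation_radius_def D_def)
  have fin: "finite D"
    by (rule finite_subset[of _ "(\<lambda>(x, y). geodesic_dist x y) ` (X \<times> X)"]) (use assms in \<open>auto simp: D_def\<close>)
  have "\<not> card X \<le> Suc 0" using assms(3) by simp
  then obtain x y where xy: "x \<in> X" "y \<in> X" "x \<noteq> y" using card_le_Suc0_iff_eq[OF assms(1)] by blast
  then have ne: "D \<noteq> {}" by (auto simp: D_def)
  have "Min D \<in> D" using fin ne by (rule Min_in)
  then obtain u v where uv: "u \<in> X" "v \<in> X" "u \<noteq> v" "Min D = geodesic_dist u v" by (auto simp: D_def)
  have "0 < dist u v" using uv by simp
  also have "\<dots> \<le> geodesic_dist u v" using uv assms by (intro dist_le_geodesic_dist) auto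
  finally show "0 < separation_radius X" by (simp add: q uv)
  have "geodesic_dist u v \<le> pi" using uv assms by (intro dist_sphere_eq_sin) auto
  then show "separation_radius X / 2 \<le> 2" using pi_less_4 by (simp add: q uv)
  have "separation_radius X / 2 \<le> dist x y" if "x \<in> X" "y \<in> X" "x \<noteq> y" for x y
  proof -
    have "Min D \<le> geodesic_dist x y" using fin that by (intro Min_le) (auto simp: D_def)
    also have "\<dots> \<le> 4 * dist x y" using that assms by (intro geodesic_dist_le_dist) auto
    finally show ?thesis by (simp add: q)
  qed
  then show "separated (separation_radius X / 2) X" by (auto simp: separated_def)
qed

lemma fill_distance_cover:
  assumes "finite X" "X \<noteq> {}" "X \<subseteq> S2" "x \<in> S2"
  shows "\<exists>y\<in>X. dist x y \<le> fill_distance X"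
proof -
  have "Min (geodesic_dist x ` X) \<in> geodesic_dist x ` X" using assms by (intro Min_in) auto
  then obtain y where y: "y \<in> X" "Min (geodesic_dist x ` X) = geodesic_dist x y" by auto
  have "Min (geodesic_dist u ` X) \<le> pi" if "u \<in> S2" for u
  proof -
    have "Min (geodesic_dist u ` X) \<le> geodesic_dist u y" using y assms by (intro Min_le) auto
    also have "\<dots> \<le> pi" using y that assms by (intro dist_sphere_eq_sin) auto
    finally show ?thesis .
  qed
  then have "bdd_above ((\<lambda>u. Min (geodesic_dist u ` X)) ` S2)" by (auto intro!: bdd_aboveI[of _ pi])
  then have "Min (geodesic_dist x ` X) \<le> fill_distance X"
    unfolding fill_distance_def using assms(4) by (intro cSUP_upper)
  moreover have "dist x y \<le> geodesic_dist x y" using y assms by (intro dist_le_geodesic_dist) auto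
  ultimately have "dist x y \<le> fill_distance X" using y by simp
  then show ?thesis using y(1) by blast
qed

lemma finite_ex_separated:
  assumes "finite X"
  shows "\<exists>\<delta>>0. \<delta> \<le> 2 \<and> separated \<delta> X"
proof -
  define D where "D = insert 2 ((\<lambda>(x, y). dist x y) ` {(x, y). x \<in> X \<and> y \<in> X \<and> x \<noteq> y})"
  have "finite {(x, y). x \<in> X \<and> y \<in> X \<and> x \<noteq> y}"
    by (rule finite_subset[of _ "X \<times> X"]) (use assms in auto)
  then have D: "finite D" "D \<noteq> {}" by (auto simp: D_def)
  have "\<forall>d\<in>D. d > 0" by (auto simp: D_def)
  then have "Min D > 0" using D by simp
  moreover have "Min D \<le> 2" using D by (intro Min_le) (auto simp: D_def)
  moreover have "Min D \<le> dist x y" if "x \<in> X" "y \<in> X" "x \<noteq> y" for x y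
    using D that by (intro Min_le) (auto simp: D_def image_iff)
  ultimately show ?thesis unfolding separated_def by blast
qed

section \<open>Norming sets and the stability estimate\<close>

lemma continuous_on_sph_harm: "continuous_on S (sph_harm l \<mu>)"
proof -
  have C: "Complex r s = of_real r + \<i> * of_real s" for r s by (simp add: complex_eq_iff)
  consider "\<mu> = 0" | "\<mu> > 0" | "\<mu> < 0" by linarith
  then show ?thesis
    unfolding sph_harm_def[abs_def] Let_def C
    by cases (auto intro!: continuous_intros)
qed

abbreviation covers :: "real \<Rightarrow> (real ^ 3) set \<Rightarrow> bool"
  where "covers h X \<equiv> \<forall>x\<in>S2. \<exists>y\<in>X. dist x y \<le> h"

context sbf_setting
begin

text \<open>What nonsingularity of the augmented matrix provides: uniqueness, solvability, and
  coefficients of polynomials given by fixed linear functionals of their values on X. The last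
  clause contains the linear independence of the harmonics.\<close>

definition unisolvent :: "(real ^ 3) set \<Rightarrow> bool"
  where "unisolvent X \<longleftrightarrow> finite X \<and> X \<subseteq> S2
    \<and> (\<forall>A b. moment_free X A \<longrightarrow> (\<forall>x\<in>X. interpolant X A b x = 0) \<longrightarrow> (\<forall>x\<in>X. A x = 0) \<and> (\<forall>k<K. b k = 0))
    \<and> (\<forall>v. \<exists>A b. moment_free X A \<and> (\<forall>x\<in>X. interpolant X A b x = v x))
    \<and> (\<exists>c. \<forall>b. \<forall>k<K. b k = (\<Sum>x\<in>X. c k x * poly_part b x))"

lemma abs_poly_part_le:
  assumes "\<And>k. k < K \<Longrightarrow> \<bar>Y k x\<bar> \<le> B"
  shows "\<bar>poly_part b x\<bar> \<le> B * (\<Sum>k<K. \<bar>b k\<bar>)"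
proof -
  have "\<bar>poly_part b x\<bar> \<le> (\<Sum>k<K. \<bar>b k * Y k x\<bar>)" unfolding poly_part_def by (rule sum_abs)
  also have "\<dots> \<le> (\<Sum>k<K. B * \<bar>b k\<bar>)"
    using assms by (intro sum_mono) (auto simp: abs_mult mult.commute[of "\<bar>b _\<bar>"] intro!: mult_right_mono)
  finally show ?thesis by (simp add: sum_distrib_left)
qed

text \<open>A single unisolvent set X0 bounds the coefficients by values on X0. By uniform
  continuity values at nearby points of X do as well, so h and C depend on X0 but not on X.\<close>

lemma poly_norming_fine:
  assumes X0: "unisolvent X0"
  shows "\<exists>h>0. \<exists>C\<ge>0. \<forall>X b \<epsilon>. X \<subseteq> S2 \<longrightarrow> covers h X \<longrightarrow> (\<forall>x\<in>X. \<bar>poly_part b x\<bar> \<le> \<epsilon>)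
    \<longrightarrow> (\<Sum>k<K. \<bar>b k\<bar>) \<le> C * \<epsilon>"
proof -
  obtain c where c: "\<And>b k. k < K \<Longrightarrow> b k = (\<Sum>x\<in>X0. c k x * poly_part b x)"
    using X0 unfolding unisolvent_def by blast
  define C where "C = (\<Sum>k<K. \<Sum>x\<in>X0. \<bar>c k x\<bar>)"
  have C0: "C \<ge> 0" unfolding C_def by (intro sum_nonneg) auto
  have bnd: "(\<Sum>k<K. \<bar>b k\<bar>) \<le> C * \<eta>" if "\<And>x. x \<in> X0 \<Longrightarrow> \<bar>poly_part b x\<bar> \<le> \<eta>" for b \<eta>
  proof -
    have "(\<Sum>k<K. \<bar>b k\<bar>) \<le> (\<Sum>k<K. \<Sum>x\<in>X0. \<bar>c k x\<bar> * \<eta>)"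
    proof (rule sum_mono)
      fix k assume "k \<in> {..<K}"
      then have "\<bar>b k\<bar> = \<bar>\<Sum>x\<in>X0. c k x * poly_part b x\<bar>" using c[of k b] by simp
      also have "\<dots> \<le> (\<Sum>x\<in>X0. \<bar>c k x * poly_part b x\<bar>)" by (rule sum_abs)
      also have "\<dots> \<le> (\<Sum>x\<in>X0. \<bar>c k x\<bar> * \<eta>)"
        using that by (intro sum_mono) (auto simp: abs_mult intro!: mult_left_mono)
      finally show "\<bar>b k\<bar> \<le> (\<Sum>x\<in>X0. \<bar>c k x\<bar> * \<eta>)" .
    qed
    then show ?thesis by (simp add: C_def sum_distrib_right)
  qed
  \<comment> \<open>Makes C e <= 1/2, so the error of moving from X0 to X, at most e times the sum
    of the |b k|, is absorbed into the left side at the price of doubling C.\<close>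
  define e where "e = 1 / (2 * C + 1)"
  have e: "e > 0" "C * e \<le> 1 / 2" using C0 by (auto simp: e_def field_simps)
  have "\<exists>h>0. \<forall>x\<in>S2. \<forall>y\<in>S2. dist x y \<le> h \<longrightarrow> \<bar>Y k x - Y k y\<bar> \<le> e" if "k < K" for k
  proof -
    obtain l \<mu> where "Y k = sph_harm l \<mu>" using Y_deg[OF \<open>k < K\<close>] by blast
    then have "uniformly_continuous_on S2 (Y k)"
      using compact_uniformly_continuous[OF continuous_on_sph_harm] by simp
    then obtain d where "d > 0" "\<And>x y. x \<in> S2 \<Longrightarrow> y \<in> S2 \<Longrightarrow> dist x y < d \<Longrightarrow> \<bar>Y k x - Y k y\<bar> < e"
      unfolding uniformly_continuous_on_def dist_real_def using e(1) by (metis dist_commute)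
    then show ?thesis by (intro exI[of _ "d / 2"]) (auto intro: less_imp_le)
  qed
  then obtain hk where hk: "\<And>k. k < K \<Longrightarrow> hk k > 0" "\<And>k x y. k < K \<Longrightarrow> x \<in> S2 \<Longrightarrow> y \<in> S2 \<Longrightarrow> dist x y \<le> hk k \<Longrightarrow> \<bar>Y k x - Y k y\<bar> \<le> e"
    by metis
  define h where "h = Min (insert 1 (hk ` {..<K}))"
  have h: "h > 0" using hk(1) by (auto simp: h_def)
  have hle: "h \<le> hk k" if "k < K" for k unfolding h_def using that by (intro Min_le) auto
  have main: "(\<Sum>k<K. \<bar>b k\<bar>) \<le> (2 * C) * \<epsilon>"
    if X: "X \<subseteq> S2" "covers h X" and b: "\<forall>x\<in>X. \<bar>poly_part b x\<bar> \<le> \<epsilon>" for X b \<epsilon>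
  proof -
    let ?\<beta> = "\<Sum>k<K. \<bar>b k\<bar>"
    have "\<bar>poly_part b x\<bar> \<le> \<epsilon> + e * ?\<beta>" if "x \<in> X0" for x
    proof -
      have x: "x \<in> S2" using that X0 unfolding unisolvent_def by blast
      then obtain y where y: "y \<in> X" "dist x y \<le> h" using X by blast
      have "\<bar>poly_part b x - poly_part b y\<bar> = \<bar>\<Sum>k<K. b k * (Y k x - Y k y)\<bar>"
        by (simp add: poly_part_def right_diff_distrib sum_subtractf)
      also have "\<dots> \<le> (\<Sum>k<K. \<bar>b k * (Y k x - Y k y)\<bar>)" by (rule sum_abs)
      also have "\<dots> \<le> (\<Sum>k<K. e * \<bar>b k\<bar>)"
      proof (rule sum_mono)
        fix k assume "k \<in> {..<K}"
        then have "\<bar>Y k x - Y k y\<bar> \<le> e" using x y X hle[of k] by (intro hk(2)) auto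
        then have "\<bar>b k\<bar> * \<bar>Y k x - Y k y\<bar> \<le> \<bar>b k\<bar> * e" by (intro mult_left_mono) auto
        then show "\<bar>b k * (Y k x - Y k y)\<bar> \<le> e * \<bar>b k\<bar>" by (simp add: abs_mult mult.commute)
      qed
      also have "\<dots> = e * ?\<beta>" by (simp add: sum_distrib_left)
      finally show ?thesis using b y(1) by fastforce
    qed
    then have "?\<beta> \<le> C * (\<epsilon> + e * ?\<beta>)" by (rule bnd)
    moreover have "C * e * ?\<beta> \<le> 1 / 2 * ?\<beta>" using e(2) by (intro mult_right_mono sum_nonneg) auto
    ultimately show ?thesis by (simp add: algebra_simps)
  qed
  show ?thesis
  proof (rule exI[of _ h], rule conjI[OF h], rule exI[of _ "2 * C"], intro conjI allI impI)
    show "0 \<le> 2 * C" using C0 by simp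
  qed (rule main)
qed

lemma poly_norming:
  "\<exists>h>0. \<exists>C\<ge>0. \<forall>X b \<epsilon>. unisolvent X \<longrightarrow> X \<noteq> {} \<longrightarrow> (mt \<ge> 1 \<longrightarrow> covers h X)
    \<longrightarrow> (\<forall>x\<in>X. \<bar>poly_part (\<lambda>k. ev k * b k) x\<bar> \<le> \<epsilon>) \<longrightarrow> (\<forall>x\<in>X. \<bar>poly_part b x\<bar> \<le> C * \<epsilon>)"
\<comment> \<open>If the condition fails, either mt < 1, where every \<open>ev k\<close> equals
  \<alpha> and p is L p divided by \<alpha>, or no unisolvent set exists and the claim is
  vacuous.\<close>
proof (cases "mt \<ge> 1 \<and> (\<exists>X0. unisolvent X0)")
  case True
  then obtain X0 where X0: "unisolvent X0" by blast
  from poly_norming_fine[OF X0] obtain h C where h: "h > 0" and C: "C \<ge> 0"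
    and bnd: "\<forall>X b \<epsilon>. X \<subseteq> S2 \<longrightarrow> covers h X \<longrightarrow> (\<forall>x\<in>X. \<bar>poly_part b x\<bar> \<le> \<epsilon>)
      \<longrightarrow> (\<Sum>k<K. \<bar>b k\<bar>) \<le> C * \<epsilon>"
    by (elim exE conjE) (rule that)
  have "\<exists>B. \<forall>x\<in>S2. \<bar>Y k x\<bar> \<le> B" if "k < K" for k
  proof -
    obtain l \<mu> where "Y k = sph_harm l \<mu>" using Y_deg[OF \<open>k < K\<close>] by blast
    then have "compact (Y k ` S2)" using compact_continuous_image[OF continuous_on_sph_harm] by simp
    then have "bounded (Y k ` S2)" by (rule compact_imp_bounded)
    then show ?thesis unfolding bounded_iff by simp
  qed
  then obtain Bk where Bk: "\<And>k x. k < K \<Longrightarrow> x \<in> S2 \<Longrightarrow> \<bar>Y k x\<bar> \<le> Bk k" by metis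
  define B where "B = (\<Sum>k<K. \<bar>Bk k\<bar>)"
  have B: "\<bar>Y k x\<bar> \<le> B" if "k < K" "x \<in> S2" for k x
  proof -
    have "\<bar>Y k x\<bar> \<le> \<bar>Bk k\<bar>" using Bk[OF that] by simp
    also have "\<dots> \<le> B" unfolding B_def using that by (intro member_le_sum) auto
    finally show ?thesis .
  qed
  have B0: "B \<ge> 0" unfolding B_def by (intro sum_nonneg) auto
  have "\<bar>poly_part b x\<bar> \<le> (B * C / \<alpha>) * \<epsilon>"
    if X: "unisolvent X" "covers h X" "\<forall>x\<in>X. \<bar>poly_part (\<lambda>k. ev k * b k) x\<bar> \<le> \<epsilon>" "x \<in> X" for X b \<epsilon> x
  proof -
    have XS: "X \<subseteq> S2" using X(1) unfolding unisolvent_def by blast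
    have "\<alpha> \<le> \<bar>ev k\<bar>" for k using ev_ge[of k] by linarith
    then have "\<alpha> * (\<Sum>k<K. \<bar>b k\<bar>) \<le> (\<Sum>k<K. \<bar>ev k * b k\<bar>)"
      unfolding sum_distrib_left abs_mult by (intro sum_mono mult_right_mono) auto
    also have "\<dots> \<le> C * \<epsilon>" using bnd XS X(2,3) by blast
    finally have le: "(\<Sum>k<K. \<bar>b k\<bar>) \<le> C * \<epsilon> / \<alpha>" using alpha_pos by (simp add: pos_le_divide_eq mult.commute)
    have "\<bar>poly_part b x\<bar> \<le> B * (\<Sum>k<K. \<bar>b k\<bar>)" by (rule abs_poly_part_le) (use B XS X(4) in auto)
    also have "\<dots> \<le> B * (C * \<epsilon> / \<alpha>)" by (rule mult_left_mono[OF le B0])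
    finally show ?thesis by simp
  qed
  note main = this
  show ?thesis
  proof (rule exI[of _ h], rule conjI[OF h], rule exI[of _ "B * C / \<alpha>"], intro conjI allI impI ballI)
    show "0 \<le> B * C / \<alpha>" using B0 C alpha_pos by simp
  qed (rule main, use True in auto)
next
  case False
  have "\<bar>poly_part b x\<bar> \<le> (1 / \<alpha>) * \<epsilon>"
    if "unisolvent X" "\<forall>x\<in>X. \<bar>poly_part (\<lambda>k. ev k * b k) x\<bar> \<le> \<epsilon>" "x \<in> X" for X b \<epsilon> x
  proof -
    have "mt < 1" using False that by auto
    then have "ev k = \<alpha>" if "k < K" for k using Y_deg(1)[OF that] by (simp add: ev_def)
    then have "poly_part (\<lambda>k. ev k * b k) x = \<alpha> * poly_part b x"
      by (simp add: poly_part_def sum_distrib_left mult_ac)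
    then have "\<alpha> * \<bar>poly_part b x\<bar> \<le> \<epsilon>" using that alpha_pos by (metis abs_mult abs_of_pos)
    then show ?thesis using alpha_pos by (simp add: field_simps)
  qed
  note main = this
  have "\<exists>C\<ge>0. \<forall>X b \<epsilon>. unisolvent X \<longrightarrow> X \<noteq> {} \<longrightarrow> (mt \<ge> 1 \<longrightarrow> covers 1 X)
    \<longrightarrow> (\<forall>x\<in>X. \<bar>poly_part (\<lambda>k. ev k * b k) x\<bar> \<le> \<epsilon>) \<longrightarrow> (\<forall>x\<in>X. \<bar>poly_part b x\<bar> \<le> C * \<epsilon>)"
  proof (rule exI[of _ "1 / \<alpha>"], intro conjI allI impI ballI)
    show "0 \<le> 1 / \<alpha>" using alpha_pos by simp
  qed (rule main)
  moreover have "(0 :: real) < 1" by simp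
  ultimately show ?thesis by - (rule exI, rule conjI)
qed

lemma L2_set_le_card:
  assumes "finite X" "\<And>x. x \<in> X \<Longrightarrow> \<bar>f x\<bar> \<le> c"
  shows "L2_set f X \<le> sqrt (card X) * c"
proof (cases "X = {}")
  case False
  then have c: "c \<ge> 0" using assms(2) by (meson abs_ge_zero all_not_in_conv order_trans)
  have "(\<Sum>x\<in>X. (f x)\<^sup>2) \<le> (\<Sum>x\<in>X. c\<^sup>2)"
    using assms(2) c by (intro sum_mono) (simp add: abs_le_square_iff[symmetric])
  then have "L2_set f X \<le> sqrt (card X * c\<^sup>2)" unfolding L2_set_def by (intro real_sqrt_le_mono) simp
  also have "\<dots> = sqrt (card X) * c" using c by (simp add: real_sqrt_mult)
  finally show ?thesis .
qed simp

text \<open>One factor sqrt N arises in passing from the l2 norm of A to the sum of the |A y|,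
  another from the maximum of the interpolant on X to its l2 norm. Since N <= 3 M, they raise
  M^(m-2) to M^(m-1).\<close>

lemma stability_core:
  "\<exists>h>0. \<exists>C>0. \<forall>M X A b. 1 \<le> M \<longrightarrow> unisolvent X \<longrightarrow> X \<noteq> {} \<longrightarrow> diag_dominant M X
    \<longrightarrow> (mt \<ge> 1 \<longrightarrow> covers h X) \<longrightarrow> moment_free X A
    \<longrightarrow> L2_set (interpolant X A b) X \<le> C * real M powr (m - 1) * L2_set (helm_interpolant X A b) X"
proof -
  from kernel_coefficients_bound obtain \<kappa> where \<kappa>: "\<kappa> > 0"
    and coef: "\<forall>M X A b. 1 \<le> M \<longrightarrow> finite X \<longrightarrow> X \<subseteq> S2 \<longrightarrow> diag_dominant M X \<longrightarrow> moment_free X A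
    \<longrightarrow> \<kappa> * real M powr (2 - m) * L2_set A X \<le> L2_set (helm_interpolant X A b) X"
    by (elim exE conjE) (rule that)
  from poly_norming obtain h D where h: "h > 0" and D: "D \<ge> 0"
    and norming: "\<forall>X b \<epsilon>. unisolvent X \<longrightarrow> X \<noteq> {} \<longrightarrow> (mt \<ge> 1 \<longrightarrow> covers h X)
    \<longrightarrow> (\<forall>x\<in>X. \<bar>poly_part (\<lambda>k. ev k * b k) x\<bar> \<le> \<epsilon>) \<longrightarrow> (\<forall>x\<in>X. \<bar>poly_part b x\<bar> \<le> D * \<epsilon>)"
    by (elim exE conjE) (rule that)
  obtain G where G: "G \<ge> 0" "\<And>x y. x \<in> S2 \<Longrightarrow> y \<in> S2 \<Longrightarrow> \<bar>\<phi> (inner x y)\<bar> \<le> G" "\<And>x y. x \<in> S2 \<Longrightarrow> y \<in> S2 \<Longrightarrow> \<bar>\<psi> x y\<bar> \<le> G"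
    using phi_psi_bounded by blast
  \<comment> \<open>The final 1 only makes C positive.\<close>
  define C where "C = 3 * (G * (1 + D) / \<kappa> + D) + 1"
  have C: "C > 0" using G D \<kappa> by (auto simp: C_def intro!: add_nonneg_pos)
  have "L2_set (interpolant X A b) X \<le> C * real M powr (m - 1) * L2_set (helm_interpolant X A b) X"
    if M: "1 \<le> M" and X: "unisolvent X" "X \<noteq> {}" "diag_dominant M X" "mt \<ge> 1 \<longrightarrow> covers h X"
      and mom: "moment_free X A" for M X A b
  proof -
    have Xf: "finite X" "X \<subseteq> S2" using X(1) unfolding unisolvent_def by blast+
    define W LA N where "W = L2_set (helm_interpolant X A b) X" and "LA = L2_set A X" and "N = real (card X)"
    have nn: "W \<ge> 0" "LA \<ge> 0" by (simp_all add: W_def LA_def L2_set_nonneg)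
    have N: "N \<ge> 1" "N \<le> 3 * real M"
      using X Xf M card_le_diag_dominant[of X M] by (auto simp: N_def Suc_le_eq card_gt_0_iff)
    have LA: "\<kappa> * LA \<le> real M powr (m - 2) * W"
    proof -
      have "\<kappa> * real M powr (2 - m) * LA \<le> W" unfolding LA_def W_def using coef M Xf X(3) mom by blast
      then have "real M powr (m - 2) * (\<kappa> * real M powr (2 - m) * LA) \<le> real M powr (m - 2) * W"
        by (intro mult_left_mono) auto
      moreover have "real M powr (m - 2) * real M powr (2 - m) = 1" using M by (simp flip: powr_add)
      then have "real M powr (m - 2) * (\<kappa> * real M powr (2 - m) * LA) = \<kappa> * LA"
        by (metis (no_types, opaque_lifting) mult.assoc mult.commute mult_1)
      ultimately show ?thesis by simp
    qed
    have sumA: "(\<Sum>y\<in>X. \<bar>A y\<bar>) \<le> sqrt N * LA"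
      using L2_set_mult_ineq[of "\<lambda>_. 1" A X] by (simp add: L2_set_def[of "\<lambda>_. 1"] N_def LA_def)
    have kern: "\<bar>\<Sum>y\<in>X. A y * k y\<bar> \<le> G * (sqrt N * LA)" if k: "\<And>y. y \<in> X \<Longrightarrow> \<bar>k y\<bar> \<le> G" for k
    proof -
      have "\<bar>\<Sum>y\<in>X. A y * k y\<bar> \<le> (\<Sum>y\<in>X. \<bar>A y * k y\<bar>)" by (rule sum_abs)
      also have "\<dots> \<le> (\<Sum>y\<in>X. G * \<bar>A y\<bar>)"
        using k by (intro sum_mono) (auto simp: abs_mult mult.commute[of "\<bar>A _\<bar>"] intro!: mult_right_mono)
      also have "\<dots> = G * (\<Sum>y\<in>X. \<bar>A y\<bar>)" by (simp add: sum_distrib_left)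
      also have "\<dots> \<le> G * (sqrt N * LA)" by (rule mult_left_mono[OF sumA G(1)])
      finally show ?thesis .
    qed
    define \<epsilon> where "\<epsilon> = W + G * (sqrt N * LA)"
    have "\<bar>poly_part (\<lambda>k. ev k * b k) x\<bar> \<le> \<epsilon>" if x: "x \<in> X" for x
    proof -
      have "\<bar>helm_interpolant X A b x\<bar> \<le> W"
      proof -
        have "(helm_interpolant X A b x)\<^sup>2 \<le> (\<Sum>x\<in>X. (helm_interpolant X A b x)\<^sup>2)"
          by (rule member_le_sum[of x X]) (use x Xf in auto)
        then show ?thesis unfolding W_def L2_set_def by (simp add: real_le_rsqrt)
      qed
      moreover have "\<bar>\<Sum>y\<in>X. A y * \<psi> x y\<bar> \<le> G * (sqrt N * LA)"
        using x Xf by (intro kern G(3)) auto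
      ultimately show ?thesis unfolding helm_interpolant_def \<epsilon>_def by linarith
    qed
    then have p: "\<forall>x\<in>X. \<bar>poly_part b x\<bar> \<le> D * \<epsilon>" using norming X by blast
    have "\<bar>interpolant X A b x\<bar> \<le> G * (sqrt N * LA) + D * \<epsilon>" if x: "x \<in> X" for x
    proof -
      have "\<bar>\<Sum>y\<in>X. A y * \<phi> (inner x y)\<bar> \<le> G * (sqrt N * LA)"
        using x Xf by (intro kern G(2)) auto
      then show ?thesis using p x unfolding interpolant_def by fastforce
    qed
    then have "L2_set (interpolant X A b) X \<le> sqrt N * (G * (sqrt N * LA) + D * \<epsilon>)"
      unfolding N_def by (intro L2_set_le_card Xf) auto
    also have "\<dots> = (sqrt N * sqrt N) * (G * (1 + D)) * LA + sqrt N * D * W"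
      unfolding \<epsilon>_def by (simp add: algebra_simps)
    also have "\<dots> \<le> (3 * real M) * (G * (1 + D)) * LA + (3 * real M) * D * W"
    proof -
      have "sqrt N * 1 \<le> sqrt N * sqrt N" using N(1) by (intro mult_left_mono) auto
      then have "sqrt N \<le> 3 * real M" using N by simp
      moreover have "sqrt N * sqrt N \<le> 3 * real M" using N by simp
      ultimately show ?thesis using nn G D by (intro add_mono mult_right_mono) auto
    qed
    also have "\<dots> \<le> (3 * real M) * (G * (1 + D)) * (real M powr (m - 2) * W / \<kappa>) + (3 * real M) * D * (real M powr (m - 2) * W)"
    proof (intro add_mono mult_left_mono)
      show "LA \<le> real M powr (m - 2) * W / \<kappa>" using LA \<kappa> by (simp add: pos_le_divide_eq mult.commute)
      have "1 \<le> real M powr (m - 2)" using M m_gt by (intro ge_one_powr_ge_zero) auto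
      then show "W \<le> real M powr (m - 2) * W" using nn(1) mult_right_mono[of 1 "real M powr (m - 2)" W] by simp
    qed (use G D in auto)
    also have "\<dots> = (C - 1) * (real M * real M powr (m - 2)) * W"
      unfolding C_def by (simp add: algebra_simps add_divide_distrib)
    also have "real M * real M powr (m - 2) = real M powr (m - 1)"
    proof -
      have "real M powr (1 + (m - 2)) = real M powr 1 * real M powr (m - 2)" by (rule powr_add)
      then show ?thesis using M by (simp add: algebra_simps)
    qed
    also have "(C - 1) * real M powr (m - 1) * W \<le> C * real M powr (m - 1) * W"
      using nn by (intro mult_right_mono) auto
    finally show ?thesis unfolding W_def .
  qed
  note main = this
  show ?thesis
  proof (rule exI[of _ h], rule conjI[OF h], rule exI[of _ C], rule conjI[OF C], intro allI impI)
  qed (rule main)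
qed

end

section \<open>The finite difference matrix\<close>

lemma distinct_ex_fun:
  assumes "distinct xs"
  shows "\<exists>f. \<forall>i<length xs. f (xs ! i) = g i"
proof (intro exI allI impI)
  fix i assume "i < length xs"
  then show "(\<lambda>x. g (THE i. i < length xs \<and> xs ! i = x)) (xs ! i) = g i"
    using assms by (intro arg_cong[where f=g] the_equality) (auto simp: nth_eq_iff_index_eq)
qed

lemma sum_set_distinct:
  assumes "distinct xs"
  shows "(\<Sum>x\<in>set xs. f x) = (\<Sum>i<length xs. f (xs ! i))"
  by (rule sum.reindex_bij_betw[OF bij_betw_nth[OF assms refl refl], symmetric])

lemma sum_lessThan_add: "(\<Sum>i<n + k. f i) = (\<Sum>i<n. f i) + (\<Sum>i<k. f (n + i))" for f :: "nat \<Rightarrow> 'a :: comm_monoid_add"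
  by (induction k) (simp_all add: add.assoc)

lemma mult_mat_vec_nth:
  assumes "M \<in> carrier_mat r c" "v \<in> carrier_vec c" "i < r"
  shows "vec_index (M *\<^sub>v v) i = (\<Sum>j<c. M $$ (i, j) * vec_index v j)"
  using assms by (simp add: scalar_prod_def atLeast0LessThan)

text \<open>\<open>inverts_mat\<close> does not state the shape of the second matrix; it is read off
  from the identity matrices on both sides.\<close>

lemma inverts_mat_carrier:
  assumes "A \<in> carrier_mat n n" "inverts_mat A B" "inverts_mat B A"
  shows "B \<in> carrier_mat n n"
proof -
  have "dim_col (A * B) = dim_row A" "dim_col (B * A) = dim_row B"
    using assms(2,3) unfolding inverts_mat_def by simp_all
  then have "dim_col B = n" "dim_row B = n"
    using carrier_matD[OF assms(1)] by (simp_all only: index_mult_mat)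
  then show ?thesis by (rule carrier_matI[rotated])
qed

context sbf_setting
begin

lemma augmented_matrix_carrier: "augmented_matrix \<phi> mt xs \<in> carrier_mat (length xs + K) (length xs + K)"
  by (simp add: augmented_matrix_def Let_def K_def)

lemma augmented_matrix_mult_top:
  assumes "distinct xs" "i < length xs" "v \<in> carrier_vec (length xs + K)"
    and "\<And>j. j < length xs \<Longrightarrow> vec_index v j = A (xs ! j)" "\<And>k. k < K \<Longrightarrow> vec_index v (length xs + k) = b k"
  shows "vec_index (augmented_matrix \<phi> mt xs *\<^sub>v v) i = interpolant (set xs) A b (xs ! i)"
proof -
  let ?M = "augmented_matrix \<phi> mt xs" and ?N = "length xs"
  have M1: "?M $$ (i, j) = \<phi> (inner (xs ! i) (xs ! j))" if "j < ?N" for j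
    using assms that by (simp add: augmented_matrix_def Let_def K_def)
  have M2: "?M $$ (i, ?N + k) = Y k (xs ! i)" if "k < K" for k
    using assms that by (simp add: augmented_matrix_def Let_def K_def Y_def)
  have "vec_index (?M *\<^sub>v v) i = (\<Sum>j<?N + K. ?M $$ (i, j) * vec_index v j)"
    by (rule mult_mat_vec_nth[OF augmented_matrix_carrier assms(3)]) (use assms(2) in simp)
  also have "\<dots> = (\<Sum>j<?N. \<phi> (inner (xs ! i) (xs ! j)) * A (xs ! j)) + (\<Sum>k<K. Y k (xs ! i) * b k)"
    unfolding sum_lessThan_add using assms by (simp add: M1 M2)
  finally show ?thesis
    by (simp add: interpolant_def poly_part_def sum_set_distinct[OF assms(1)] mult.commute)
qed

lemma augmented_matrix_mult_bottom:
  assumes "distinct xs" "k < K" "v \<in> carrier_vec (length xs + K)"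
    and "\<And>j. j < length xs \<Longrightarrow> vec_index v j = A (xs ! j)"
  shows "vec_index (augmented_matrix \<phi> mt xs *\<^sub>v v) (length xs + k) = (\<Sum>x\<in>set xs. A x * Y k x)"
proof -
  let ?M = "augmented_matrix \<phi> mt xs" and ?N = "length xs"
  have M1: "?M $$ (?N + k, j) = Y k (xs ! j)" if "j < ?N" for j
    using assms that by (simp add: augmented_matrix_def Let_def K_def Y_def)
  have M2: "?M $$ (?N + k, ?N + k') = 0" if "k' < K" for k'
    using assms that by (simp add: augmented_matrix_def Let_def K_def)
  have "vec_index (?M *\<^sub>v v) (?N + k) = (\<Sum>j<?N + K. ?M $$ (?N + k, j) * vec_index v j)"
    by (rule mult_mat_vec_nth[OF augmented_matrix_carrier assms(3)]) (use assms(2) in simp)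
  also have "\<dots> = (\<Sum>j<?N. Y k (xs ! j) * A (xs ! j))"
    unfolding sum_lessThan_add using assms by (simp add: M1 M2)
  finally show ?thesis
    by (simp add: sum_set_distinct[OF assms(1)] mult.commute)
qed

text \<open>The inverse maps data, padded with K zeros, to coefficients. Its last K rows give the
  functionals in the last clause of \<open>unisolvent\<close>, as A = 0 shows, where the interpolant
  is a pure polynomial part.\<close>

lemma augmented_invertible_imp_unisolvent:
  assumes "distinct xs" "set xs \<subseteq> S2" "invertible_mat (augmented_matrix \<phi> mt xs)"
  shows "unisolvent (set xs)"
proof -
  let ?M = "augmented_matrix \<phi> mt xs" and ?N = "length xs" and ?X = "set xs"
  let ?n = "?N + K"
  note Mc = augmented_matrix_carrier[of xs]
  obtain B where inv: "inverts_mat ?M B" "inverts_mat B ?M"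
    using assms(3) unfolding invertible_mat_def by blast
  have B: "B \<in> carrier_mat ?n ?n" by (rule inverts_mat_carrier[OF Mc inv])
  have MB: "?M * B = 1\<^sub>m ?n" "B * ?M = 1\<^sub>m ?n"
    using inv B Mc by (simp_all add: inverts_mat_def)
  define w where "w A b = vec ?n (\<lambda>i. if i < ?N then A (xs ! i) else b (i - ?N))" for A :: "real ^ 3 \<Rightarrow> real" and b :: "nat \<Rightarrow> real"
  have w: "w A b \<in> carrier_vec ?n" "j < ?N \<Longrightarrow> vec_index (w A b) j = A (xs ! j)" "k < K \<Longrightarrow> vec_index (w A b) (?N + k) = b k" for A b j k
    by (auto simp: w_def)
  have rec: "vec_index (w A b) i = (\<Sum>j<?N. B $$ (i, j) * interpolant ?X A b (xs ! j))"
    if mom: "moment_free ?X A" and i: "i < ?n" for A b i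
  proof -
    have "w A b = B *\<^sub>v (?M *\<^sub>v w A b)"
      using w(1)[of A b] by (simp only: assoc_mult_mat_vec[OF B Mc, symmetric] MB one_mult_mat_vec)
    then have "vec_index (w A b) i = (\<Sum>j<?n. B $$ (i, j) * vec_index (?M *\<^sub>v w A b) j)"
      using mult_mat_vec_nth[OF B mult_mat_vec_carrier[OF Mc w(1)[of A b]] i] by simp
    also have "\<dots> = (\<Sum>j<?N. B $$ (i, j) * interpolant ?X A b (xs ! j))"
    proof -
      have "vec_index (?M *\<^sub>v w A b) (?N + k) = 0" if "k < K" for k
        using augmented_matrix_mult_bottom[OF assms(1) that w(1)] w(2) mom that by (simp add: moment_free_def)
      moreover have "vec_index (?M *\<^sub>v w A b) j = interpolant ?X A b (xs ! j)" if "j < ?N" for j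
        using augmented_matrix_mult_top[OF assms(1) that w(1)] w(2,3) by blast
      ultimately show ?thesis unfolding sum_lessThan_add by simp
    qed
    finally show ?thesis .
  qed
  have uniq: "(\<forall>x\<in>?X. A x = 0) \<and> (\<forall>k<K. b k = 0)" if mom: "moment_free ?X A" and z: "\<forall>x\<in>?X. interpolant ?X A b x = 0" for A b
  proof -
    have z0: "vec_index (w A b) i = 0" if "i < ?n" for i using rec[OF mom that, of b] z by simp
    have "A (xs ! j) = 0" if "j < ?N" for j using z0[of j] w(2)[OF that, of A b] that by simp
    moreover have "b k = 0" if "k < K" for k using z0[of "?N + k"] w(3)[OF that, of A b] that by simp
    ultimately show ?thesis by (auto simp: in_set_conv_nth)
  qed
  have exist: "\<exists>A b. moment_free ?X A \<and> (\<forall>x\<in>?X. interpolant ?X A b x = v x)" for v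
  proof -
    define u where "u = w v (\<lambda>_. 0)"
    define s where "s = B *\<^sub>v u"
    have uc: "u \<in> carrier_vec ?n" by (simp add: u_def w)
    then have sc: "s \<in> carrier_vec ?n" using B by (simp add: s_def)
    have Ms: "?M *\<^sub>v s = u"
      using uc by (simp only: s_def assoc_mult_mat_vec[OF Mc B, symmetric] MB one_mult_mat_vec)
    obtain A where A: "\<forall>j<?N. A (xs ! j) = vec_index s j" using distinct_ex_fun[OF assms(1), of "vec_index s"] by blast
    define b where "b k = vec_index s (?N + k)" for k
    have "(\<Sum>x\<in>?X. A x * Y k x) = 0" if "k < K" for k
      using augmented_matrix_mult_bottom[OF assms(1) that sc, of A] A w(3)[OF that, of v "\<lambda>_. 0"] by (simp add: Ms u_def)
    moreover have "interpolant ?X A b (xs ! j) = v (xs ! j)" if "j < ?N" for j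
      using augmented_matrix_mult_top[OF assms(1) that sc, of A b] A w(2)[OF that, of v "\<lambda>_. 0"] by (simp add: Ms u_def b_def)
    ultimately show ?thesis unfolding moment_free_def
      by (intro exI[of _ A] exI[of _ b]) (auto simp: in_set_conv_nth)
  qed
  have inv: "\<exists>c. \<forall>b. \<forall>k<K. b k = (\<Sum>x\<in>?X. c k x * poly_part b x)"
  proof -
    have "\<forall>k. \<exists>c. \<forall>j<?N. c (xs ! j) = B $$ (?N + k, j)" by (intro allI distinct_ex_fun[OF assms(1)])
    from choice[OF this] obtain c where c: "\<And>k j. j < ?N \<Longrightarrow> c k (xs ! j) = B $$ (?N + k, j)" by auto
    have "b k = (\<Sum>x\<in>?X. c k x * poly_part b x)" if "k < K" for b k
    proof -
      have "moment_free ?X (\<lambda>_. 0)" by (simp add: moment_free_def)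
      then have "vec_index (w (\<lambda>_. 0) b) (?N + k) = (\<Sum>j<?N. B $$ (?N + k, j) * interpolant ?X (\<lambda>_. 0) b (xs ! j))"
        using that by (intro rec) auto
      then show ?thesis using w(3)[OF that, of "\<lambda>_. 0" b]
        by (simp add: interpolant_def sum_set_distinct[OF assms(1)] c)
    qed
    then show ?thesis by blast
  qed
  show ?thesis unfolding unisolvent_def by (intro conjI finite_set assms(2) inv allI impI exist) (use uniq in simp_all)
qed

section \<open>Lagrange functions and the action of the finite difference matrix\<close>

lemma kernel_space_eq: "kernel_space \<phi> mt X = {interpolant X A b | A b. moment_free X A}"
proof -
  define F where "F A p = (\<lambda>x. (\<Sum>y\<in>X. A y * \<phi> (inner x y)) + p x)" for A and p :: "real ^ 3 \<Rightarrow> real"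
  have "interpolant X A b = F A (poly_part b)" for A b by (simp add: F_def interpolant_def fun_eq_iff)
  moreover have "kernel_space \<phi> mt X = {F A p | A p. p \<in> sph_polys mt \<and> moment_free X A}"
    unfolding kernel_space_def sph_polys_moment_iff F_def ..
  ultimately show ?thesis unfolding sph_polys_eq by auto
qed

lemma poly_part_sum: "poly_part (\<lambda>k. \<Sum>i\<in>I. c i * b i k) x = (\<Sum>i\<in>I. c i * poly_part (b i) x)"
  unfolding poly_part_def sum_distrib_left sum_distrib_right by (subst sum.swap) (simp only: mult.assoc)

lemma interpolant_sum:
  "interpolant X (\<lambda>y. \<Sum>i\<in>I. c i * A i y) (\<lambda>k. \<Sum>i\<in>I. c i * b i k) x = (\<Sum>i\<in>I. c i * interpolant X (A i) (b i) x)"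
proof -
  have "(\<Sum>y\<in>X. (\<Sum>i\<in>I. c i * A i y) * \<phi> (inner x y)) = (\<Sum>i\<in>I. c i * (\<Sum>y\<in>X. A i y * \<phi> (inner x y)))"
    unfolding sum_distrib_left sum_distrib_right by (subst sum.swap) (simp add: mult_ac)
  then show ?thesis by (simp add: interpolant_def poly_part_sum distrib_left sum.distrib)
qed

lemma helm_interpolant_sum:
  "helm_interpolant X (\<lambda>y. \<Sum>i\<in>I. c i * A i y) (\<lambda>k. \<Sum>i\<in>I. c i * b i k) x = (\<Sum>i\<in>I. c i * helm_interpolant X (A i) (b i) x)"
proof -
  have "(\<Sum>y\<in>X. (\<Sum>i\<in>I. c i * A i y) * \<psi> x y) = (\<Sum>i\<in>I. c i * (\<Sum>y\<in>X. A i y * \<psi> x y))"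
    unfolding sum_distrib_left sum_distrib_right by (subst sum.swap) (simp add: mult_ac)
  moreover have "poly_part (\<lambda>k. ev k * (\<Sum>i\<in>I. c i * b i k)) x = (\<Sum>i\<in>I. c i * poly_part (\<lambda>k. ev k * b i k) x)"
    using poly_part_sum[where I=I and c=c and b="\<lambda>i k. ev k * b i k" and x=x] by (simp add: sum_distrib_left mult_ac)
  ultimately show ?thesis by (simp add: helm_interpolant_def distrib_left sum.distrib)
qed

lemma moment_free_sum:
  assumes "\<And>i. i \<in> I \<Longrightarrow> moment_free X (A i)"
  shows "moment_free X (\<lambda>y. \<Sum>i\<in>I. c i * A i y)"
  unfolding moment_free_def
proof (intro allI impI)
  fix k assume k: "k < K"
  have "(\<Sum>y\<in>X. (\<Sum>i\<in>I. c i * A i y) * Y k y) = (\<Sum>i\<in>I. c i * (\<Sum>y\<in>X. A i y * Y k y))"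
    unfolding sum_distrib_left sum_distrib_right by (subst sum.swap) (simp add: mult_ac)
  then show "(\<Sum>y\<in>X. (\<Sum>i\<in>I. c i * A i y) * Y k y) = 0"
    using assms k by (simp add: moment_free_def)
qed

text \<open>\<open>THE\<close> needs uniqueness as a function on the whole space: equal values on X
  force equal coefficients on X and below K, and an interpolant depends on no others.\<close>

lemma lagrange_fun_eq:
  assumes "unisolvent X"
  shows "\<exists>A b. moment_free X A \<and> lagrange_fun \<phi> mt X x = interpolant X A b \<and> (\<forall>y\<in>X. interpolant X A b y = (if y = x then 1 else 0))"
proof -
  obtain A b where Ab: "moment_free X A" "\<forall>y\<in>X. interpolant X A b y = (if y = x then 1 else 0)"
    using assms unfolding unisolvent_def by (elim conjE) (erule allE[of _ "\<lambda>y. if y = x then 1 else 0"], blast)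
  have "lagrange_fun \<phi> mt X x = interpolant X A b"
    unfolding lagrange_fun_def
  proof (rule the_equality)
    show "interpolant X A b \<in> kernel_space \<phi> mt X \<and> (\<forall>y\<in>X. interpolant X A b y = (if y = x then 1 else 0))"
      using Ab unfolding kernel_space_eq by blast
  next
    fix f assume f: "f \<in> kernel_space \<phi> mt X \<and> (\<forall>y\<in>X. f y = (if y = x then 1 else 0))"
    then obtain A' b' where f': "f = interpolant X A' b'" "moment_free X A'" unfolding kernel_space_eq by blast
    have mom: "moment_free X (\<lambda>y. A' y - A y)"
      using Ab(1) f'(2) by (simp add: moment_free_def left_diff_distrib sum_subtractf)
    have diff: "interpolant X (\<lambda>y. A' y - A y) (\<lambda>k. b' k - b k) u = interpolant X A' b' u - interpolant X A b u" for u
      by (simp add: interpolant_def poly_part_def left_diff_distrib sum_subtractf)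
    have "\<forall>y\<in>X. interpolant X (\<lambda>y. A' y - A y) (\<lambda>k. b' k - b k) y = 0"
      unfolding diff using f f'(1) Ab(2) by simp
    then have "(\<forall>y\<in>X. A' y - A y = 0) \<and> (\<forall>k<K. b' k - b k = 0)"
      using assms mom unfolding unisolvent_def by blast
    then show "f = interpolant X A b"
      unfolding f'(1) interpolant_def poly_part_def by (intro ext) simp
  qed
  then show ?thesis using Ab by blast
qed

text \<open>The matrix maps the values on X of an interpolant to the values of its Helmholtz image.
  Every statement on the matrix thus becomes a comparison of these two samples.\<close>

lemma FD_matrix_mult:
  assumes X: "unisolvent (set xs)" and "distinct xs" and v: "v \<in> carrier_vec (length xs)"
  shows "\<exists>A b. moment_free (set xs) A \<and> (\<forall>i<length xs. interpolant (set xs) A b (xs ! i) = vec_index v i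
    \<and> vec_index (FD_matrix \<alpha> \<phi> mt xs *\<^sub>v v) i = helm_interpolant (set xs) A b (xs ! i))"
proof -
  let ?X = "set xs" and ?N = "length xs"
  have XS: "?X \<subseteq> S2" using X unfolding unisolvent_def by blast
  have "\<forall>j. \<exists>A b. moment_free ?X A \<and> lagrange_fun \<phi> mt ?X (xs ! j) = interpolant ?X A b \<and> (\<forall>y\<in>?X. interpolant ?X A b y = (if y = xs ! j then 1 else 0))"
    using lagrange_fun_eq[OF X] by blast
  then obtain A b where Ab: "\<And>j. moment_free ?X (A j)" "\<And>j. lagrange_fun \<phi> mt ?X (xs ! j) = interpolant ?X (A j) (b j)"
    "\<And>j y. y \<in> ?X \<Longrightarrow> interpolant ?X (A j) (b j) y = (if y = xs ! j then 1 else 0)"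
    by metis
  define A' b' where "A' y = (\<Sum>j<?N. vec_index v j * A j y)" and "b' k = (\<Sum>j<?N. vec_index v j * b j k)" for y k
  have "moment_free ?X A'" unfolding A'_def[abs_def] by (intro moment_free_sum Ab)
  moreover have "interpolant ?X A' b' (xs ! i) = vec_index v i" if i: "i < ?N" for i
  proof -
    have "interpolant ?X A' b' (xs ! i) = (\<Sum>j<?N. vec_index v j * interpolant ?X (A j) (b j) (xs ! i))"
      unfolding A'_def[abs_def] b'_def[abs_def] by (rule interpolant_sum)
    also have "\<dots> = (\<Sum>j<?N. if j = i then vec_index v j else 0)"
      using i assms(2) by (intro sum.cong) (auto simp: Ab(3) nth_eq_iff_index_eq)
    also have "\<dots> = vec_index v i" using i by simp
    finally show ?thesis .
  qed
  moreover have "vec_index (FD_matrix \<alpha> \<phi> mt xs *\<^sub>v v) i = helm_interpolant ?X A' b' (xs ! i)" if i: "i < ?N" for i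
  proof -
    have "vec_index (FD_matrix \<alpha> \<phi> mt xs *\<^sub>v v) i = (\<Sum>j<?N. FD_matrix \<alpha> \<phi> mt xs $$ (i, j) * vec_index v j)"
      using v i by (intro mult_mat_vec_nth) (auto simp: FD_matrix_def)
    also have "\<dots> = (\<Sum>j<?N. vec_index v j * helm_interpolant ?X (A j) (b j) (xs ! i))"
      using i XS by (intro sum.cong) (auto simp: FD_matrix_def Ab(2) helmholtz_interpolant[OF XS] subset_eq)
    also have "\<dots> = helm_interpolant ?X A' b' (xs ! i)"
      unfolding A'_def[abs_def] b'_def[abs_def] by (rule helm_interpolant_sum[symmetric])
    finally show ?thesis .
  qed
  ultimately show ?thesis by blast
qed

text \<open>The lower bound for the kernel form gives A = 0. What is left is that L p vanishes on X,
  and unisolvency itself settles this on any such X, however coarse.\<close>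

lemma helm_interpolant_eq_0_imp:
  assumes X: "unisolvent X" and mom: "moment_free X A" and z: "\<And>x. x \<in> X \<Longrightarrow> helm_interpolant X A b x = 0" and x: "x \<in> X"
  shows "interpolant X A b x = 0"
proof -
  have Xf: "finite X" "X \<subseteq> S2" using X unfolding unisolvent_def by blast+
  obtain \<delta> where \<delta>: "\<delta> > 0" "\<delta> \<le> 2" "separated \<delta> X" using finite_ex_separated[OF Xf(1)] by blast
  obtain M where M: "1 \<le> M" "diag_dominant M X" using ex_diag_dominant \<delta> Xf by metis
  obtain \<kappa> where "\<kappa> > 0" "\<kappa> * real M powr (2 - m) * L2_set A X \<le> L2_set (helm_interpolant X A b) X"
    using kernel_coefficients_bound M Xf mom by metis
  moreover have "L2_set (helm_interpolant X A b) X = 0" using z by (simp add: L2_set_def)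
  moreover have "\<kappa> * real M powr (2 - m) > 0" using \<open>\<kappa> > 0\<close> M by simp
  moreover have "L \<le> 0" if "c * L \<le> 0" "c > 0" for c L :: real using that by (simp add: mult_le_0_iff)
  ultimately have "L2_set A X \<le> 0" by metis
  then have "L2_set A X = 0" using L2_set_nonneg[of A X] by simp
  then have A0: "A y = 0" if "y \<in> X" for y using that Xf by (simp add: L2_set_eq_0_iff)
  \<comment> \<open>L p is read as an interpolant of its own, with the coefficients
    \<open>ev k * b k\<close>; uniqueness makes these zero, and \<open>ev k\<close> is
    positive.\<close>
  have "interpolant X A (\<lambda>k. ev k * b k) y = 0" if "y \<in> X" for y
    using z[OF that] A0 by (simp add: helm_interpolant_def interpolant_def)
  then have "\<forall>k<K. ev k * b k = 0" using X mom unfolding unisolvent_def by blast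
  moreover have "ev k \<noteq> 0" for k using ev_ge[of k] alpha_pos by linarith
  ultimately have "\<forall>k<K. b k = 0" by simp
  then show ?thesis using A0 by (simp add: interpolant_def poly_part_def)
qed

lemma FD_matrix_invertible:
  assumes "unisolvent (set xs)" "distinct xs"
  shows "invertible_mat (FD_matrix \<alpha> \<phi> mt xs)"
proof -
  let ?F = "FD_matrix \<alpha> \<phi> mt xs" and ?N = "length xs"
  have Fc: "?F \<in> carrier_mat ?N ?N" by (simp add: FD_matrix_def)
  have "det ?F \<noteq> 0"
  proof
    assume "det ?F = 0"
    then obtain v where v: "v \<in> carrier_vec ?N" "v \<noteq> 0\<^sub>v ?N" "?F *\<^sub>v v = 0\<^sub>v ?N"
      using det_0_iff_vec_prod_zero_field[OF Fc] by blast
    obtain A b where Ab: "moment_free (set xs) A" "\<forall>i<?N. interpolant (set xs) A b (xs ! i) = vec_index v i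
      \<and> vec_index (?F *\<^sub>v v) i = helm_interpolant (set xs) A b (xs ! i)"
      using FD_matrix_mult[OF assms v(1)] by blast
    have "helm_interpolant (set xs) A b x = 0" if "x \<in> set xs" for x
      using that Ab(2) unfolding v(3) by (auto simp: in_set_conv_nth)
    then have "interpolant (set xs) A b (xs ! i) = 0" if "i < ?N" for i
      using that by (intro helm_interpolant_eq_0_imp[OF assms(1) Ab(1)]) auto
    then have "v = 0\<^sub>v ?N" using Ab(2) v(1) by (intro eq_vecI) auto
    then show False using v(2) by simp
  qed
  from det_non_zero_imp_unit[OF Fc this, of undefined] obtain B where "B \<in> carrier_mat ?N ?N" "B * ?F = 1\<^sub>m ?N" "?F * B = 1\<^sub>m ?N"
    unfolding Units_def ring_mat_def by auto
  then show ?thesis using Fc unfolding invertible_mat_def inverts_mat_def by (auto simp: square_mat.simps)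
qed

end

lemma l2_norm_vec_eq:
  assumes "distinct xs" "v \<in> carrier_vec (length xs)" "\<And>i. i < length xs \<Longrightarrow> f (xs ! i) = vec_index v i"
  shows "l2_norm_vec v = L2_set f (set xs)"
proof -
  have "scalar_prod v v = (\<Sum>i<length xs. vec_index v i * vec_index v i)"
    using assms(2) by (simp only: scalar_prod_def lessThan_atLeast0 carrier_vecD)
  also have "\<dots> = (\<Sum>i<length xs. (f (xs ! i))\<^sup>2)"
    by (rule sum.cong[OF refl]) (simp only: assms(3) lessThan_iff power2_eq_square)
  also have "\<dots> = (\<Sum>x\<in>set xs. (f x)\<^sup>2)"
    by (rule sum_set_distinct[OF assms(1), symmetric])
  finally show ?thesis by (simp only: l2_norm_vec_def L2_set_def)
qed

text \<open>\<open>h0\<close> is the covering radius from \<open>poly_norming\<close>. The condition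
  m > 2 allows the operator to be applied termwise to the kernel series.\<close>

theorem proposition4p4:
  fixes \<alpha> m :: real and mt :: int and \<phi> :: "real \<Rightarrow> real" and \<phi>hat :: "nat \<Rightarrow> real"
  assumes "\<alpha> > 0"
    and "m > 2"
    and "mt \<ge> -1"
    and "is_SBF \<phi> \<phi>hat"
    and "cond_pos_def \<phi> mt"
    and "coeffs_decay \<phi>hat mt m"
  shows "(\<forall>xs. xs \<noteq> [] \<and> distinct xs \<and> set xs \<subseteq> S2 \<and> invertible_mat (augmented_matrix \<phi> mt xs)
            \<longrightarrow> invertible_mat (FD_matrix \<alpha> \<phi> mt xs))
       \<and> (\<exists>h0>0. \<forall>\<rho>0. \<exists>C>0. \<forall>xs B.
            length xs \<ge> 2 \<and> distinct xs \<and> set xs \<subseteq> S2 \<and> invertible_mat (augmented_matrix \<phi> mt xs)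
            \<and> mesh_ratio (set xs) \<le> \<rho>0
            \<and> (mt \<ge> 1 \<longrightarrow> fill_distance (set xs) \<le> h0)
            \<and> inverts_mat (FD_matrix \<alpha> \<phi> mt xs) B \<and> inverts_mat B (FD_matrix \<alpha> \<phi> mt xs)
            \<longrightarrow> l2_op_norm B \<le> C * separation_radius (set xs) powr (2 - 2 * m))"
proof -
  interpret sbf_setting \<alpha> m mt \<phi> \<phi>hat using assms by unfold_locales
  from stability_core obtain h C where h: "h > 0" and C: "C > 0"
    and core: "\<forall>M X A b. 1 \<le> M \<longrightarrow> unisolvent X \<longrightarrow> X \<noteq> {} \<longrightarrow> diag_dominant M X
    \<longrightarrow> (mt \<ge> 1 \<longrightarrow> covers h X) \<longrightarrow> moment_free X A
    \<longrightarrow> L2_set (interpolant X A b) X \<le> C * real M powr (m - 1) * L2_set (helm_interpolant X A b) X"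
    by (elim exE conjE) (rule that)
  from ex_diag_dominant obtain D where D: "D > 0"
    and dom: "\<forall>\<delta> X. 0 < \<delta> \<longrightarrow> \<delta> \<le> 2 \<longrightarrow> finite X \<longrightarrow> X \<subseteq> S2 \<longrightarrow> separated \<delta> X
    \<longrightarrow> (\<exists>M\<ge>1. real M \<le> D / \<delta>\<^sup>2 \<and> diag_dominant M X)"
    by (elim exE conjE) (rule that)
  \<comment> \<open>M is at most D / (q/2)^2 = 4 D / q^2, and this is raised to the power m -
    1.\<close>
  define C' where "C' = C * (4 * D) powr (m - 1)"
  have C': "C' > 0" using C D by (simp add: C'_def)
  have bound: "l2_op_norm B \<le> C' * separation_radius (set xs) powr (2 - 2 * m)"
    if xs: "length xs \<ge> 2" "distinct xs" "set xs \<subseteq> S2" "invertible_mat (augmented_matrix \<phi> mt xs)"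
      and fill: "mt \<ge> 1 \<longrightarrow> fill_distance (set xs) \<le> h"
      and B: "inverts_mat (FD_matrix \<alpha> \<phi> mt xs) B" "inverts_mat B (FD_matrix \<alpha> \<phi> mt xs)" for xs B
  proof -
    let ?F = "FD_matrix \<alpha> \<phi> mt xs" and ?N = "length xs" and ?X = "set xs"
    define q where "q = separation_radius ?X"
    have X: "unisolvent ?X" using xs by (intro augmented_invertible_imp_unisolvent)
    have ne: "?X \<noteq> {}" using xs(1) by auto
    have card: "card ?X \<ge> 2" using xs by (simp add: distinct_card)
    have q: "q > 0" "q / 2 \<le> 2" "separated (q / 2) ?X"
      using separation_radius_bounds[OF finite_set xs(3) card] by (simp_all add: q_def)
    obtain M where M: "1 \<le> M" "real M \<le> D / (q / 2)\<^sup>2" "diag_dominant M ?X"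
    proof -
      have "0 < q / 2" using q(1) by simp
      then have "\<exists>M\<ge>1. real M \<le> D / (q / 2)\<^sup>2 \<and> diag_dominant M ?X"
        by (rule dom[rule_format, OF _ q(2) finite_set xs(3) q(3)])
      then show ?thesis by (elim exE conjE) (rule that)
    qed
    have cover: "mt \<ge> 1 \<longrightarrow> covers h ?X"
    proof (intro impI ballI)
      fix x :: "real ^ 3" assume "1 \<le> mt" "x \<in> S2"
      obtain y where "y \<in> ?X" "dist x y \<le> fill_distance ?X"
        using fill_distance_cover[OF finite_set ne xs(3) \<open>x \<in> S2\<close>] by blast
      moreover have "fill_distance ?X \<le> h" using fill \<open>1 \<le> mt\<close> by blast
      ultimately show "\<exists>y\<in>?X. dist x y \<le> h" by (intro bexI[of _ y]) auto
    qed
    have Mq: "real M powr (m - 1) \<le> (4 * D) powr (m - 1) * q powr (2 - 2 * m)"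
    proof -
      have "real M \<le> (4 * D) * q powr (- 2)"
      proof -
        have "q powr (- 2) = 1 / q\<^sup>2" using q(1) by (simp add: powr_minus_divide)
        then show ?thesis using M(2) by (simp add: power_divide mult.commute)
      qed
      then have "real M powr (m - 1) \<le> ((4 * D) * q powr (- 2)) powr (m - 1)"
        using assms(2) by (intro powr_mono2) auto
      also have "\<dots> = (4 * D) powr (m - 1) * (q powr (- 2)) powr (m - 1)"
        by (rule powr_mult)
      also have "(q powr (- 2)) powr (m - 1) = q powr (2 - 2 * m)"
      proof -
        have "- 2 * (m - 1) = 2 - 2 * m" by simp
        then show ?thesis by (simp only: powr_powr)
      qed
      finally show ?thesis .
    qed
    have Fc: "?F \<in> carrier_mat ?N ?N" by (simp add: FD_matrix_def)
    have FB: "?F * B = 1\<^sub>m ?N" using B(1) Fc by (simp add: inverts_mat_def)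
    have Bc: "B \<in> carrier_mat ?N ?N"
      by (rule inverts_mat_carrier[OF Fc B])
    have le: "l2_norm_vec (B *\<^sub>v w) / l2_norm_vec w \<le> C' * q powr (2 - 2 * m)" if w: "w \<in> carrier_vec ?N - {0\<^sub>v ?N}" for w
    proof -
      have wc: "w \<in> carrier_vec ?N" using w by simp
      define v where "v = B *\<^sub>v w"
      have vc: "v \<in> carrier_vec ?N" using Bc wc by (simp add: v_def)
      have Fv: "?F *\<^sub>v v = w" using wc by (simp only: v_def assoc_mult_mat_vec[OF Fc Bc, symmetric] FB one_mult_mat_vec)
      obtain A b where Ab: "moment_free ?X A" "\<forall>i<?N. interpolant ?X A b (xs ! i) = vec_index v i
        \<and> vec_index (?F *\<^sub>v v) i = helm_interpolant ?X A b (xs ! i)"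
        using FD_matrix_mult[OF X xs(2) vc] by blast
      have lv: "l2_norm_vec v = L2_set (interpolant ?X A b) ?X"
        using Ab(2) by (intro l2_norm_vec_eq xs(2) vc) auto
      have lw: "l2_norm_vec w = L2_set (helm_interpolant ?X A b) ?X"
        using Ab(2) unfolding Fv by (intro l2_norm_vec_eq xs(2) wc) auto
      have "l2_norm_vec v \<le> C * real M powr (m - 1) * l2_norm_vec w"
        unfolding lv lw by (rule core[rule_format, OF M(1) X ne M(3) _ Ab(1)]) (use cover in blast)
      also have "\<dots> \<le> C' * q powr (2 - 2 * m) * l2_norm_vec w"
      proof -
        have "C * real M powr (m - 1) \<le> C' * q powr (2 - 2 * m)"
          using mult_left_mono[OF Mq, of C] C by (simp add: C'_def mult.assoc)
        then show ?thesis by (rule mult_right_mono) (simp add: lw L2_set_nonneg)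
      qed
      finally have "l2_norm_vec v \<le> C' * q powr (2 - 2 * m) * l2_norm_vec w" .
      moreover have "l2_norm_vec w \<ge> 0" by (simp add: lw L2_set_nonneg)
      moreover have "C' * q powr (2 - 2 * m) \<ge> 0" using C' by simp
      ultimately show ?thesis unfolding v_def
        \<comment> \<open>If the norm of w were 0, the quotient would be 0 by convention, so
          positivity of the norm is not proved.\<close>
        by (cases "l2_norm_vec w = 0") (auto simp: pos_divide_le_eq)
    qed
    \<comment> \<open>A witness that the supremum is over a nonempty set; on an empty set its value
      would be unspecified.\<close>
    define e :: "real Matrix.vec" where "e = unit_vec ?N 0"
    have "0 < ?N" using xs(1) by linarith
    then have "vec_index e 0 = 1" "vec_index (0\<^sub>v ?N) 0 = (0 :: real)" by (simp_all add: e_def)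
    then have "e \<noteq> 0\<^sub>v ?N" by auto
    then have "e \<in> carrier_vec ?N - {0\<^sub>v ?N}" by (simp add: e_def)
    then have "carrier_vec ?N - {0\<^sub>v ?N :: real Matrix.vec} \<noteq> {}" by blast
    then have "(SUP w\<in>carrier_vec ?N - {0\<^sub>v ?N}. l2_norm_vec (B *\<^sub>v w) / l2_norm_vec w) \<le> C' * q powr (2 - 2 * m)"
      by (rule cSUP_least) (rule le)
    then show ?thesis unfolding l2_op_norm_def q_def[symmetric] carrier_matD(2)[OF Bc] .
  qed
  show ?thesis
  proof (rule conjI, goal_cases)
    case 1
    show ?case
      using FD_matrix_invertible augmented_invertible_imp_unisolvent by simp
  next
    case 2
    show ?case
    proof (rule exI[of _ h], rule conjI[OF h], rule allI, rule exI[of _ C'], rule conjI[OF C'], intro allI impI, elim conjE)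
    qed (rule bound)
  qed
qed

end
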